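(* Let $n\ge2$, let $a\in C^{\beta}(\mathbb{R}^n)$ for some $\beta\in(0,1]$ with $a\ge0$ and $a\not\equiv0$, and let $V\in C^{\beta}(\mathbb{R}^n-\{0\})$ be real-valued with $\liminf_{x\to0}V(x)>-\infty$. For $p>1$ consider the problem $$u_t=\Delta u-Vu+au^p\ \text{ in }\mathbb{R}^n\times(0,T),\qquad u(x,0)=\phi(x)\ \text{ in }\mathbb{R}^n,$$ where $T\in(0,\infty]$ and $\phi\ge0$, $\phi\not\equiv0$, is bounded and continuous. If there exists a domain $D\subseteq\mathbb{R}^n$ for which $$\inf_{x\in D}a(x)>0\quad\text{and}\quad\lambda_{0;D}(-\Delta+V)<0,$$ then there are no global solutions to the problem for any $p>1$ (and any bounded continuous initial data $\phi\ge0$, $\phi\not\equiv0$).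
   Context: The class $C^\beta$ means Hölder continuous with exponent $\beta$ (locally on the indicated set). A solution on the time interval $(0,T)$ means a nonnegative classical solution $u$ satisfying $\|u(\cdot,t)\|_\infty<\infty$ for $0<t<T$. A solution is called global if $T=\infty$. For a domain $D\subseteq\mathbb{R}^n$, the operator $-\Delta+V$ on $D$ with the Dirichlet boundary condition on $\partial D$ is realized as a self-adjoint operator on $L^2(D)$; its spectrum is denoted $\sigma(-\Delta+V;D)$, and $\lambda_{0;D}(-\Delta+V)\equiv\inf\sigma(-\Delta+V;D)$. *)

theory Defs
  imports "HOL-Analysis.Analysis"
begin

section \<open>Regularity of functions\<close>

definition locally_holder_on :: "real \<Rightarrow> 'a::metric_space set \<Rightarrow> ('a \<Rightarrow> real) \<Rightarrow> bool" where
  "locally_holder_on \<beta> S f \<longleftrightarrow>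
     (\<forall>K. compact K \<and> K \<subseteq> S \<longrightarrow>
        (\<exists>C. \<forall>x\<in>K. \<forall>y\<in>K. \<bar>f x - f y\<bar> \<le> C * dist x y powr \<beta>))"

definition partial :: "'a::euclidean_space \<Rightarrow> ('a \<Rightarrow> 'b::real_normed_vector) \<Rightarrow> 'a \<Rightarrow> 'b" where
  "partial b f x = frechet_derivative f (at x) b"

definition laplacian :: "('a::euclidean_space \<Rightarrow> 'b::real_normed_vector) \<Rightarrow> 'a \<Rightarrow> 'b" where
  "laplacian f x = (\<Sum>b\<in>Basis. partial b (partial b f) x)"

text \<open>Intended for open \<open>S\<close> only: the derivatives are taken with respect to the whole space.\<close>

primrec Ck_on :: "nat \<Rightarrow> 'a::euclidean_space set \<Rightarrow> ('a \<Rightarrow> 'b::real_normed_vector) \<Rightarrow> bool" where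
  "Ck_on 0 S f \<longleftrightarrow> continuous_on S f"
| "Ck_on (Suc k) S f \<longleftrightarrow>
     (\<forall>x\<in>S. f differentiable (at x)) \<and> (\<forall>b\<in>Basis. Ck_on k S (partial b f))"

definition test_function :: "'a::euclidean_space set \<Rightarrow> ('a \<Rightarrow> 'b::real_normed_vector) \<Rightarrow> bool" where
  "test_function D \<eta> \<longleftrightarrow>
     (\<forall>k. Ck_on k UNIV \<eta>) \<and> compact (closure {x. \<eta> x \<noteq> 0}) \<and> closure {x. \<eta> x \<noteq> 0} \<subseteq> D"

section \<open>Unbounded operators on complex \<open>L\<^sup>2(D)\<close>\<close>

text \<open>Elements of \<open>L\<^sup>2(D)\<close> are represented by functions on the whole space whose values outside
  \<open>D\<close> are irrelevant; equality is equality almost everywhere on \<open>D\<close>.\<close>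

definition L2 :: "'a::euclidean_space set \<Rightarrow> ('a \<Rightarrow> complex) set" where
  "L2 D = {f. f \<in> borel_measurable (lebesgue_on D) \<and>
              integrable (lebesgue_on D) (\<lambda>x. (cmod (f x))\<^sup>2)}"

definition L2_inner :: "'a::euclidean_space set \<Rightarrow> ('a \<Rightarrow> complex) \<Rightarrow> ('a \<Rightarrow> complex) \<Rightarrow> complex" where
  "L2_inner D f g = (LINT x|lebesgue_on D. f x * cnj (g x))"

definition L2_norm :: "'a::euclidean_space set \<Rightarrow> ('a \<Rightarrow> complex) \<Rightarrow> real" where
  "L2_norm D f = sqrt (LINT x|lebesgue_on D. (cmod (f x))\<^sup>2)"

text \<open>An operator is given by its graph: \<open>(f, g) \<in> H\<close> means that \<open>f\<close> is in the domain of \<open>H\<close> and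
  \<open>H f = g\<close>.\<close>

type_synonym 'a graph = "(('a \<Rightarrow> complex) \<times> ('a \<Rightarrow> complex)) set"

definition linear_operator :: "'a::euclidean_space set \<Rightarrow> 'a graph \<Rightarrow> bool" where
  "linear_operator D H \<longleftrightarrow>
     H \<subseteq> L2 D \<times> L2 D \<and>
     (\<lambda>x. 0, \<lambda>x. 0) \<in> H \<and>
     (\<forall>f g f' g'. (f, g) \<in> H \<and> (f', g') \<in> H \<longrightarrow> (\<lambda>x. f x + f' x, \<lambda>x. g x + g' x) \<in> H) \<and>
     (\<forall>c f g. (f, g) \<in> H \<longrightarrow> (\<lambda>x. c * f x, \<lambda>x. c * g x) \<in> H) \<and>
     (\<forall>f g g'. (f, g) \<in> H \<and> (f, g') \<in> H \<longrightarrow> (AE x in lebesgue_on D. g x = g' x))"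

definition densely_defined :: "'a::euclidean_space set \<Rightarrow> 'a graph \<Rightarrow> bool" where
  "densely_defined D H \<longleftrightarrow>
     (\<forall>h\<in>L2 D. \<forall>\<epsilon>>0. \<exists>(f, g)\<in>H. L2_norm D (\<lambda>x. h x - f x) < \<epsilon>)"

definition adjoint_graph :: "'a::euclidean_space set \<Rightarrow> 'a graph \<Rightarrow> 'a graph" where
  "adjoint_graph D H =
     {(h, k). h \<in> L2 D \<and> k \<in> L2 D \<and> (\<forall>(f, g)\<in>H. L2_inner D g h = L2_inner D f k)}"

definition self_adjoint :: "'a::euclidean_space set \<Rightarrow> 'a graph \<Rightarrow> bool" where
  "self_adjoint D H \<longleftrightarrow> linear_operator D H \<and> densely_defined D H \<and> adjoint_graph D H = H"

definition resolvent_set :: "'a::euclidean_space set \<Rightarrow> 'a graph \<Rightarrow> complex set" where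
  "resolvent_set D H =
     {z. (\<exists>C. \<forall>(f, g)\<in>H. L2_norm D f \<le> C * L2_norm D (\<lambda>x. g x - z * f x)) \<and>
         (\<forall>h\<in>L2 D. \<exists>(f, g)\<in>H. AE x in lebesgue_on D. g x - z * f x = h x)}"

definition spectrum :: "'a::euclidean_space set \<Rightarrow> 'a graph \<Rightarrow> complex set" where
  "spectrum D H = - resolvent_set D H"

text \<open>The spectrum of a self-adjoint operator is real, so taking real parts only changes the type.
  The infimum is extended real because the spectrum may be unbounded below.\<close>

definition inf_spectrum :: "'a::euclidean_space set \<Rightarrow> 'a graph \<Rightarrow> ereal" where
  "inf_spectrum D H = (INF z\<in>spectrum D H. ereal (Re z))"

section \<open>The Dirichlet realization of \<open>- \<Delta> + V\<close>\<close>

definition H10 :: "'a::euclidean_space set \<Rightarrow> ('a \<Rightarrow> complex) set" where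
  "H10 D = {f \<in> L2 D. \<exists>\<eta> F.
     (\<forall>k::nat. test_function D (\<eta> k)) \<and>
     (\<lambda>k. L2_norm D (\<lambda>x. \<eta> k x - f x)) \<longlonglongrightarrow> 0 \<and>
     (\<forall>b\<in>Basis. F b \<in> L2 D \<and> (\<lambda>k. L2_norm D (\<lambda>x. partial b (\<eta> k) x - F b x)) \<longlonglongrightarrow> 0)}"

text \<open>The Dirichlet condition in local form. For bounded \<open>D\<close> this is just membership in \<open>H10 D\<close>.
  For unbounded \<open>D\<close> the gradient of a function in the operator domain need not be globally square
  integrable when \<open>V\<close> is unbounded below at infinity.\<close>

definition H10_loc :: "'a::euclidean_space set \<Rightarrow> ('a \<Rightarrow> complex) set" where
  "H10_loc D = {f. \<forall>\<zeta>. test_function UNIV \<zeta> \<longrightarrow> (\<lambda>x. \<zeta> x * f x) \<in> H10 D}"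

text \<open>All \<open>f \<in> L\<^sup>2(D)\<close> satisfying the Dirichlet condition for which \<open>g = - \<Delta> f + V f\<close>, in the sense of
  distributions, is in \<open>L\<^sup>2(D)\<close>. The origin, where \<open>V\<close> is undefined, is excluded from the supports
  of the test functions.\<close>

definition dirichlet_graph :: "'a::euclidean_space set \<Rightarrow> ('a \<Rightarrow> real) \<Rightarrow> 'a graph" where
  "dirichlet_graph D V =
     {(f, g). f \<in> L2 D \<and> g \<in> L2 D \<and> f \<in> H10_loc D \<and>
        (\<forall>\<eta>::'a \<Rightarrow> real. test_function (D - {0}) \<eta> \<longrightarrow>
           (LINT x|lebesgue_on D. f x * of_real (- laplacian \<eta> x + V x * \<eta> x)) =
           (LINT x|lebesgue_on D. g x * of_real (\<eta> x)))}"

text \<open>Every such \<open>H\<close> extends \<open>- \<Delta> + V\<close> on the test functions on \<open>D - {0}\<close>, because \<open>H\<close> equals its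
  adjoint. In dimension at least two, for \<open>V\<close> locally bounded off the origin and bounded below
  near it, if the quadratic form of \<open>- \<Delta> + V\<close> on these test functions is bounded below, then \<open>H\<close> is
  unique: it is the Friedrichs extension, and equals \<open>dirichlet_graph D V\<close>. If the form is not
  bounded below, no choice of \<open>H\<close> is singled out, and every \<open>H\<close> has \<open>inf_spectrum D H = - \<infinity>\<close>.\<close>

definition dirichlet_realization ::
  "'a::euclidean_space set \<Rightarrow> ('a \<Rightarrow> real) \<Rightarrow> 'a graph \<Rightarrow> bool" where
  "dirichlet_realization D V H \<longleftrightarrow> self_adjoint D H \<and> H \<subseteq> dirichlet_graph D V"

section \<open>Classical solutions\<close>

text \<open>Nonnegative solutions of \<open>u_t = \<Delta>u - V u + a u^p\<close>, \<open>u(\<cdot>, 0) = \<phi>\<close>, on \<open>(0, T)\<close>. Since \<open>V\<close> is defined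
  only off the origin, the equation, and with it the regularity of \<open>u\<close>, is required only there.\<close>

definition solution ::
  "('a::euclidean_space \<Rightarrow> real) \<Rightarrow> ('a \<Rightarrow> real) \<Rightarrow> real \<Rightarrow> ('a \<Rightarrow> real) \<Rightarrow> ereal \<Rightarrow> ('a \<Rightarrow> real \<Rightarrow> real) \<Rightarrow> bool"
  where
  "solution V a p \<phi> T u \<longleftrightarrow>
     (let I = {t. 0 < t \<and> ereal t < T}; I0 = {t. 0 \<le> t \<and> ereal t < T}; S = - {0} in
       0 < T \<and>
       (\<forall>x. \<forall>t\<in>I0. 0 \<le> u x t) \<and>
       (\<forall>t\<in>I. bounded (range (\<lambda>x. u x t))) \<and>
       (\<forall>x. u x 0 = \<phi> x) \<and>
       continuous_on (S \<times> I0) (\<lambda>(x, t). u x t) \<and>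
       (\<forall>x\<in>S. \<forall>t\<in>I. u x differentiable (at t)) \<and>
       (\<forall>t\<in>I. Ck_on 2 S (\<lambda>x. u x t)) \<and>
       continuous_on (S \<times> I) (\<lambda>(x, t). deriv (u x) t) \<and>
       (\<forall>b\<in>Basis. continuous_on (S \<times> I) (\<lambda>(x, t). partial b (\<lambda>y. u y t) x)) \<and>
       (\<forall>b\<in>Basis. \<forall>c\<in>Basis.
          continuous_on (S \<times> I) (\<lambda>(x, t). partial b (partial c (\<lambda>y. u y t)) x)) \<and>
       (\<forall>x\<in>S. \<forall>t\<in>I.
          deriv (u x) t = laplacian (\<lambda>y. u y t) x - V x * u x t + a x * u x t powr p))"

definition global_solution ::
  "('a::euclidean_space \<Rightarrow> real) \<Rightarrow> ('a \<Rightarrow> real) \<Rightarrow> real \<Rightarrow> ('a \<Rightarrow> real) \<Rightarrow> ('a \<Rightarrow> real \<Rightarrow> real) \<Rightarrow> bool"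
  where
  "global_solution V a p \<phi> u \<longleftrightarrow> solution V a p \<phi> \<infinity> u"

end

theory Submission
  imports Defs
begin

text \<open>Suppose \<open>u\<close> is a global solution. By the strong maximum principle it is positive off the origin for
  positive times. For a test function \<open>\<eta>\<close> on \<open>D - {0}\<close> put \<open>G(t) = \<integral> \<eta>\<^sup>2 ln u(\<cdot>, t)\<close>. Since
  \<open>\<integral> \<eta>\<^sup>2 \<Delta>u / u \<ge> - \<integral> \<bar>\<nabla>\<eta>\<bar>\<^sup>2\<close>, Jensen's inequality gives
  \<open>G' \<ge> - q(\<eta>) + \<alpha> m exp ((p - 1) G / m)\<close> with \<open>q(\<eta>) = \<integral> \<bar>\<nabla>\<eta>\<bar>\<^sup>2 + V \<eta>\<^sup>2\<close>, \<open>m = \<integral> \<eta>\<^sup>2\<close> and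
  \<open>\<alpha> = inf a\<close> over \<open>D\<close>. If \<open>q(\<eta>) < 0\<close>, then \<open>G\<close> becomes infinite in finite time; so \<open>q \<ge> 0\<close>. Localizing with
  cutoffs at infinity and, since a point has zero capacity in dimension at least two, at the origin, one
  gets \<open>Re \<langle>Hf, f\<rangle> \<ge> 0\<close> on the whole operator domain, hence \<open>\<sigma>(H) \<subseteq> [0, \<infinity>)\<close>.\<close>

section \<open>Square-integrable functions\<close>

text \<open>The time derivative of \<open>ln u\<close> is
  \<open>\<Delta>u / u - V + a u^(p-1)\<close>, and the first term tested with \<eta>^2 is bounded
  below without any information on \<open>u\<close>. Hence neither an eigenfunction on
  \<open>D\<close> nor the boundary behaviour of \<open>u\<close> enters, and every p > 1 is treated
  alike. On the operator side there are two obstacles. A function in the domain of H has a gradient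
  that is square integrable only locally, so <Hf, f> is not directly the form of f and must be
  recovered as a limit over cutoffs \<zeta>. Moreover the error of a cutoff is the integral of |grad
  \<zeta>|^2 f^2, where f may be unbounded at the origin; the usual capacity estimate, made for
  bounded f, is not enough. A logarithmic Hardy inequality bounds this error by \<kappa>^2 times a
  squared H^1 norm of f on a ball. That norm depends on the ball in an unknown way, which is why
  \<kappa> is chosen only after the radius and the norm are fixed.\<close>

definition sqint :: "'x measure \<Rightarrow> ('x \<Rightarrow> 'b::{real_normed_field,banach,second_countable_topology}) \<Rightarrow> bool" where
  "sqint M f \<longleftrightarrow> f \<in> borel_measurable M \<and> integrable M (\<lambda>x. (norm (f x))\<^sup>2)"

definition nrm :: "'x measure \<Rightarrow> ('x \<Rightarrow> 'b::{real_normed_field,banach,second_countable_topology}) \<Rightarrow> real" where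
  "nrm M f = sqrt (LINT x|M. (norm (f x))\<^sup>2)"

lemma nrm_nonneg [simp]: "0 \<le> nrm M f"
  unfolding nrm_def by simp

lemma nrm_sq: "(nrm M f)\<^sup>2 = (LINT x|M. (norm (f x))\<^sup>2)"
  unfolding nrm_def by simp

lemma sqint_mult_integrable:
  fixes f g :: "'x \<Rightarrow> 'b::{real_normed_field,banach,second_countable_topology}"
  assumes "sqint M f" "sqint M g"
  shows "integrable M (\<lambda>x. f x * g x)"
proof (rule Bochner_Integration.integrable_bound)
  show "integrable M (\<lambda>x. (norm (f x))\<^sup>2 + (norm (g x))\<^sup>2)"
    using assms unfolding sqint_def by simp
  show "(\<lambda>x. f x * g x) \<in> borel_measurable M"
    using assms unfolding sqint_def by (intro borel_measurable_times) auto
  have "norm (f x) * norm (g x) \<le> (norm (f x))\<^sup>2 + (norm (g x))\<^sup>2" for x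
    using sum_squares_bound[of "norm (f x)" "norm (g x)"]
      mult_nonneg_nonneg[OF norm_ge_zero[of "f x"] norm_ge_zero[of "g x"]] by linarith
  then show "AE x in M. norm (f x * g x) \<le> norm ((norm (f x))\<^sup>2 + (norm (g x))\<^sup>2)"
    by (simp add: norm_mult)
qed

lemma sqint_norm: "sqint M f \<Longrightarrow> sqint M (\<lambda>x. norm (f x))"
  unfolding sqint_def by (auto intro: borel_measurable_norm)

lemma sqint_cmult:
  assumes "sqint M f" shows "sqint M (\<lambda>x. c * f x)"
  using assms unfolding sqint_def by (auto simp: norm_mult power_mult_distrib intro: borel_measurable_times)

lemma nrm_cmult: "nrm M (\<lambda>x. c * f x) = norm c * nrm M f"
  unfolding nrm_def by (simp add: norm_mult power_mult_distrib real_sqrt_mult)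

lemma sqint_add:
  fixes f g :: "'x \<Rightarrow> 'b::{real_normed_field,banach,second_countable_topology}"
  assumes "sqint M f" "sqint M g" shows "sqint M (\<lambda>x. f x + g x)"
proof -
  have m: "(\<lambda>x. f x + g x) \<in> borel_measurable M"
    using assms unfolding sqint_def by (intro borel_measurable_add) auto
  have "integrable M (\<lambda>x. (norm (f x + g x))\<^sup>2)"
  proof (rule Bochner_Integration.integrable_bound)
    show "integrable M (\<lambda>x. 2 * (norm (f x))\<^sup>2 + 2 * (norm (g x))\<^sup>2)"
      using assms unfolding sqint_def by simp
    show "(\<lambda>x. (norm (f x + g x))\<^sup>2) \<in> borel_measurable M"
      using m by measurable
    have "(norm (f x + g x))\<^sup>2 \<le> 2 * (norm (f x))\<^sup>2 + 2 * (norm (g x))\<^sup>2" for x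
    proof -
      have "(norm (f x + g x))\<^sup>2 \<le> (norm (f x) + norm (g x))\<^sup>2"
        by (intro power_mono norm_triangle_ineq) auto
      also have "\<dots> \<le> 2 * (norm (f x))\<^sup>2 + 2 * (norm (g x))\<^sup>2"
        using sum_squares_bound[of "norm (f x)" "norm (g x)"] by (simp add: power2_sum)
      finally show ?thesis .
    qed
    then show "AE x in M. norm ((norm (f x + g x))\<^sup>2) \<le> norm (2 * (norm (f x))\<^sup>2 + 2 * (norm (g x))\<^sup>2)"
      by simp
  qed
  with m show ?thesis unfolding sqint_def by simp
qed

lemma sqint_diff:
  fixes f g :: "'x \<Rightarrow> 'b::{real_normed_field,banach,second_countable_topology}"
  assumes "sqint M f" "sqint M g" shows "sqint M (\<lambda>x. f x - g x)"
  using sqint_add[OF assms(1) sqint_cmult[OF assms(2), of "-1"]] by simp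

lemma sqint_mult_bounded:
  fixes f w :: "'x \<Rightarrow> 'b::{real_normed_field,banach,second_countable_topology}"
  assumes "sqint M f" "w \<in> borel_measurable M" "\<And>x. x \<in> space M \<Longrightarrow> norm (w x) \<le> C"
  shows "sqint M (\<lambda>x. w x * f x)"
proof -
  have m: "(\<lambda>x. w x * f x) \<in> borel_measurable M"
    using assms unfolding sqint_def by (intro borel_measurable_times) auto
  have "integrable M (\<lambda>x. (norm (w x * f x))\<^sup>2)"
  proof (rule Bochner_Integration.integrable_bound)
    show "integrable M (\<lambda>x. C\<^sup>2 * (norm (f x))\<^sup>2)"
      using assms unfolding sqint_def by simp
    show "(\<lambda>x. (norm (w x * f x))\<^sup>2) \<in> borel_measurable M"
      using m by measurable
    show "AE x in M. norm ((norm (w x * f x))\<^sup>2) \<le> norm (C\<^sup>2 * (norm (f x))\<^sup>2)"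
      using assms(3) by (intro AE_I2) (simp add: norm_mult power_mult_distrib mult_right_mono power_mono)
  qed
  with m show ?thesis unfolding sqint_def by simp
qed

section \<open>Cauchy-Schwarz, Minkowski and completeness\<close>

lemma Cauchy_Schwarz_integral_norm:
  fixes f g :: "'x \<Rightarrow> 'b::{real_normed_field,banach,second_countable_topology}"
  assumes f: "sqint M f" and g: "sqint M g"
  shows "(LINT x|M. norm (f x) * norm (g x)) \<le> nrm M f * nrm M g"
proof -
  define A where "A = (nrm M f)\<^sup>2"
  define B where "B = (LINT x|M. norm (f x) * norm (g x))"
  define C where "C = (nrm M g)\<^sup>2"
  have ifg: "integrable M (\<lambda>x. norm (f x) * norm (g x))"
    by (rule sqint_mult_integrable[OF sqint_norm[OF f] sqint_norm[OF g]])
  \<comment> \<open>The integral of \<open>(s * norm (f x) + norm (g x))\<^sup>2\<close> as a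
    polynomial in \<open>s\<close>. Its nonnegativity for every \<open>s\<close> forces
    \<open>B\<^sup>2 \<le> A * C\<close>.\<close>
  have q: "0 \<le> A * s\<^sup>2 + 2 * B * s + C" for s
  proof -
    have "0 \<le> (LINT x|M. (s * norm (f x) + norm (g x))\<^sup>2)"
      by (rule integral_nonneg_AE) simp
    also have "\<dots> = (LINT x|M. s\<^sup>2 * (norm (f x))\<^sup>2 + (2 * s * (norm (f x) * norm (g x)) + (norm (g x))\<^sup>2))"
      by (rule Bochner_Integration.integral_cong) (auto simp: power2_sum power_mult_distrib)
    also have "\<dots> = A * s\<^sup>2 + 2 * B * s + C"
      using f g ifg unfolding sqint_def A_def B_def C_def nrm_sq by simp
    finally show ?thesis .
  qed
  have A0: "A \<ge> 0" and C0: "C \<ge> 0" unfolding A_def C_def by auto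
  have "B\<^sup>2 \<le> A * C"
  proof (cases "A = 0")
    case True
    show ?thesis
    proof (cases "B = 0")
      case True then show ?thesis using A0 C0 by simp
    next
      case False
      \<comment> \<open>For \<open>A = 0\<close> the polynomial is affine; at this \<open>s\<close>
        its value would be -1.\<close>
      have "0 \<le> 2 * B * (- (C + 1) / (2 * B)) + C" using q[of "- (C + 1) / (2 * B)"] True by simp
      then show ?thesis using False by (simp add: field_simps)
    qed
  next
    case False
    then have "A > 0" using A0 by simp
    have "0 \<le> A * (A * (- B / A)\<^sup>2 + 2 * B * (- B / A) + C)"
      using q[of "- B / A"] A0 by (intro mult_nonneg_nonneg) auto
    also have "\<dots> = A * C - B\<^sup>2"
      using \<open>A > 0\<close> by (simp add: field_simps power2_eq_square)
    finally show ?thesis by simp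
  qed
  then have "B\<^sup>2 \<le> (nrm M f * nrm M g)\<^sup>2" unfolding A_def C_def by (simp add: power_mult_distrib)
  then show ?thesis unfolding B_def by (rule power2_le_imp_le) simp
qed

lemma Cauchy_Schwarz_integral:
  fixes f g :: "'x \<Rightarrow> 'b::{real_normed_field,banach,second_countable_topology}"
  assumes f: "sqint M f" and g: "sqint M g"
  shows "norm (LINT x|M. f x * g x) \<le> nrm M f * nrm M g"
proof -
  have "norm (LINT x|M. f x * g x) \<le> (LINT x|M. norm (f x * g x))" by simp
  also have "\<dots> = (LINT x|M. norm (f x) * norm (g x))" by (simp add: norm_mult)
  also have "\<dots> \<le> nrm M f * nrm M g" by (rule Cauchy_Schwarz_integral_norm[OF f g])
  finally show ?thesis .
qed

lemma nrm_triangle: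
  fixes f g :: "'x \<Rightarrow> 'b::{real_normed_field,banach,second_countable_topology}"
  assumes f: "sqint M f" and g: "sqint M g"
  shows "nrm M (\<lambda>x. f x + g x) \<le> nrm M f + nrm M g"
proof -
  have ifg: "integrable M (\<lambda>x. norm (f x) * norm (g x))"
    by (rule sqint_mult_integrable[OF sqint_norm[OF f] sqint_norm[OF g]])
  have "(nrm M (\<lambda>x. f x + g x))\<^sup>2 \<le> (LINT x|M. (norm (f x))\<^sup>2 + (2 * (norm (f x) * norm (g x)) + (norm (g x))\<^sup>2))"
    unfolding nrm_sq
  proof (rule integral_mono)
    show "integrable M (\<lambda>x. (norm (f x + g x))\<^sup>2)"
      using sqint_add[OF f g] unfolding sqint_def by simp
    show "integrable M (\<lambda>x. (norm (f x))\<^sup>2 + (2 * (norm (f x) * norm (g x)) + (norm (g x))\<^sup>2))"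
      using f g ifg unfolding sqint_def by simp
    show "(norm (f x + g x))\<^sup>2 \<le> (norm (f x))\<^sup>2 + (2 * (norm (f x) * norm (g x)) + (norm (g x))\<^sup>2)" for x
    proof -
      have "(norm (f x + g x))\<^sup>2 \<le> (norm (f x) + norm (g x))\<^sup>2"
        by (intro power_mono norm_triangle_ineq) auto
      then show ?thesis by (simp add: power2_sum)
    qed
  qed
  also have "\<dots> = (nrm M f)\<^sup>2 + 2 * (LINT x|M. norm (f x) * norm (g x)) + (nrm M g)\<^sup>2"
    using f g ifg unfolding sqint_def nrm_sq by simp
  also have "\<dots> \<le> (nrm M f)\<^sup>2 + 2 * (nrm M f * nrm M g) + (nrm M g)\<^sup>2"
    using Cauchy_Schwarz_integral_norm[OF f g] by simp
  also have "\<dots> = (nrm M f + nrm M g)\<^sup>2" by (simp add: power2_sum)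
  finally show ?thesis by (rule power2_le_imp_le) simp
qed

text \<open>Along a subsequence the increments are so small that \<open>\<Sum> 2^k |f_(k+1) - f_k|\<^sup>2\<close> is integrable,
  hence finite almost everywhere.\<close>

lemma sqint_complete:
  fixes f :: "nat \<Rightarrow> 'x \<Rightarrow> 'b::{real_normed_field,banach,second_countable_topology}"
  assumes f: "\<And>k. sqint M (f k)"
    and cauchy: "\<And>e. e > 0 \<Longrightarrow> \<exists>N. \<forall>m\<ge>N. \<forall>n\<ge>N. nrm M (\<lambda>x. f m x - f n x) < e"
  obtains h where "sqint M h" "(\<lambda>k. nrm M (\<lambda>x. f k x - h x)) \<longlonglongrightarrow> 0"
proof -
  have "\<exists>N. \<forall>m\<ge>N. \<forall>n\<ge>N. nrm M (\<lambda>x. f m x - f n x) < (1/2)^k" for k :: nat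
    by (rule cauchy) simp
  then obtain N where N: "\<And>k m n. m \<ge> N k \<Longrightarrow> n \<ge> N k \<Longrightarrow> nrm M (\<lambda>x. f m x - f n x) < (1/2)^k"
    by metis
  \<comment> \<open>The maximum makes \<open>r\<close> strictly increasing with
    \<open>r k \<ge> N k\<close>, so consecutive members of the subsequence differ by less than
    (1/2)^k in norm.\<close>
  define r where "r = rec_nat (N 0) (\<lambda>k m. max (Suc m) (N (Suc k)))"
  have r_Suc: "r (Suc k) > r k" for k unfolding r_def by simp
  have r_N: "r k \<ge> N k" for k unfolding r_def by (cases k) auto
  have sm: "strict_mono r" by (simp add: strict_mono_Suc_iff r_Suc)
  define d where "d k x = (norm (f (r (Suc k)) x - f (r k) x))\<^sup>2" for k x
  have dint: "integrable M (d k)" for k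
    using sqint_diff[OF f f] unfolding sqint_def d_def by blast
  have d_nonneg: "0 \<le> d k x" for k x unfolding d_def by simp
  have dle: "(LINT x|M. d k x) \<le> (1/4)^k" for k
  proof -
    have "(LINT x|M. d k x) = (nrm M (\<lambda>x. f (r (Suc k)) x - f (r k) x))\<^sup>2"
      unfolding nrm_sq d_def ..
    also have "\<dots> \<le> ((1/2)^k)\<^sup>2"
      using N[OF order.trans[OF r_N less_imp_le[OF r_Suc]] r_N, of k] by (intro power_mono) auto
    also have "\<dots> = (1/4)^k" by (simp add: power2_eq_square flip: power_mult_distrib)
    finally show ?thesis .
  qed
  have dm[measurable]: "d k \<in> borel_measurable M" for k using dint by auto
  have "(\<integral>\<^sup>+x. (\<Sum>k. ennreal (2^k * d k x)) \<partial>M) = (\<Sum>k. \<integral>\<^sup>+x. ennreal (2^k * d k x) \<partial>M)"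
    by (rule nn_integral_suminf) measurable
  also have "\<dots> \<le> (\<Sum>k. ennreal ((1/2)^k))"
  proof (rule suminf_le)
    fix k
    have "(\<integral>\<^sup>+x. ennreal (2^k * d k x) \<partial>M) = ennreal (LINT x|M. 2^k * d k x)"
      by (rule nn_integral_eq_integral) (use dint[of k] in \<open>auto simp: d_nonneg\<close>)
    also have "\<dots> \<le> ennreal (2^k * (1/4)^k)"
      using dle[of k] by (intro ennreal_leI) simp
    also have "2^k * (1/4)^k = ((1/2)^k :: real)" by (simp flip: power_mult_distrib)
    finally show "(\<integral>\<^sup>+x. ennreal (2^k * d k x) \<partial>M) \<le> ennreal ((1/2)^k)" .
  qed auto
  also have "\<dots> = ennreal (\<Sum>k. (1/2)^k)"
    by (rule suminf_ennreal2) (auto intro: summable_geometric)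
  also have "\<dots> < \<infinity>" by simp
  finally have "(\<integral>\<^sup>+x. (\<Sum>k. ennreal (2^k * d k x)) \<partial>M) \<noteq> \<infinity>" by simp
  then have AE1: "AE x in M. (\<Sum>k. ennreal (2^k * d k x)) \<noteq> \<infinity>"
    by (rule nn_integral_PInf_AE[rotated]) measurable
  have AE2: "AE x in M. convergent (\<lambda>k. f (r k) x)"
    using AE1
  proof eventually_elim
    case (elim x)
    have "summable (\<lambda>k. 2^k * d k x)"
      using elim by (intro summable_suminf_not_top) (auto simp: d_def)
    then have "(\<lambda>k. 2^k * d k x) \<longlonglongrightarrow> 0" by (rule summable_LIMSEQ_zero)
    then have "Bseq (\<lambda>k. 2^k * d k x)" by (intro convergent_imp_Bseq convergentI)
    then obtain C where C: "C > 0" "\<And>k. norm (2^k * d k x) \<le> C" by (auto elim: BseqE)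
    \<comment> \<open>The terms of a convergent series are bounded, so the squared increments are at
      most C / 2^k at this point, and the increments are dominated by a geometric series of ratio
      sqrt (1/2).\<close>
    have b: "norm (f (r (Suc k)) x - f (r k) x) \<le> sqrt C * (sqrt (1/2))^k" for k
    proof -
      have "(norm (f (r (Suc k)) x - f (r k) x))\<^sup>2 \<le> C * (1/2)^k"
        using C(2)[of k] unfolding d_def by (simp add: field_simps power_divide)
      then have "norm (f (r (Suc k)) x - f (r k) x) \<le> sqrt (C * (1/2)^k)"
        by (rule real_le_rsqrt)
      then show ?thesis by (simp add: real_sqrt_mult real_sqrt_power)
    qed
    have "sqrt (1/2) < sqrt 1" by (rule real_sqrt_less_mono) simp
    then have sg: "summable (\<lambda>k. sqrt C * (sqrt (1/2))^k)"
      by (intro summable_mult summable_geometric) simp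
    have "summable (\<lambda>k. f (r (Suc k)) x - f (r k) x)"
      by (rule summable_comparison_test'[OF sg, of 0]) (use b in auto)
    then have "convergent (\<lambda>n. \<Sum>k<n. f (r (Suc k)) x - f (r k) x)"
      by (simp add: summable_iff_convergent)
    then have "convergent (\<lambda>n. f (r n) x - f (r 0) x)"
      by (simp add: sum_lessThan_telescope[of "\<lambda>k. f (r k) x"])
    then show ?case by (simp add: convergent_diff_const_right_iff)
  qed
  \<comment> \<open>On the null set of divergence \<open>lim\<close> has an unspecified value;
    \<open>h\<close> is measurable all the same.\<close>
  define h where "h x = lim (\<lambda>k. f (r k) x)" for x
  have fm[measurable]: "f k \<in> borel_measurable M" for k using f unfolding sqint_def by blast
  have hm[measurable]: "h \<in> borel_measurable M" unfolding h_def by measurable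
  have AE3: "AE x in M. (\<lambda>k. f (r k) x) \<longlonglongrightarrow> h x"
    using AE2 unfolding h_def by eventually_elim (simp add: convergent_LIMSEQ_iff)
  \<comment> \<open>Fatou's lemma along the subsequence: the distance from \<open>f m\<close> to
    \<open>h\<close> is at most the lower limit of its distances to \<open>f (r j)\<close>.\<close>
  have key: "sqint M (\<lambda>x. f m x - h x) \<and> nrm M (\<lambda>x. f m x - h x) \<le> (1/2)^k" if "m \<ge> N k" for m k
  proof -
    have "(\<integral>\<^sup>+x. ennreal ((norm (f m x - h x))\<^sup>2) \<partial>M) = (\<integral>\<^sup>+x. liminf (\<lambda>j. ennreal ((norm (f m x - f (r j) x))\<^sup>2)) \<partial>M)"
    proof (rule nn_integral_cong_AE)
      show "AE x in M. ennreal ((norm (f m x - h x))\<^sup>2) = liminf (\<lambda>j. ennreal ((norm (f m x - f (r j) x))\<^sup>2))"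
        using AE3
      proof eventually_elim
        case (elim x)
        have "(\<lambda>j. ennreal ((norm (f m x - f (r j) x))\<^sup>2)) \<longlonglongrightarrow> ennreal ((norm (f m x - h x))\<^sup>2)"
          by (intro tendsto_intros elim)
        then show ?case by (intro lim_imp_Liminf[symmetric]) simp
      qed
    qed
    also have "\<dots> \<le> liminf (\<lambda>j. \<integral>\<^sup>+x. ennreal ((norm (f m x - f (r j) x))\<^sup>2) \<partial>M)"
      by (rule nn_integral_liminf) measurable
    also have "\<dots> \<le> liminf (\<lambda>j::nat. ennreal (((1/2)^k)\<^sup>2))"
    proof (rule Liminf_mono, rule eventually_sequentiallyI[of k])
      fix j assume "k \<le> j"
      then have "r j \<ge> N k" using r_N[of k] strict_mono_less_eq[OF sm, of k j] by linarith
      have "(\<integral>\<^sup>+x. ennreal ((norm (f m x - f (r j) x))\<^sup>2) \<partial>M) = ennreal (LINT x|M. (norm (f m x - f (r j) x))\<^sup>2)"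
        by (rule nn_integral_eq_integral) (use sqint_diff[OF f f] in \<open>auto simp: sqint_def\<close>)
      also have "\<dots> \<le> ennreal (((1/2)^k)\<^sup>2)"
        unfolding nrm_sq[symmetric] using N[OF that \<open>r j \<ge> N k\<close>]
        by (intro ennreal_leI power_mono) auto
      finally show "(\<integral>\<^sup>+x. ennreal ((norm (f m x - f (r j) x))\<^sup>2) \<partial>M) \<le> ennreal (((1/2)^k)\<^sup>2)" .
    qed
    also have "\<dots> = ennreal (((1/2)^k)\<^sup>2)" by (simp add: Liminf_const)
    finally have le: "(\<integral>\<^sup>+x. ennreal ((norm (f m x - h x))\<^sup>2) \<partial>M) \<le> ennreal (((1/2)^k)\<^sup>2)" .
    have int: "integrable M (\<lambda>x. (norm (f m x - h x))\<^sup>2)"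
      by (rule integrableI_nonneg) (use le in \<open>auto intro: le_less_trans\<close>)
    have "(LINT x|M. (norm (f m x - h x))\<^sup>2) \<le> ((1/2)^k)\<^sup>2"
      using le nn_integral_eq_integral[OF int] by (simp add: ennreal_le_iff)
    then have "nrm M (\<lambda>x. f m x - h x) \<le> (1/2)^k"
      unfolding nrm_sq[symmetric] by (rule power2_le_imp_le) simp
    then show ?thesis using int unfolding sqint_def by simp
  qed
  show ?thesis
  proof
    have "sqint M (\<lambda>x. f (N 0) x - (f (N 0) x - h x))"
      by (rule sqint_diff[OF f]) (use key[of 0 "N 0"] in auto)
    then show "sqint M h" by simp
    show "(\<lambda>k. nrm M (\<lambda>x. f k x - h x)) \<longlonglongrightarrow> 0"
    proof (rule LIMSEQ_I)
      fix e :: real assume "e > 0"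
      then obtain k where k: "(1/2::real)^k < e" using real_arch_pow_inv[of e "1/2"] by auto
      have "\<forall>m\<ge>N k. norm (nrm M (\<lambda>x. f m x - h x) - 0) < e"
        using key k by (auto intro: le_less_trans)
      then show "\<exists>no. \<forall>m\<ge>no. norm (nrm M (\<lambda>x. f m x - h x) - 0) < e" by blast
    qed
  qed
qed

section \<open>Nonnegative self-adjoint operators\<close>

lemma L2_iff: "f \<in> L2 D \<longleftrightarrow> sqint (lebesgue_on D) f"
  unfolding L2_def sqint_def by auto

lemma L2_norm_eq: "L2_norm D f = nrm (lebesgue_on D) f"
  unfolding L2_norm_def nrm_def ..

lemma sqint_cnj: "sqint M f \<Longrightarrow> sqint M (\<lambda>x. cnj (f x))"
  unfolding sqint_def by (auto intro: borel_measurable_continuous_onI[THEN measurable_compose_rev] continuous_intros)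

lemma nrm_cnj: "nrm M (\<lambda>x. cnj (f x)) = nrm M f"
  unfolding nrm_def by simp

lemma L2_inner_bound:
  "f \<in> L2 D \<Longrightarrow> g \<in> L2 D \<Longrightarrow> cmod (L2_inner D f g) \<le> L2_norm D f * L2_norm D g"
  unfolding L2_inner_def L2_norm_eq L2_iff
  using Cauchy_Schwarz_integral[OF _ sqint_cnj, of "lebesgue_on D" f g] by (simp add: nrm_cnj)

lemma L2_add: "f \<in> L2 D \<Longrightarrow> g \<in> L2 D \<Longrightarrow> (\<lambda>x. f x + g x) \<in> L2 D"
  unfolding L2_iff by (rule sqint_add)

lemma L2_diff: "f \<in> L2 D \<Longrightarrow> g \<in> L2 D \<Longrightarrow> (\<lambda>x. f x - g x) \<in> L2 D"
  unfolding L2_iff by (rule sqint_diff)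

lemma L2_cmult: "f \<in> L2 D \<Longrightarrow> (\<lambda>x. c * f x) \<in> L2 D"
  unfolding L2_iff by (rule sqint_cmult)

lemma L2_inner_integrable:
  "f \<in> L2 D \<Longrightarrow> g \<in> L2 D \<Longrightarrow> integrable (lebesgue_on D) (\<lambda>x. f x * cnj (g x))"
  unfolding L2_iff by (intro sqint_mult_integrable sqint_cnj)

lemma L2_inner_diff_left:
  assumes "f \<in> L2 D" "g \<in> L2 D" "h \<in> L2 D"
  shows "L2_inner D (\<lambda>x. f x - g x) h = L2_inner D f h - L2_inner D g h"
  unfolding L2_inner_def using L2_inner_integrable[OF assms(1,3)] L2_inner_integrable[OF assms(2,3)]
  by (simp add: left_diff_distrib)

lemma L2_inner_diff_right:
  assumes "f \<in> L2 D" "g \<in> L2 D" "h \<in> L2 D"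
  shows "L2_inner D h (\<lambda>x. f x - g x) = L2_inner D h f - L2_inner D h g"
  unfolding L2_inner_def using L2_inner_integrable[OF assms(3,1)] L2_inner_integrable[OF assms(3,2)]
  by (simp add: right_diff_distrib)

lemma L2_inner_cmult_left: "L2_inner D (\<lambda>x. c * f x) g = c * L2_inner D f g"
  unfolding L2_inner_def by (simp add: mult.assoc)

lemma L2_inner_cmult_right: "L2_inner D f (\<lambda>x. c * g x) = cnj c * L2_inner D f g"
  unfolding L2_inner_def by (simp add: mult.left_commute)

lemma L2_inner_self: "L2_inner D f f = of_real ((L2_norm D f)\<^sup>2)"
  unfolding L2_inner_def L2_norm_eq nrm_sq
  by (simp add: complex_norm_square[symmetric] del: of_real_power)

lemma L2_inner_cnj: "L2_inner D g f = cnj (L2_inner D f g)"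
  unfolding L2_inner_def by (subst Bochner_Integration.integral_cnj[symmetric]) (simp add: mult.commute)

lemma L2_norm_diff_sq:
  assumes "f \<in> L2 D" "g \<in> L2 D"
  shows "(L2_norm D (\<lambda>x. f x - g x))\<^sup>2 = (L2_norm D f)\<^sup>2 - 2 * Re (L2_inner D f g) + (L2_norm D g)\<^sup>2"
proof -
  have "complex_of_real ((L2_norm D (\<lambda>x. f x - g x))\<^sup>2) =
      L2_inner D f f - L2_inner D g f - (L2_inner D f g - L2_inner D g g)"
    unfolding L2_inner_self[symmetric]
    by (simp add: L2_inner_diff_left L2_inner_diff_right assms L2_diff)
  then have "(L2_norm D (\<lambda>x. f x - g x))\<^sup>2 =
      Re (L2_inner D f f - L2_inner D g f - (L2_inner D f g - L2_inner D g g))"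
    by (metis Re_complex_of_real)
  then show ?thesis unfolding L2_inner_self using L2_inner_cnj[of D f g] by simp
qed

lemma L2_inner_tendsto:
  assumes f: "\<And>k. f k \<in> L2 D" "l \<in> L2 D" and h: "h \<in> L2 D"
    and lim: "(\<lambda>k. L2_norm D (\<lambda>x. f k x - l x)) \<longlonglongrightarrow> 0"
  shows "(\<lambda>k. L2_inner D (f k) h) \<longlonglongrightarrow> L2_inner D l h"
    and "(\<lambda>k. L2_inner D h (f k)) \<longlonglongrightarrow> L2_inner D h l"
proof -
  have lim2: "(\<lambda>k. L2_norm D (\<lambda>x. f k x - l x) * L2_norm D h) \<longlonglongrightarrow> 0"
    using tendsto_mult_left_zero[OF lim] .
  have d: "(\<lambda>x. f k x - l x) \<in> L2 D" for k by (intro L2_diff f)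
  have "cmod (L2_inner D (f k) h - L2_inner D l h) \<le> L2_norm D (\<lambda>x. f k x - l x) * L2_norm D h" for k
    using L2_inner_bound[OF d h, of k] by (simp add: L2_inner_diff_left f h)
  then have "(\<lambda>k. L2_inner D (f k) h - L2_inner D l h) \<longlonglongrightarrow> 0"
    by (intro Lim_null_comparison[OF always_eventually lim2]) auto
  then show 1: "(\<lambda>k. L2_inner D (f k) h) \<longlonglongrightarrow> L2_inner D l h" by (simp add: LIM_zero_iff)
  show "(\<lambda>k. L2_inner D h (f k)) \<longlonglongrightarrow> L2_inner D h l"
    using tendsto_cnj[OF 1] by (simp flip: L2_inner_cnj)
qed

lemma L2_norm_triangle:
  "f \<in> L2 D \<Longrightarrow> g \<in> L2 D \<Longrightarrow> L2_norm D (\<lambda>x. f x + g x) \<le> L2_norm D f + L2_norm D g"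
  unfolding L2_iff L2_norm_eq by (rule nrm_triangle)

lemma L2_norm_nonneg: "0 \<le> L2_norm D f"
  unfolding L2_norm_eq by simp

lemma L2_norm_cmult: "L2_norm D (\<lambda>x. c * f x) = cmod c * L2_norm D f"
  unfolding L2_norm_eq by (rule nrm_cmult)

lemma L2_norm_eq_0_AE:
  assumes "f \<in> L2 D" "L2_norm D f = 0" shows "AE x in lebesgue_on D. f x = 0"
proof -
  have "(LINT x|lebesgue_on D. (cmod (f x))\<^sup>2) = 0"
    using assms(2) unfolding L2_norm_def by simp
  then have "AE x in lebesgue_on D. (cmod (f x))\<^sup>2 = 0"
    using assms(1) by (subst (asm) integral_nonneg_eq_0_iff_AE) (auto simp: L2_def)
  then show ?thesis by simp
qed

lemma L2_complete:
  assumes "\<And>k. f k \<in> L2 D"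
    and "\<And>e. e > 0 \<Longrightarrow> \<exists>N. \<forall>m\<ge>N. \<forall>n\<ge>N. L2_norm D (\<lambda>x. f m x - f n x) < e"
  obtains h where "h \<in> L2 D" "(\<lambda>k. L2_norm D (\<lambda>x. f k x - h x)) \<longlonglongrightarrow> 0"
  using sqint_complete[of "lebesgue_on D" f] assms unfolding L2_iff L2_norm_eq by blast

text \<open>An adjoint graph is closed, because the identity that defines membership in it is
  continuous in both components; \<open>H\<close> equals its adjoint.\<close>

lemma self_adjoint_closed:
  assumes H: "self_adjoint D H" and fg: "\<And>k. (f k, g k) \<in> H"
    and f: "f' \<in> L2 D" "(\<lambda>k. L2_norm D (\<lambda>x. f k x - f' x)) \<longlonglongrightarrow> 0"
    and g: "g' \<in> L2 D" "(\<lambda>k. L2_norm D (\<lambda>x. g k x - g' x)) \<longlonglongrightarrow> 0"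
  shows "(f', g') \<in> H"
proof -
  have adj: "adjoint_graph D H = H" and sub: "H \<subseteq> L2 D \<times> L2 D"
    using H unfolding self_adjoint_def linear_operator_def by auto
  have fL: "f k \<in> L2 D" "g k \<in> L2 D" for k using fg[of k] sub by auto
  have "L2_inner D v f' = L2_inner D u g'" if uv: "(u, v) \<in> H" for u v
  proof (rule LIMSEQ_unique)
    have L: "u \<in> L2 D" "v \<in> L2 D" using uv sub by auto
    show "(\<lambda>k. L2_inner D v (f k)) \<longlonglongrightarrow> L2_inner D v f'"
      by (rule L2_inner_tendsto(2)[OF fL(1) f(1) L(2) f(2)])
    have "L2_inner D v (f k) = L2_inner D u (g k)" for k
    proof -
      have "(f k, g k) \<in> adjoint_graph D H" using fg adj by simp
      then show ?thesis using uv unfolding adjoint_graph_def by auto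
    qed
    moreover have "(\<lambda>k. L2_inner D u (g k)) \<longlonglongrightarrow> L2_inner D u g'"
      by (rule L2_inner_tendsto(2)[OF fL(2) g(1) L(1) g(2)])
    ultimately show "(\<lambda>k. L2_inner D v (f k)) \<longlonglongrightarrow> L2_inner D u g'" by simp
  qed
  then have "(f', g') \<in> adjoint_graph D H"
    unfolding adjoint_graph_def using f(1) g(1) by auto
  then show ?thesis using adj by simp
qed

text \<open>The range of \<open>H - z\<close> is closed by the coercivity estimate, so a function at minimal distance
  exists; the residual is orthogonal to the range, hence an eigenfunction for \<open>cnj z\<close>, hence zero.\<close>

lemma nonnegative_self_adjoint_resolvent:
  assumes H: "self_adjoint D H"
    and pos: "\<And>f g. (f, g) \<in> H \<Longrightarrow> 0 \<le> Re (L2_inner D g f)"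
    and z: "Re z < 0"
  shows "z \<in> resolvent_set D H"
proof -
  have adj: "adjoint_graph D H = H" and sub: "H \<subseteq> L2 D \<times> L2 D"
    and zero: "(\<lambda>x. 0, \<lambda>x. 0) \<in> H"
    and add: "\<And>f g f' g'. (f, g) \<in> H \<Longrightarrow> (f', g') \<in> H \<Longrightarrow> (\<lambda>x. f x + f' x, \<lambda>x. g x + g' x) \<in> H"
    and cmult: "\<And>c f g. (f, g) \<in> H \<Longrightarrow> (\<lambda>x. c * f x, \<lambda>x. c * g x) \<in> H"
    using H unfolding self_adjoint_def linear_operator_def by auto
  have inL: "f \<in> L2 D" "g \<in> L2 D" if "(f, g) \<in> H" for f g using that sub by auto
  define w where "w f g x = g x - z * f x" for f g :: "'a \<Rightarrow> complex" and x
  have wL: "w f g \<in> L2 D" if "(f, g) \<in> H" for f g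
    unfolding w_def using inL[OF that] by (intro L2_diff L2_cmult)
  define c where "c = - Re z"
  have c: "c > 0" using z unfolding c_def by simp
  \<comment> \<open>The real part of <(H - z) f, f> is at least \<open>c\<close> times the squared
    norm of f; Cauchy-Schwarz then cancels one factor.\<close>
  have coer: "c * L2_norm D f \<le> L2_norm D (w f g)" if fg: "(f, g) \<in> H" for f g
  proof -
    note L = inL[OF fg]
    have "L2_inner D (w f g) f = L2_inner D g f - z * of_real ((L2_norm D f)\<^sup>2)"
      unfolding w_def using L by (simp add: L2_inner_diff_left L2_cmult L2_inner_cmult_left L2_inner_self)
    then have "Re (L2_inner D (w f g) f) \<ge> c * (L2_norm D f)\<^sup>2"
      using pos[OF fg] unfolding c_def by simp
    also have "Re (L2_inner D (w f g) f) \<le> L2_norm D (w f g) * L2_norm D f"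
      using L2_inner_bound[OF wL[OF fg] L(1)] complex_Re_le_cmod order.trans by blast
    finally have "c * L2_norm D f * L2_norm D f \<le> L2_norm D (w f g) * L2_norm D f"
      by (simp add: power2_eq_square)
    then show ?thesis
      using L2_norm_nonneg[of D f] L2_norm_nonneg[of D "w f g"]
      by (cases "L2_norm D f = 0") auto
  qed
  have wdiff: "(\<lambda>x. f x - f' x, \<lambda>x. g x - g' x) \<in> H"
    if "(f, g) \<in> H" "(f', g') \<in> H" for f g f' g'
    using add[OF that(1) cmult[OF that(2), of "-1"]] by simp
  have surj: "\<exists>(f, g)\<in>H. AE x in lebesgue_on D. g x - z * f x = h x" if h: "h \<in> L2 D" for h
  proof -
    define N where "N f g = (L2_norm D (\<lambda>x. h x - w f g x))\<^sup>2" for f g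
    \<comment> \<open>The squared distance from \<open>h\<close> to the range of
      \<open>H - z\<close>.\<close>
    define d where "d = (INF (f, g)\<in>H. N f g)"
    have bdd: "bdd_below ((\<lambda>(f, g). N f g) ` H)"
      by (rule bdd_belowI[of _ 0]) (auto simp: N_def)
    have dle: "d \<le> N f g" if "(f, g) \<in> H" for f g
      unfolding d_def using cINF_lower[OF bdd that] by simp
    have "\<exists>fg\<in>H. (\<lambda>(f, g). N f g) fg < d + 1 / real (Suc k)" for k
    proof -
      have "d < d + 1 / real (Suc k)" by simp
      then show ?thesis unfolding d_def
        by (subst (asm) (1) cINF_less_iff[OF _ bdd]) (use zero in auto)
    qed
    then obtain fg where fg: "\<And>k. fg k \<in> H" "\<And>k. (\<lambda>(f, g). N f g) (fg k) < d + 1 / real (Suc k)"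
      by metis
    define f where "f k = fst (fg k)" for k
    define g where "g k = snd (fg k)" for k
    have inH: "(f k, g k) \<in> H" for k using fg(1)[of k] unfolding f_def g_def by simp
    have Nk: "N (f k) (g k) < d + 1 / real (Suc k)" for k
      using fg(2)[of k] unfolding f_def g_def by (simp add: case_prod_beta)
    \<comment> \<open>Parallelogram law. The midpoint of two pairs lies in \<open>H\<close>, so half
      the sum of the residuals \<open>A\<close> and \<open>B\<close> has squared norm at least
      \<open>d\<close>; since both residuals are almost minimal, their difference is small.\<close>
    have par: "(L2_norm D (\<lambda>x. w (f m) (g m) x - w (f n) (g n) x))\<^sup>2 \<le> 2 / real (Suc m) + 2 / real (Suc n)" for m n
    proof -
      define A where "A x = h x - w (f m) (g m) x" for x
      define B where "B x = h x - w (f n) (g n) x" for x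
      have AL: "A \<in> L2 D" and BL: "B \<in> L2 D"
        unfolding A_def B_def by (intro L2_diff h wL inH)+
      \<comment> \<open>The sum \<open>A + B\<close> is written as a difference so that
        \<open>L2_norm_diff_sq\<close> applies to it as well.\<close>
      have BL': "(\<lambda>x. - 1 * B x) \<in> L2 D" by (rule L2_cmult[OF BL])
      have mid: "(\<lambda>x. (1/2) * (f m x + f n x), \<lambda>x. (1/2) * (g m x + g n x)) \<in> H"
        by (intro cmult add inH)
      have m0: "(\<lambda>x. (1/2) * (A x - (- 1 * B x))) = (\<lambda>x. h x - w (\<lambda>x. (1/2) * (f m x + f n x)) (\<lambda>x. (1/2) * (g m x + g n x)) x)"
        by (rule ext) (simp add: A_def B_def w_def field_simps)
      have "d \<le> (L2_norm D (\<lambda>x. (1/2) * (A x - (- 1 * B x))))\<^sup>2"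
        using dle[OF mid] unfolding N_def m0 .
      also have "\<dots> = (L2_norm D (\<lambda>x. A x - (- 1 * B x)))\<^sup>2 / 4"
        unfolding L2_norm_cmult by (simp add: power2_eq_square)
      finally have 1: "4 * d \<le> (L2_norm D (\<lambda>x. A x - (- 1 * B x)))\<^sup>2" by simp
      have 2: "(L2_norm D (\<lambda>x. A x - (- 1 * B x)))\<^sup>2 = (L2_norm D A)\<^sup>2 + 2 * Re (L2_inner D A B) + (L2_norm D B)\<^sup>2"
        unfolding L2_norm_diff_sq[OF AL BL'] L2_norm_cmult L2_inner_cmult_right by simp
      have 3: "(L2_norm D (\<lambda>x. B x - A x))\<^sup>2 = (L2_norm D B)\<^sup>2 - 2 * Re (L2_inner D A B) + (L2_norm D A)\<^sup>2"
        unfolding L2_norm_diff_sq[OF BL AL] using L2_inner_cnj[of D B A] by simp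
      have 4: "(L2_norm D A)\<^sup>2 \<le> d + 1 / real (Suc m)" "(L2_norm D B)\<^sup>2 \<le> d + 1 / real (Suc n)"
        using Nk[of m] Nk[of n] unfolding N_def A_def B_def by simp_all
      have 5: "(\<lambda>x. w (f m) (g m) x - w (f n) (g n) x) = (\<lambda>x. B x - A x)"
        unfolding A_def B_def by auto
      have "(L2_norm D (\<lambda>x. B x - A x))\<^sup>2 \<le> 2 * (L2_norm D A)\<^sup>2 + 2 * (L2_norm D B)\<^sup>2 - 4 * d"
        using 1 2 3 by linarith
      also have "\<dots> \<le> 2 * (1 / real (Suc m)) + 2 * (1 / real (Suc n))"
        using 4 by linarith
      finally show ?thesis unfolding 5 by simp
    qed
    have cauchyw: "\<exists>M. \<forall>m\<ge>M. \<forall>n\<ge>M. L2_norm D (\<lambda>x. w (f m) (g m) x - w (f n) (g n) x) < e" if "e > 0" for e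
    proof -
      obtain M where M: "4 / e\<^sup>2 < real M" using reals_Archimedean2 by blast
      have "L2_norm D (\<lambda>x. w (f m) (g m) x - w (f n) (g n) x) < e" if "m \<ge> M" "n \<ge> M" for m n
      proof -
        have M0: "real M > 0" using M \<open>e > 0\<close> by (smt (verit) divide_nonneg_nonneg zero_le_power2)
        have i: "2 / real (Suc k) \<le> 2 / real M" if "k \<ge> M" for k
          using that M0 by (intro divide_left_mono) auto
        have "(L2_norm D (\<lambda>x. w (f m) (g m) x - w (f n) (g n) x))\<^sup>2 \<le> 2 / real M + 2 / real M"
          using par[of m n] i[OF \<open>m \<ge> M\<close>] i[OF \<open>n \<ge> M\<close>] by linarith
        also have "\<dots> < e\<^sup>2"
          using M M0 \<open>e > 0\<close> by (simp add: field_simps)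
        finally show ?thesis by (rule power_less_imp_less_base) (use \<open>e > 0\<close> in auto)
      qed
      then show ?thesis by blast
    qed
    have fmul: "c * L2_norm D (\<lambda>x. f m x - f n x) \<le> L2_norm D (\<lambda>x. w (f m) (g m) x - w (f n) (g n) x)" for m n
    proof -
      have "w (\<lambda>x. f m x - f n x) (\<lambda>x. g m x - g n x) = (\<lambda>x. w (f m) (g m) x - w (f n) (g n) x)"
        by (rule ext) (simp add: w_def algebra_simps)
      then show ?thesis using coer[OF wdiff[OF inH inH], of m n] by simp
    qed
    have "\<exists>M. \<forall>m\<ge>M. \<forall>n\<ge>M. L2_norm D (\<lambda>x. f m x - f n x) < e" if "e > 0" for e
    proof -
      obtain M where M: "\<And>m n. m \<ge> M \<Longrightarrow> n \<ge> M \<Longrightarrow> L2_norm D (\<lambda>x. w (f m) (g m) x - w (f n) (g n) x) < c * e"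
        using cauchyw[of "c * e"] c \<open>e > 0\<close> by auto
      have "L2_norm D (\<lambda>x. f m x - f n x) < e" if "m \<ge> M" "n \<ge> M" for m n
        using fmul[of m n] M[OF that] c by (smt (verit) mult_less_cancel_left_pos)
      then show ?thesis by blast
    qed
    then obtain f' where f': "f' \<in> L2 D" "(\<lambda>k. L2_norm D (\<lambda>x. f k x - f' x)) \<longlonglongrightarrow> 0"
      using L2_complete[of f D] inL[OF inH] by blast
    obtain w' where w': "w' \<in> L2 D" "(\<lambda>k. L2_norm D (\<lambda>x. w (f k) (g k) x - w' x)) \<longlonglongrightarrow> 0"
      using L2_complete[of "\<lambda>k. w (f k) (g k)" D] wL[OF inH] cauchyw by blast
    define g' where "g' x = w' x + z * f' x" for x
    have g'L: "g' \<in> L2 D" unfolding g'_def by (intro L2_add L2_cmult w' f')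
    have g'lim: "(\<lambda>k. L2_norm D (\<lambda>x. g k x - g' x)) \<longlonglongrightarrow> 0"
    proof (rule Lim_null_comparison[OF always_eventually])
      show "(\<lambda>k. L2_norm D (\<lambda>x. w (f k) (g k) x - w' x) + cmod z * L2_norm D (\<lambda>x. f k x - f' x)) \<longlonglongrightarrow> 0"
        using tendsto_add[OF w'(2) tendsto_mult_right_zero[OF f'(2)]] by simp
      show "\<forall>k. norm (L2_norm D (\<lambda>x. g k x - g' x)) \<le>
          L2_norm D (\<lambda>x. w (f k) (g k) x - w' x) + cmod z * L2_norm D (\<lambda>x. f k x - f' x)"
      proof
        fix k
        have e: "(\<lambda>x. g k x - g' x) = (\<lambda>x. (w (f k) (g k) x - w' x) + z * (f k x - f' x))"
          by (rule ext) (simp add: w_def g'_def algebra_simps)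
        have "L2_norm D (\<lambda>x. g k x - g' x) \<le> L2_norm D (\<lambda>x. w (f k) (g k) x - w' x) + L2_norm D (\<lambda>x. z * (f k x - f' x))"
          unfolding e by (intro L2_norm_triangle L2_diff L2_cmult wL inH w' inL[OF inH] f')
        then show "norm (L2_norm D (\<lambda>x. g k x - g' x)) \<le>
          L2_norm D (\<lambda>x. w (f k) (g k) x - w' x) + cmod z * L2_norm D (\<lambda>x. f k x - f' x)"
          by (simp add: L2_norm_cmult L2_norm_nonneg)
      qed
    qed
    have fgH: "(f', g') \<in> H"
      by (rule self_adjoint_closed[OF H inH f' g'L g'lim])
    have ww: "w f' g' = w'" unfolding w_def g'_def by simp
    define r where "r x = h x - w' x" for x
    have rL: "r \<in> L2 D" unfolding r_def by (intro L2_diff h w')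
    have rmin: "(L2_norm D r)\<^sup>2 \<le> d"
    proof (rule LIMSEQ_le_const)
      let ?e = "\<lambda>k. L2_norm D (\<lambda>x. w (f k) (g k) x - w' x)"
      have "(\<lambda>k. (sqrt (d + 1 / real (Suc k)) + ?e k)\<^sup>2) \<longlonglongrightarrow> (sqrt (d + 0) + 0)\<^sup>2"
        by (intro tendsto_intros w' LIMSEQ_inverse_real_of_nat[unfolded inverse_eq_divide])
      moreover have "d \<ge> 0" unfolding d_def using zero
        by (intro cINF_greatest) (auto simp: N_def)
      ultimately show "(\<lambda>k. (sqrt (d + 1 / real (Suc k)) + ?e k)\<^sup>2) \<longlonglongrightarrow> d" by simp
      show "\<exists>N. \<forall>k\<ge>N. (L2_norm D r)\<^sup>2 \<le> (sqrt (d + 1 / real (Suc k)) + ?e k)\<^sup>2"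
      proof (intro exI allI impI power_mono)
        fix k
        have e: "r = (\<lambda>x. (h x - w (f k) (g k) x) + (w (f k) (g k) x - w' x))"
          unfolding r_def by auto
        have "L2_norm D r \<le> L2_norm D (\<lambda>x. h x - w (f k) (g k) x) + ?e k"
          unfolding e by (intro L2_norm_triangle L2_diff h wL inH w')
        moreover have "L2_norm D (\<lambda>x. h x - w (f k) (g k) x) \<le> sqrt (d + 1 / real (Suc k))"
          using Nk[of k] unfolding N_def by (intro real_le_rsqrt) simp
        ultimately show "L2_norm D r \<le> sqrt (d + 1 / real (Suc k)) + ?e k" by linarith
      qed (rule L2_norm_nonneg)
    qed
    have orth: "L2_inner D r (w u v) = 0" if uv: "(u, v) \<in> H" for u v
    proof -
      define I where "I = L2_inner D r (w u v)"
      \<comment> \<open>Step length for moving \<open>r\<close> in the direction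
        \<open>w u v\<close>. It makes the quadratic term at most half of the linear gain, so that
        the squared norm drops by at least \<open>s * (cmod I)\<^sup>2\<close>; the summand 1 covers
        a vanishing direction.\<close>
      define s where "s = 1 / ((L2_norm D (w u v))\<^sup>2 + 1)"
      have s0: "s > 0" unfolding s_def by (smt (verit) zero_le_power2 divide_pos_pos)
      define t where "t = of_real s * I"
      have tH: "(\<lambda>x. f' x + t * u x, \<lambda>x. g' x + t * v x) \<in> H"
        by (intro add cmult fgH uv)
      have e: "(\<lambda>x. h x - w (\<lambda>x. f' x + t * u x) (\<lambda>x. g' x + t * v x) x) = (\<lambda>x. r x - t * w u v x)"
        by (rule ext) (simp add: r_def w_def ww[symmetric] algebra_simps)
      have "d \<le> (L2_norm D (\<lambda>x. r x - t * w u v x))\<^sup>2"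
        using dle[OF tH] unfolding N_def e .
      also have "\<dots> = (L2_norm D r)\<^sup>2 - 2 * Re (cnj t * I) + (cmod t)\<^sup>2 * (L2_norm D (w u v))\<^sup>2"
        unfolding L2_norm_diff_sq[OF rL L2_cmult[OF wL[OF uv]]] L2_norm_cmult L2_inner_cmult_right I_def
        by (simp add: power_mult_distrib)
      also have "Re (cnj t * I) = s * (cmod I)\<^sup>2"
        unfolding t_def cmod_power2 by (simp add: power2_eq_square algebra_simps)
      also have "(cmod t)\<^sup>2 * (L2_norm D (w u v))\<^sup>2 = s * (cmod I)\<^sup>2 * (s * (L2_norm D (w u v))\<^sup>2)"
        unfolding t_def by (simp add: norm_mult power2_eq_square)
      also have "\<dots> \<le> s * (cmod I)\<^sup>2 * 1"
        using s0 by (intro mult_left_mono) (auto simp: s_def)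
      finally have "s * (cmod I)\<^sup>2 \<le> 0" using rmin by linarith
      then have "cmod I = 0" using s0 by (simp add: mult_le_0_iff)
      then show ?thesis unfolding I_def by simp
    qed
    have "L2_inner D v r = L2_inner D u (\<lambda>x. cnj z * r x)" if uv: "(u, v) \<in> H" for u v
    proof -
      have "L2_inner D (w u v) r = 0" using orth[OF uv] L2_inner_cnj[of D "w u v" r] by simp
      then have "L2_inner D v r - z * L2_inner D u r = 0"
        unfolding w_def using inL[OF uv] rL by (simp add: L2_inner_diff_left L2_cmult L2_inner_cmult_left)
      then show ?thesis by (simp add: L2_inner_cmult_right)
    qed
    then have "(r, \<lambda>x. cnj z * r x) \<in> adjoint_graph D H"
      unfolding adjoint_graph_def using rL L2_cmult[OF rL] by auto
    then have "0 \<le> Re (L2_inner D (\<lambda>x. cnj z * r x) r)" using adj pos by simp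
    then have "0 \<le> Re z * (L2_norm D r)\<^sup>2" by (simp add: L2_inner_cmult_left L2_inner_self)
    then have "L2_norm D r = 0" using z by (simp add: zero_le_mult_iff)
    then have "AE x in lebesgue_on D. r x = 0" by (rule L2_norm_eq_0_AE[OF rL])
    then have "AE x in lebesgue_on D. g' x - z * f' x = h x"
      by eventually_elim (simp add: r_def ww[symmetric] w_def)
    then show ?thesis using fgH by blast
  qed
  have "L2_norm D f \<le> 1 / c * L2_norm D (\<lambda>x. g x - z * f x)" if "(f, g) \<in> H" for f g
    using coer[OF that] c unfolding w_def by (simp add: field_simps)
  then have "\<exists>C. \<forall>(f, g)\<in>H. L2_norm D f \<le> C * L2_norm D (\<lambda>x. g x - z * f x)" by blast
  then show ?thesis unfolding resolvent_set_def using surj by blast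
qed

lemma nonnegative_self_adjoint_inf_spectrum:
  assumes "self_adjoint D H" and "\<And>f g. (f, g) \<in> H \<Longrightarrow> 0 \<le> Re (L2_inner D g f)"
  shows "0 \<le> inf_spectrum D H"
  unfolding inf_spectrum_def spectrum_def
proof (rule INF_greatest)
  fix z assume "z \<in> - resolvent_set D H"
  then have "\<not> Re z < 0" using nonnegative_self_adjoint_resolvent[of D H z] assms by blast
  then show "0 \<le> ereal (Re z)" by simp
qed

section \<open>Smooth functions and cutoffs\<close>

lemma partial_eqI: "(f has_derivative f') (at x) \<Longrightarrow> partial b f x = f' b"
  unfolding partial_def using frechet_derivative_at[of f f' x] by simp

lemma partial_works:
  "f differentiable (at x) \<Longrightarrow> (f has_derivative frechet_derivative f (at x)) (at x)"
  by (simp add: frechet_derivative_works)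

text \<open>No differentiability is required: both functions have the same derivatives at
  \<open>x\<close>, so the choice made in \<open>frechet_derivative\<close> is the same even if
  there is none.\<close>

lemma partial_cong:
  assumes "open S" "x \<in> S" "\<And>y. y \<in> S \<Longrightarrow> f y = g y"
  shows "partial b f x = partial b g x"
proof -
  have "(f has_derivative d) (at x) \<longleftrightarrow> (g has_derivative d) (at x)" for d
  proof
    show "(g has_derivative d) (at x)" if "(f has_derivative d) (at x)"
      by (rule has_derivative_transform_within_open[OF that assms(1,2)]) (simp add: assms(3))
    show "(f has_derivative d) (at x)" if "(g has_derivative d) (at x)"
      by (rule has_derivative_transform_within_open[OF that assms(1,2)]) (simp add: assms(3))
  qed
  then show ?thesis unfolding partial_def frechet_derivative_def by simp
qed

lemma differentiable_cong_open:
  assumes "open S" "x \<in> S" "\<And>y. y \<in> S \<Longrightarrow> f y = g y" "f differentiable (at x)"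
  shows "g differentiable (at x)"
  by (rule differentiableI, rule has_derivative_transform_within_open[OF partial_works[OF assms(4)] assms(1,2)])
    (simp add: assms(3))

lemma Ck_on_cong:
  assumes "open S" "\<And>y. y \<in> S \<Longrightarrow> f y = g y" "Ck_on k S f"
  shows "Ck_on k S g"
  using assms(2,3)
proof (induction k arbitrary: f g)
  case 0 then show ?case using continuous_on_eq by fastforce
next
  case (Suc k)
  have "Ck_on k S (partial b g)" if "b \<in> Basis" for b
    using Suc.IH[of "partial b f" "partial b g"] Suc.prems that
      partial_cong[OF assms(1) _ Suc.prems(1)] by auto
  moreover have "g differentiable at x" if "x \<in> S" for x
    using differentiable_cong_open[OF assms(1) that Suc.prems(1)] Suc.prems(2) that by auto
  ultimately show ?case by simp
qed

lemma Ck_on_subset: "Ck_on k T f \<Longrightarrow> S \<subseteq> T \<Longrightarrow> Ck_on k S f"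
  by (induction k arbitrary: f) (auto intro: continuous_on_subset)

lemma Ck_on_SucD: "Ck_on (Suc k) S f \<Longrightarrow> Ck_on k S f"
proof (induction k arbitrary: f)
  case 0 then show ?case
    by (auto intro!: continuous_at_imp_continuous_on differentiable_imp_continuous_within)
next
  case (Suc k)
  then have "Ck_on k S (partial b f)" if "b \<in> Basis" for b using that by auto
  with Suc show ?case by simp
qed

lemma Ck_on_le: "Ck_on k S f \<Longrightarrow> j \<le> k \<Longrightarrow> Ck_on j S f"
proof (induction k)
  case (Suc k) then show ?case using Ck_on_SucD le_Suc_eq by metis
qed simp

lemma Ck_on_local:
  assumes "\<And>x. x \<in> S \<Longrightarrow> \<exists>U. open U \<and> x \<in> U \<and> Ck_on k U f"
  shows "Ck_on k S f"
  using assms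
proof (induction k arbitrary: f)
  case 0
  then have "isCont f x" if "x \<in> S" for x
    using that by (fastforce simp: continuous_on_eq_continuous_at)
  then show ?case by (simp add: continuous_at_imp_continuous_on)
next
  case (Suc k)
  have "Ck_on k S (partial b f)" if "b \<in> Basis" for b
    using Suc.prems that by (intro Suc.IH) fastforce
  moreover have "f differentiable at x" if "x \<in> S" for x
    using Suc.prems[OF that] by auto
  ultimately show ?case by simp
qed

lemma Ck_on_const:
  fixes S :: "'a::euclidean_space set" and c :: "'b::real_normed_vector"
  shows "Ck_on k S (\<lambda>x. c)"
proof (induction k arbitrary: c)
  case (Suc k)
  have "partial b (\<lambda>x::'a. c) = (\<lambda>x. 0)" for b and c :: 'b
    by (rule ext, rule partial_eqI) (auto intro: derivative_eq_intros)
  then show ?case using Suc[of 0] by simp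
qed simp

lemma Ck_on_add:
  assumes "open S" "Ck_on k S f" "Ck_on k S g"
  shows "Ck_on k S (\<lambda>x. f x + g x)"
  using assms(2,3)
proof (induction k arbitrary: f g)
  case (Suc k)
  have "Ck_on k S (partial b (\<lambda>x. f x + g x))" if "b \<in> Basis" for b
  proof (rule Ck_on_cong[OF assms(1)])
    show "Ck_on k S (\<lambda>x. partial b f x + partial b g x)" using Suc that by simp
    show "partial b f x + partial b g x = partial b (\<lambda>x. f x + g x) x" if "x \<in> S" for x
      by (rule sym, unfold partial_def[of b f] partial_def[of b g], rule partial_eqI, intro has_derivative_add partial_works)
        (use Suc.prems that in auto)
  qed
  then show ?case using Suc.prems by simp
qed (auto intro: continuous_intros)

lemma partial_bounded_linear:
  assumes "bounded_linear L" "f differentiable (at x)"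
  shows "partial b (\<lambda>x. L (f x)) x = L (partial b f x)"
  unfolding partial_def[of b f]
  by (rule partial_eqI) (rule bounded_linear.has_derivative[OF assms(1) partial_works[OF assms(2)]])

lemma Ck_on_bounded_linear:
  assumes "open S" "bounded_linear L" "Ck_on k S f"
  shows "Ck_on k S (\<lambda>x. L (f x))"
  using assms(3)
proof (induction k arbitrary: f)
  case 0 then show ?case by (simp add: bounded_linear.continuous_on[OF assms(2)])
next
  case (Suc k)
  have "Ck_on k S (partial b (\<lambda>x. L (f x)))" if "b \<in> Basis" for b
  proof (rule Ck_on_cong[OF assms(1)])
    show "Ck_on k S (\<lambda>x. L (partial b f x))" using Suc that by simp
    show "L (partial b f x) = partial b (\<lambda>x. L (f x)) x" if "x \<in> S" for x
      using partial_bounded_linear[OF assms(2), of f x b] Suc.prems that by auto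
  qed
  moreover have "(\<lambda>x. L (f x)) differentiable at x" if "x \<in> S" for x
    using bounded_linear.has_derivative[OF assms(2) partial_works[of f x]] Suc.prems that
    by (auto intro: differentiableI)
  ultimately show ?case by simp
qed

lemma partial_mult:
  fixes f g :: "'a::euclidean_space \<Rightarrow> real"
  assumes "f differentiable (at x)" "g differentiable (at x)"
  shows "partial b (\<lambda>x. f x * g x) x = f x * partial b g x + partial b f x * g x"
  unfolding partial_def[of b f] partial_def[of b g]
  by (rule partial_eqI) (rule has_derivative_mult[OF partial_works[OF assms(1)] partial_works[OF assms(2)]])

lemma Ck_on_mult:
  fixes f g :: "'a::euclidean_space \<Rightarrow> real"
  assumes "open S" "Ck_on k S f" "Ck_on k S g"
  shows "Ck_on k S (\<lambda>x. f x * g x)"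
  using assms(2,3)
proof (induction k arbitrary: f g)
  case 0 then show ?case by (auto intro: continuous_intros)
next
  case (Suc k)
  have "Ck_on k S (partial b (\<lambda>x. f x * g x))" if "b \<in> Basis" for b
  proof (rule Ck_on_cong[OF assms(1)])
    show "Ck_on k S (\<lambda>x. f x * partial b g x + partial b f x * g x)"
      using Suc that Ck_on_SucD[OF Suc.prems(1)] Ck_on_SucD[OF Suc.prems(2)]
      by (intro Ck_on_add assms(1) Suc.IH) auto
    show "f x * partial b g x + partial b f x * g x = partial b (\<lambda>x. f x * g x) x" if "x \<in> S" for x
      using partial_mult[of f x g b] Suc.prems that by auto
  qed
  then show ?case using Suc.prems by (auto intro: differentiable_mult)
qed

lemma Ck_on_cmult:
  fixes f :: "'a::euclidean_space \<Rightarrow> real"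
  shows "open S \<Longrightarrow> Ck_on k S f \<Longrightarrow> Ck_on k S (\<lambda>x. c * f x)"
  by (intro Ck_on_mult Ck_on_const)

lemma Ck_on_diff:
  fixes f :: "'a::euclidean_space \<Rightarrow> real"
  assumes "open S" "Ck_on k S f" "Ck_on k S g"
  shows "Ck_on k S (\<lambda>x. f x - g x)"
  using Ck_on_add[OF assms(1,2) Ck_on_cmult[OF assms(1,3), of "-1"]] by simp

lemma partial_compose:
  fixes f :: "'a::euclidean_space \<Rightarrow> real" and g :: "real \<Rightarrow> real"
  assumes "f differentiable (at x)" "g differentiable (at (f x))"
  shows "partial b (\<lambda>x. g (f x)) x = partial 1 g (f x) * partial b f x"
proof -
  let ?g' = "frechet_derivative g (at (f x))"
  have "((\<lambda>x. g (f x)) has_derivative (\<lambda>h. ?g' (frechet_derivative f (at x) h))) (at x)"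
    using diff_chain_at[OF partial_works[OF assms(1)] partial_works[OF assms(2)]] by (simp add: o_def)
  then have "partial b (\<lambda>x. g (f x)) x = ?g' (partial b f x)"
    unfolding partial_def[of b f] by (rule partial_eqI)
  moreover have "linear ?g'" by (rule linear_frechet_derivative[OF assms(2)])
  ultimately show ?thesis unfolding partial_def[of 1 g]
    using linear_scale[of ?g' "partial b f x" 1] by simp
qed

lemma Ck_on_compose:
  fixes f :: "'a::euclidean_space \<Rightarrow> real" and g :: "real \<Rightarrow> real"
  assumes "open S" "f ` S \<subseteq> U" "Ck_on k U g" "Ck_on k S f"
  shows "Ck_on k S (\<lambda>x. g (f x))"
  using assms(3,4)
proof (induction k arbitrary: g)
  case 0 then show ?case
    using continuous_on_compose2[of U g S f] assms(2) by auto
next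
  case (Suc k)
  have "Ck_on k S (partial b (\<lambda>x. g (f x)))" if "b \<in> Basis" for b
  proof (rule Ck_on_cong[OF assms(1)])
    show "Ck_on k S (\<lambda>x. partial 1 g (f x) * partial b f x)"
      using Suc that Ck_on_SucD[OF Suc.prems(2)] by (intro Ck_on_mult assms(1)) auto
    show "partial 1 g (f x) * partial b f x = partial b (\<lambda>x. g (f x)) x" if "x \<in> S" for x
      using partial_compose[of f x g b] Suc.prems that assms(2) by auto
  qed
  moreover have "(\<lambda>x. g (f x)) differentiable at x" if "x \<in> S" for x
    using differentiable_chain_at[of f x g] Suc.prems that assms(2) by (auto simp: o_def)
  ultimately show ?case by simp
qed

lemma Ck_on_inner: "open S \<Longrightarrow> Ck_on k S (\<lambda>x. x \<bullet> b)"
proof (cases k)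
  case (Suc j)
  have "partial c (\<lambda>x. x \<bullet> b) = (\<lambda>x. c \<bullet> b)" for c
    by (rule ext, rule partial_eqI) (auto intro!: derivative_eq_intros)
  moreover have "(\<lambda>x. x \<bullet> b) differentiable at x" for x
    unfolding differentiable_def by (auto intro!: derivative_eq_intros)
  ultimately show ?thesis unfolding Suc by (simp add: Ck_on_const)
qed (auto intro: continuous_intros)

lemma partial_inner_self: "partial b (\<lambda>x. x \<bullet> x) x = 2 * (x \<bullet> b)"
  by (rule partial_eqI) (auto intro!: derivative_eq_intros simp: inner_commute)

lemma differentiable_inner_self: "(\<lambda>x::'a::euclidean_space. x \<bullet> x) differentiable at x"
  unfolding differentiable_def by (auto intro!: derivative_eq_intros)

lemma Ck_on_inner_self:
  assumes "open (S :: 'a::euclidean_space set)" shows "Ck_on k S (\<lambda>x. x \<bullet> x)"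
proof (cases k)
  case (Suc j)
  have "partial b (\<lambda>x::'a. x \<bullet> x) = (\<lambda>x. 2 * (x \<bullet> b))" for b
    using partial_inner_self by blast
  then show ?thesis unfolding Suc
    by (simp add: differentiable_inner_self Ck_on_cmult[OF assms] Ck_on_inner[OF assms])
qed (auto intro: continuous_intros)

lemma partial_real_derivative:
  fixes g :: "real \<Rightarrow> real"
  assumes "(g has_real_derivative d) (at x)"
  shows "partial 1 g x = d" "g differentiable (at x)"
proof -
  have h: "(g has_derivative (\<lambda>h. d * h)) (at x)"
    using assms by (simp add: has_field_derivative_def)
  show "partial 1 g x = d" using partial_eqI[OF h, of 1] by simp
  show "g differentiable (at x)" using h unfolding differentiable_def by blast
qed

lemma Ck_on_SucI_real:
  fixes g :: "real \<Rightarrow> real"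
  assumes "open S" "\<And>x. x \<in> S \<Longrightarrow> (g has_real_derivative g' x) (at x)" "Ck_on k S g'"
  shows "Ck_on (Suc k) S g"
proof -
  have "Ck_on k S (partial 1 g)"
    by (rule Ck_on_cong[OF assms(1) _ assms(3)]) (simp add: partial_real_derivative(1)[OF assms(2)])
  then show ?thesis using partial_real_derivative(2)[OF assms(2)] by simp
qed

text \<open>The derivative is a product of two inverses, so the induction closes on itself.\<close>

lemma Ck_on_inverse: "Ck_on k (- {0}) (inverse :: real \<Rightarrow> real)"
proof (induction k)
  case 0 then show ?case by (auto intro: continuous_intros)
next
  case (Suc k)
  show ?case
  proof (rule Ck_on_SucI_real)
    show "Ck_on k (- {0}) (\<lambda>x::real. (- 1) * (inverse x * inverse x))"
      by (intro Ck_on_cmult Ck_on_mult Suc) auto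
    show "(inverse has_real_derivative - 1 * (inverse x * inverse x)) (at x)" if "x \<in> - {0}" for x :: real
      using DERIV_inverse[of x UNIV] that by (simp add: power2_eq_square)
  qed auto
qed

lemma Ck_on_divide:
  fixes f g :: "'a::euclidean_space \<Rightarrow> real"
  assumes "open S" "Ck_on k S f" "Ck_on k S g" "\<And>x. x \<in> S \<Longrightarrow> g x \<noteq> 0"
  shows "Ck_on k S (\<lambda>x. f x / g x)"
  unfolding divide_inverse
  by (intro Ck_on_mult Ck_on_compose[OF _ _ Ck_on_inverse] assms) (use assms(4) in auto)

lemma Ck_on_ln: "Ck_on k {0<..} (ln :: real \<Rightarrow> real)"
proof (cases k)
  case 0 then show ?thesis by (auto intro: continuous_intros)
next
  case (Suc j)
  show ?thesis unfolding Suc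
  proof (rule Ck_on_SucI_real)
    show "Ck_on j {0<..} (inverse :: real \<Rightarrow> real)"
      by (rule Ck_on_subset[OF Ck_on_inverse]) auto
    show "(ln has_real_derivative inverse x) (at x)" if "x \<in> {0<..}" for x :: real
      using that by (auto intro!: DERIV_ln)
  qed auto
qed

section \<open>A smooth transition function on the line\<close>

definition flat :: "nat \<Rightarrow> real \<Rightarrow> real" where
  "flat m x = (if x > 0 then inverse x ^ m * exp (- inverse x) else 0)"

text \<open>With y = 1/x, the exponential of y dominates the single term y^(m+2) / (m+2)! of its
  series. The two powers beyond y^m become the factor x^2, which is what differentiability at 0
  requires.\<close>

lemma flat_bound: "\<bar>flat m x\<bar> \<le> fact (m + 2) * x\<^sup>2"
proof (cases "x > 0")
  case True
  let ?y = "inverse x"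
  have y: "?y > 0" using True by simp
  have "?y ^ (m + 2) /\<^sub>R fact (m + 2) \<le> exp ?y"
    using sum_le_suminf[OF summable_exp_generic[of ?y], of "{m + 2}"] y unfolding exp_def by simp
  then have "?y ^ (m + 2) \<le> fact (m + 2) * exp ?y"
    by (simp add: divide_inverse_commute[symmetric] pos_divide_le_eq mult.commute del: fact_Suc power_Suc)
  then have "?y ^ (m + 2) * exp (- ?y) \<le> fact (m + 2) * exp ?y * exp (- ?y)"
    by (intro mult_right_mono) auto
  also have "\<dots> = fact (m + 2)" by (simp add: mult.assoc flip: exp_add)
  finally have "?y ^ m * ?y\<^sup>2 * exp (- ?y) \<le> fact (m + 2)"
    by (simp add: power2_eq_square mult_ac del: fact_Suc)
  then have "flat m x * ?y\<^sup>2 * x\<^sup>2 \<le> fact (m + 2) * x\<^sup>2"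
    using True by (intro mult_right_mono) (simp_all add: flat_def mult_ac del: fact_Suc)
  moreover have "?y\<^sup>2 * x\<^sup>2 = 1" using True by (simp flip: power_mult_distrib)
  ultimately have "flat m x \<le> fact (m + 2) * x\<^sup>2" by (simp add: mult.assoc)
  moreover have "flat m x \<ge> 0" unfolding flat_def using True by simp
  ultimately show ?thesis by simp
qed (simp add: flat_def)

text \<open>The case with content is \<open>x = 0\<close>, where \<open>flat_bound\<close> makes the
  difference quotient at most a constant times |h|.\<close>

lemma flat_deriv: "(flat m has_real_derivative flat (m + 2) x - real m * flat (m + 1) x) (at x)"
proof -
  consider "x > 0" | "x < 0" | "x = 0" by linarith
  then show ?thesis
  proof cases
    case 1
    have "((\<lambda>x. inverse x ^ m * exp (- inverse x)) has_real_derivative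
        (real m * inverse x ^ (m - 1) * (- (inverse x)\<^sup>2)) * exp (- inverse x)
          + inverse x ^ m * (exp (- inverse x) * (inverse x)\<^sup>2)) (at x)"
      using 1 by (auto intro!: derivative_eq_intros simp: power2_eq_square)
    also have "(real m * inverse x ^ (m - 1) * (- (inverse x)\<^sup>2)) * exp (- inverse x)
          + inverse x ^ m * (exp (- inverse x) * (inverse x)\<^sup>2) =
        inverse x ^ (m + 2) * exp (- inverse x) - real m * (inverse x ^ (m + 1) * exp (- inverse x))"
      by (cases m) (auto simp: algebra_simps power2_eq_square)
    finally have "((\<lambda>x. inverse x ^ m * exp (- inverse x)) has_real_derivative
       inverse x ^ (m + 2) * exp (- inverse x) - real m * (inverse x ^ (m + 1) * exp (- inverse x))) (at x)" .
    then have "(flat m has_real_derivative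
       inverse x ^ (m + 2) * exp (- inverse x) - real m * (inverse x ^ (m + 1) * exp (- inverse x))) (at x)"
      by (rule has_field_derivative_transform_within_open[where S="{0<..}"]) (use 1 in \<open>auto simp: flat_def\<close>)
    then show ?thesis using 1 by (simp add: flat_def)
  next
    case 2
    have "((\<lambda>x. 0) has_real_derivative 0) (at x)" by simp
    then have "(flat m has_real_derivative 0) (at x)"
      by (rule has_field_derivative_transform_within_open[where S="{..<0}"]) (use 2 in \<open>auto simp: flat_def\<close>)
    then show ?thesis using 2 by (simp add: flat_def)
  next
    case 3
    have "((\<lambda>h. flat m h / h) \<longlongrightarrow> 0) (at 0)"
    proof (rule Lim_null_comparison[OF always_eventually])
      show "\<forall>h. norm (flat m h / h) \<le> fact (m + 2) * \<bar>h\<bar>"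
      proof
        fix h :: real
        show "norm (flat m h / h) \<le> fact (m + 2) * \<bar>h\<bar>"
          using flat_bound[of m h] by (cases "h = 0") (simp_all add: divide_le_eq power2_eq_square mult.assoc del: fact_Suc)
      qed
      show "((\<lambda>h. fact (m + 2) * \<bar>h\<bar>) \<longlongrightarrow> 0) (at (0::real))"
        by (rule tendsto_eq_intros | simp)+
    qed
    then have "(flat m has_real_derivative 0) (at 0)"
      by (simp add: DERIV_def flat_def)
    then show ?thesis using 3 by (simp add: flat_def)
  qed
qed

text \<open>The derivative of one member of the family is a combination of two others, so the
  induction runs over all \<open>m\<close> at once.\<close>

lemma Ck_on_flat: "Ck_on k UNIV (flat m)"
proof (induction k arbitrary: m)
  case 0
  show ?case using DERIV_isCont[OF flat_deriv] by (simp add: continuous_at_imp_continuous_on)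
next
  case (Suc k)
  show ?case
    by (rule Ck_on_SucI_real[OF _ flat_deriv]) (intro Ck_on_diff Ck_on_cmult Suc.IH open_UNIV)+
qed

text \<open>The standard smooth step, 1 up to s = 1 and 0 from s = 2 on. The denominator has no zero
  because the half-lines s < 2 and s > 1 cover the line.\<close>

definition cutoff :: "real \<Rightarrow> real" where
  "cutoff s = flat 0 (2 - s) / (flat 0 (2 - s) + flat 0 (s - 1))"

lemma flat_nonneg: "0 \<le> flat m x" and flat_pos: "x > 0 \<Longrightarrow> 0 < flat m x"
  and flat_zero: "x \<le> 0 \<Longrightarrow> flat m x = 0"
  unfolding flat_def by auto

lemma cutoff_denom: "0 < flat 0 (2 - s) + flat 0 (s - 1)"
  using flat_pos[of "2 - s" 0] flat_pos[of "s - 1" 0] flat_nonneg[of 0 "2 - s"] flat_nonneg[of 0 "s - 1"]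
  by (cases "s > 1") auto

lemma cutoff_range: "0 \<le> cutoff s" "cutoff s \<le> 1"
  using cutoff_denom[of s] flat_nonneg[of 0 "2 - s"] flat_nonneg[of 0 "s - 1"]
  unfolding cutoff_def by auto

lemma cutoff_one: "s \<le> 1 \<Longrightarrow> cutoff s = 1"
  using cutoff_denom[of s] unfolding cutoff_def by (simp add: flat_zero)

lemma cutoff_zero: "2 \<le> s \<Longrightarrow> cutoff s = 0"
  unfolding cutoff_def by (simp add: flat_zero)

lemma Ck_on_affine_real: "Ck_on k UNIV (\<lambda>s::real. a * s + b)"
proof -
  have "Ck_on k UNIV (\<lambda>s::real. a * (s \<bullet> 1) + b)"
    by (intro Ck_on_add Ck_on_cmult Ck_on_inner Ck_on_const open_UNIV)
  then show ?thesis by simp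
qed

lemma Ck_on_cutoff: "Ck_on k UNIV cutoff"
proof -
  have 1: "Ck_on k UNIV (\<lambda>s. flat 0 (2 - s))"
    using Ck_on_compose[of UNIV "\<lambda>s. (-1) * s + 2" UNIV k "flat 0"] Ck_on_flat Ck_on_affine_real[of k "-1" 2] by simp
  have 2: "Ck_on k UNIV (\<lambda>s. flat 0 (s - 1))"
    using Ck_on_compose[of UNIV "\<lambda>s. 1 * s + (-1)" UNIV k "flat 0"] Ck_on_flat Ck_on_affine_real[of k "1" "-1"] by simp
  have "Ck_on k UNIV (\<lambda>s. flat 0 (2 - s) / (flat 0 (2 - s) + flat 0 (s - 1)))"
    by (intro Ck_on_divide Ck_on_add 1 2) (use cutoff_denom in \<open>auto simp: less_le\<close>)
  then show ?thesis unfolding cutoff_def[abs_def] .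
qed

text \<open>One constant serves the gradients of all later cutoffs, since each is
  \<open>cutoff\<close> composed with a smooth function.\<close>

lemma cutoff_deriv:
  obtains C where "\<And>s. \<bar>partial 1 cutoff s\<bar> \<le> C" "C > 0"
    and "\<And>s. s < 1 \<or> s > 2 \<Longrightarrow> partial 1 cutoff s = 0"
proof -
  have z: "partial 1 cutoff s = 0" if "s < 1 \<or> s > 2" for s
  proof -
    have "partial 1 cutoff s = partial 1 (\<lambda>_. if s < 1 then 1 else 0::real) s"
      by (rule partial_cong[where S="if s < 1 then {..<1} else {2<..}"])
        (use that in \<open>auto simp: cutoff_one cutoff_zero\<close>)
    also have "\<dots> = 0" by (rule partial_eqI) auto
    finally show ?thesis .
  qed
  have "continuous_on UNIV (partial 1 cutoff)" using Ck_on_cutoff[of 1] by simp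
  then have "continuous_on {1..2} (partial 1 cutoff)" by (rule continuous_on_subset) simp
  then have "compact (partial 1 cutoff ` {1..2})" by (intro compact_continuous_image) auto
  then have "bounded (partial 1 cutoff ` {1..2})" by (rule compact_imp_bounded)
  then obtain C where C: "\<And>s. s \<in> {1..2} \<Longrightarrow> \<bar>partial 1 cutoff s\<bar> \<le> C" "C > 0"
    unfolding bounded_pos by (metis imageI real_norm_def)
  have "\<bar>partial 1 cutoff s\<bar> \<le> C" for s
    using C z[of s] by (cases "s \<in> {1..2}") auto
  then show ?thesis using that C(2) z by blast
qed

section \<open>Integration by parts and Hardy inequalities\<close>

lemma compact_support_integrable:
  fixes F :: "'a::euclidean_space \<Rightarrow> real"
  assumes "continuous_on UNIV F" "compact K" "\<And>x. x \<notin> K \<Longrightarrow> F x = 0"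
  shows "integrable lborel F"
proof -
  have "integrable lborel (\<lambda>x. indicator K x *\<^sub>R F x)"
    by (rule borel_integrable_compact[OF assms(2) continuous_on_subset[OF assms(1)]]) simp
  also have "(\<lambda>x. indicator K x *\<^sub>R F x) = F"
    using assms(3) by (intro ext) (auto simp: indicator_def)
  finally show ?thesis .
qed

text \<open>Differentiation under the integral sign is done for the gauge integral over a box; this
  identity carries it over to the Lebesgue integral.\<close>

lemma compact_support_integral_cbox:
  fixes F :: "'a::euclidean_space \<Rightarrow> real"
  assumes "continuous_on UNIV F" "\<And>x. x \<notin> cbox a b \<Longrightarrow> F x = 0"
  shows "integral (cbox a b) F = (LINT x|lborel. F x)"
proof -
  have "integral (cbox a b) F = integral UNIV (\<lambda>x. if x \<in> cbox a b then F x else 0)"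
    by (simp add: integral_restrict_UNIV)
  also have "(\<lambda>x. if x \<in> cbox a b then F x else 0) = F" using assms(2) by auto
  also have "integral UNIV F = (LINT x|lborel. F x)"
    by (rule integral_lborel) (rule compact_support_integrable[OF assms(1) compact_cbox assms(2)])
  finally show ?thesis .
qed

lemma compact_support_integral_lebesgue_on:
  fixes F :: "'a::euclidean_space \<Rightarrow> real"
  assumes "continuous_on UNIV F" "compact K" "\<And>x. x \<notin> K \<Longrightarrow> F x = 0" "K \<subseteq> D" "open D"
  shows "(LINT x|lebesgue_on D. F x) = (LINT x|lborel. F x)"
    and "integrable (lebesgue_on D) F"
proof -
  have i: "integrable lborel F" by (rule compact_support_integrable[OF assms(1-3)])
  have D: "D \<inter> space lebesgue \<in> sets lebesgue" using assms(5) by (simp add: borel_open sets_completionI_sets)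
  have e: "(\<lambda>x. indicator D x *\<^sub>R F x) = F"
    using assms(3,4) by (intro ext) (auto simp: indicator_def)
  show "(LINT x|lebesgue_on D. F x) = (LINT x|lborel. F x)"
    unfolding integral_restrict_space[OF D] e by (rule integral_completion) (use i in auto)
  show "integrable (lebesgue_on D) F"
    unfolding integrable_restrict_space[OF D] e using i
    by (subst integrable_completion) auto
qed

text \<open>A compact set that supports all the integrands reduces the claim to a fixed box.
  Derivatives are taken within a convex \<open>U\<close> so that both a compact interval of
  translations and the open half-line of times can be used.\<close>

lemma compact_support_leibniz:
  fixes f fs :: "real \<Rightarrow> 'a::euclidean_space \<Rightarrow> real"
  assumes K: "compact K" and U: "convex U" "s0 \<in> U"
    and supp: "\<And>s x. s \<in> U \<Longrightarrow> x \<notin> K \<Longrightarrow> f s x = 0" "\<And>x. x \<notin> K \<Longrightarrow> fs s0 x = 0"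
    and cont: "\<And>s. s \<in> U \<Longrightarrow> continuous_on UNIV (f s)" "continuous_on (U \<times> UNIV) (\<lambda>(s, x). fs s x)"
    and deriv: "\<And>s x. s \<in> U \<Longrightarrow> ((\<lambda>s. f s x) has_field_derivative fs s x) (at s within U)"
  shows "((\<lambda>s. LINT x|lborel. f s x) has_field_derivative (LINT x|lborel. fs s0 x)) (at s0 within U)"
proof -
  obtain c where c: "K \<subseteq> cbox (- c) c"
    using bounded_subset_cbox_symmetric[OF compact_imp_bounded[OF K]] by blast
  have "continuous_on UNIV (\<lambda>x. (case (s0, x) of (s, x) \<Rightarrow> fs s x))"
    by (rule continuous_on_compose2[OF cont(2)]) (use U in \<open>auto intro!: continuous_intros\<close>)
  then have cs0: "continuous_on UNIV (fs s0)" by simp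
  have "((\<lambda>s. integral (cbox (- c) c) (f s)) has_field_derivative integral (cbox (- c) c) (fs s0)) (at s0 within U)"
  proof (rule leibniz_rule_field_derivative)
    show "f s integrable_on cbox (- c) c" if "s \<in> U" for s
      by (rule integrable_continuous[OF continuous_on_subset[OF cont(1)[OF that]]]) simp
    show "continuous_on (U \<times> cbox (- c) c) (\<lambda>(s, x). fs s x)"
      by (rule continuous_on_subset[OF cont(2)]) auto
  qed (use deriv U in auto)
  moreover have "integral (cbox (- c) c) (fs s0) = (LINT x|lborel. fs s0 x)"
    by (rule compact_support_integral_cbox[OF cs0]) (use supp c in auto)
  moreover have "integral (cbox (- c) c) (f s) = (LINT x|lborel. f s x)" if "s \<in> U" for s
    by (rule compact_support_integral_cbox[OF cont(1)[OF that]]) (use supp c that in auto)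
  ultimately show ?thesis
    using U(2) by (auto intro: has_field_derivative_transform_within[where d=1])
qed

lemma lborel_integral_translate:
  fixes F :: "'a::euclidean_space \<Rightarrow> real"
  assumes "F \<in> borel_measurable borel"
  shows "(LINT x|lborel. F (x + c)) = (LINT x|lborel. F x)"
proof -
  have "(LINT x|lborel. F x) = (LINT x|distr lborel borel ((+) c). F x)"
    by (simp add: lborel_distr_plus)
  also have "\<dots> = (LINT x|lborel. F (c + x))"
    by (rule integral_distr) (use assms in auto)
  finally show ?thesis by (simp add: add.commute)
qed

lemma has_derivative_along_line:
  fixes F :: "'a::euclidean_space \<Rightarrow> real"
  assumes "F differentiable (at (x + s *\<^sub>R b))"
  shows "((\<lambda>s. F (x + s *\<^sub>R b)) has_field_derivative partial b F (x + s *\<^sub>R b)) (at s)"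
proof -
  let ?F' = "frechet_derivative F (at (x + s *\<^sub>R b))"
  have "((\<lambda>s. x + s *\<^sub>R b) has_derivative (\<lambda>h. h *\<^sub>R b)) (at s)"
    by (auto intro!: derivative_eq_intros)
  from diff_chain_at[OF this partial_works[OF assms]]
  have "((\<lambda>s. F (x + s *\<^sub>R b)) has_derivative (\<lambda>h. ?F' (h *\<^sub>R b))) (at s)" by (simp add: o_def)
  moreover have "?F' (h *\<^sub>R b) = partial b F (x + s *\<^sub>R b) * h" for h
    using linear_scale[OF linear_frechet_derivative[OF assms]] by (simp add: partial_def)
  ultimately show ?thesis by (simp add: has_field_derivative_def)
qed

lemma partial_zero_outside:
  fixes F :: "'a::euclidean_space \<Rightarrow> real"
  assumes "closed K" "\<And>x. x \<notin> K \<Longrightarrow> F x = 0" "x \<notin> K"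
  shows "partial b F x = 0"
proof -
  have "partial b F x = partial b (\<lambda>_. 0::real) x"
    by (rule partial_cong[where S="- K"]) (use assms in auto)
  also have "\<dots> = 0" by (rule partial_eqI) auto
  finally show ?thesis .
qed

text \<open>By translation invariance the integral of \<open>F (x + s *\<^sub>R b)\<close> is
  constant in \<open>s\<close>; its derivative at 0 is the integral in question.\<close>

lemma integral_partial_compact_support:
  fixes F :: "'a::euclidean_space \<Rightarrow> real"
  assumes F: "Ck_on 1 UNIV F" and K: "compact K" "\<And>x. x \<notin> K \<Longrightarrow> F x = 0" and b: "b \<in> Basis"
  shows "(LINT x|lborel. partial b F x) = 0"
proof -
  \<comment> \<open>All translates of \<open>K\<close> along \<open>b\<close> by at most 1: a
    compact support common to all parameters in \<open>{-1..1}\<close>.\<close>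
  define K' where "K' = (\<lambda>(x, s). x - s *\<^sub>R b) ` (K \<times> {-1..1::real})"
  have cK': "compact K'" unfolding K'_def
    by (intro compact_continuous_image compact_Times K) (auto intro!: continuous_intros simp: case_prod_beta)
  have nK': "x + s *\<^sub>R b \<notin> K" if "x \<notin> K'" "s \<in> {-1..1}" for x s
    using that unfolding K'_def by (force intro: image_eqI[where x="(x + s *\<^sub>R b, s)"])
  have cF: "continuous_on UNIV F" using Ck_on_SucD[of 0 UNIV F] F by simp
  have cp: "continuous_on UNIV (partial b F)" using F b by simp
  have "((\<lambda>s. LINT x|lborel. F (x + s *\<^sub>R b)) has_field_derivative (LINT x|lborel. partial b F (x + 0 *\<^sub>R b))) (at 0 within {-1..1})"
  proof (rule compact_support_leibniz[OF cK'])
    show "F (x + s *\<^sub>R b) = 0" if "s \<in> {-1..1}" "x \<notin> K'" for s x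
      using nK'[OF that(2,1)] K(2) by simp
    show "partial b F (x + 0 *\<^sub>R b) = 0" if "x \<notin> K'" for x
      using nK'[OF that, of 0] partial_zero_outside[OF compact_imp_closed[OF K(1)] K(2)] by simp
    show "continuous_on UNIV (\<lambda>x. F (x + s *\<^sub>R b))" for s
      by (rule continuous_on_compose2[OF cF]) (auto intro!: continuous_intros)
    show "continuous_on ({-1..1} \<times> UNIV) (\<lambda>(s, x). partial b F (x + s *\<^sub>R b))"
      unfolding case_prod_beta by (rule continuous_on_compose2[OF cp]) (auto intro!: continuous_intros)
    show "((\<lambda>s. F (x + s *\<^sub>R b)) has_field_derivative partial b F (x + s *\<^sub>R b)) (at s within {-1..1})" for s x
      by (rule has_field_derivative_at_within, rule has_derivative_along_line) (use F in simp)
  qed auto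
  moreover have "(\<lambda>s. LINT x|lborel. F (x + s *\<^sub>R b)) = (\<lambda>s. LINT x|lborel. F x)"
    by (rule ext, rule lborel_integral_translate) (use cF in \<open>rule borel_measurable_continuous_onI\<close>)
  moreover have "((\<lambda>s::real. LINT x|lborel. F x) has_field_derivative 0) (at 0 within {-1..1})" by simp
  ultimately have "0 = (LINT x|lborel. partial b F (x + 0 *\<^sub>R b))"
    using at_within_interior[of 0 "{-1..1::real}"] by (simp add: DERIV_unique)
  then show ?thesis by simp
qed

text \<open>Allows factors such as \<open>V\<close> or quotients by \<open>u\<close>, controlled
  only off the origin, in integrands whose support avoids the origin.\<close>

lemma continuous_on_glue:
  fixes F :: "'a::euclidean_space \<Rightarrow> real"
  assumes "closed K" "\<And>x. x \<notin> K \<Longrightarrow> F x = 0" "open S" "K \<subseteq> S" "continuous_on S F"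
  shows "continuous_on UNIV F"
proof -
  have "continuous_on (S \<union> (- K)) F"
    using assms by (intro continuous_on_open_Un) (auto intro: continuous_on_eq[of _ "\<lambda>_. 0"])
  moreover have "S \<union> (- K) = UNIV" using assms(4) by auto
  ultimately show ?thesis by simp
qed

lemma Ck_on_glue:
  fixes F :: "'a::euclidean_space \<Rightarrow> real"
  assumes "closed K" "\<And>x. x \<notin> K \<Longrightarrow> F x = 0" "open S" "K \<subseteq> S" "Ck_on k S F"
  shows "Ck_on k UNIV F"
proof (rule Ck_on_local)
  fix x
  have z: "Ck_on k (- K) F"
    by (rule Ck_on_cong[OF _ _ Ck_on_const[of k "- K" 0]]) (use assms in auto)
  show "\<exists>U. open U \<and> x \<in> U \<and> Ck_on k U F"
  proof (cases "x \<in> K")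
    case True then show ?thesis using assms by blast
  next
    case False then show ?thesis using assms(1) z by (intro exI[of _ "- K"]) auto
  qed
qed

text \<open>Completing the square: \<open>\<bar>\<nabla>\<eta> + \<eta> X\<bar>\<^sup>2 = \<bar>\<nabla>\<eta>\<bar>\<^sup>2 + div (\<eta>\<^sup>2 X) - \<eta>\<^sup>2 (div X - \<bar>X\<bar>\<^sup>2)\<close>.\<close>

lemma hardy_vector_field:
  fixes \<eta> :: "'a::euclidean_space \<Rightarrow> real" and X :: "'a \<Rightarrow> 'a \<Rightarrow> real"
  assumes \<eta>: "Ck_on 1 UNIV \<eta>" and K: "compact K" "\<And>x. x \<notin> K \<Longrightarrow> \<eta> x = 0"
    and S: "open S" "K \<subseteq> S" and X: "\<And>b. b \<in> Basis \<Longrightarrow> Ck_on 1 S (X b)"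
  shows "(LINT x|lborel. (\<eta> x)\<^sup>2 * (\<Sum>b\<in>Basis. partial b (X b) x - (X b x)\<^sup>2))
    \<le> (LINT x|lborel. (\<Sum>b\<in>Basis. (partial b \<eta> x)\<^sup>2))"
proof -
  have clK: "closed K" by (rule compact_imp_closed[OF K(1)])
  define F where "F b x = \<eta> x * \<eta> x * X b x" for b x
  have F0: "F b x = 0" if "x \<notin> K" for b x using K(2)[OF that] unfolding F_def by simp
  have F1: "Ck_on 1 UNIV (F b)" if "b \<in> Basis" for b
  proof (rule Ck_on_glue[OF clK _ S])
    show "Ck_on 1 S (F b)" unfolding F_def
      by (intro Ck_on_mult S(1) X that Ck_on_subset[OF \<eta>]) auto
  qed (rule F0)
  have d\<eta>: "\<eta> differentiable at x" for x using \<eta> by simp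
  have c\<eta>: "continuous_on UNIV \<eta>" using Ck_on_SucD[of 0 UNIV \<eta>] \<eta> by simp
  have cd\<eta>: "continuous_on UNIV (partial b \<eta>)" if "b \<in> Basis" for b using \<eta> that by simp
  have dF: "partial b (F b) x = 2 * \<eta> x * partial b \<eta> x * X b x + (\<eta> x)\<^sup>2 * partial b (X b) x"
    if "b \<in> Basis" "x \<in> S" for b x
  proof -
    have "X b differentiable at x" using X[OF that(1)] that(2) by simp
    then show ?thesis unfolding F_def
      by (subst partial_mult) (auto intro: differentiable_mult d\<eta> simp: partial_mult d\<eta> power2_eq_square algebra_simps)
  qed
  have iF: "integrable lborel (partial b (F b))" if "b \<in> Basis" for b
    by (rule compact_support_integrable[OF _ K(1)])
      (use F1[OF that] that partial_zero_outside[OF clK F0] in auto)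
  have id: "integrable lborel (\<lambda>x. \<Sum>b\<in>Basis. (partial b \<eta> x)\<^sup>2)"
  proof (rule compact_support_integrable[OF _ K(1)])
    show "continuous_on UNIV (\<lambda>x. \<Sum>b\<in>Basis. (partial b \<eta> x)\<^sup>2)"
      by (intro continuous_intros cd\<eta>)
    show "(\<Sum>b\<in>Basis. (partial b \<eta> x)\<^sup>2) = 0" if "x \<notin> K" for x
      using partial_zero_outside[OF clK K(2) that] by simp
  qed
  have iA: "integrable lborel (\<lambda>x. (\<eta> x)\<^sup>2 * (\<Sum>b\<in>Basis. partial b (X b) x - (X b x)\<^sup>2))"
  proof (rule compact_support_integrable[OF _ K(1)])
    show "continuous_on UNIV (\<lambda>x. (\<eta> x)\<^sup>2 * (\<Sum>b\<in>Basis. partial b (X b) x - (X b x)\<^sup>2))"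
    proof (rule continuous_on_glue[OF clK _ S])
      show "continuous_on S (\<lambda>x. (\<eta> x)\<^sup>2 * (\<Sum>b\<in>Basis. partial b (X b) x - (X b x)\<^sup>2))"
        using X Ck_on_SucD[of 0 S "X _"]
        by (intro continuous_intros continuous_on_subset[OF c\<eta>]) auto
    qed (simp add: K)
  qed (simp add: K)
  \<comment> \<open>The added sum is the divergence of \<eta>^2 X, whose integral vanishes. The
    pointwise inequality comes from the square on \<open>K\<close>, and off \<open>K\<close> both
    sides are zero.\<close>
  have "(LINT x|lborel. (\<eta> x)\<^sup>2 * (\<Sum>b\<in>Basis. partial b (X b) x - (X b x)\<^sup>2))
    \<le> (LINT x|lborel. (\<Sum>b\<in>Basis. (partial b \<eta> x)\<^sup>2) + (\<Sum>b\<in>Basis. partial b (F b) x))"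
  proof (rule integral_mono)
    fix x
    show "(\<eta> x)\<^sup>2 * (\<Sum>b\<in>Basis. partial b (X b) x - (X b x)\<^sup>2) \<le>
      (\<Sum>b\<in>Basis. (partial b \<eta> x)\<^sup>2) + (\<Sum>b\<in>Basis. partial b (F b) x)"
    proof (cases "x \<in> K")
      case True
      have "(\<eta> x)\<^sup>2 * (partial b (X b) x - (X b x)\<^sup>2) \<le> (partial b \<eta> x)\<^sup>2 + partial b (F b) x" if b: "b \<in> Basis" for b
      proof -
        have "0 \<le> (partial b \<eta> x + \<eta> x * X b x)\<^sup>2" by simp
        then show ?thesis using True S(2) dF[OF b, of x]
          by (auto simp: power2_sum power_mult_distrib algebra_simps)
      qed
      then show ?thesis unfolding sum_distrib_left sum.distrib[symmetric] by (rule sum_mono)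
    next
      case False
      then show ?thesis using partial_zero_outside[OF clK K(2) False] partial_zero_outside[OF clK F0 False] K(2) by simp
    qed
  qed (use id iF iA in auto)
  also have "\<dots> = (LINT x|lborel. (\<Sum>b\<in>Basis. (partial b \<eta> x)\<^sup>2)) + (\<Sum>b\<in>Basis. LINT x|lborel. partial b (F b) x)"
    using id iF by simp
  also have "(\<Sum>b\<in>Basis. LINT x|lborel. partial b (F b) x) = 0"
    using integral_partial_compact_support[OF F1 K(1) F0] by simp
  finally show ?thesis by simp
qed

text \<open>The divergence theorem for the field \<eta> grad \<theta>. Its support is that of
  \<theta>, so \<eta> may be any C^1 function.\<close>

lemma integration_by_parts_laplacian:
  fixes \<eta> \<theta> :: "'a::euclidean_space \<Rightarrow> real"
  assumes \<eta>: "Ck_on 1 UNIV \<eta>" and \<theta>: "Ck_on 2 UNIV \<theta>" and K: "compact K" "\<And>x. x \<notin> K \<Longrightarrow> \<theta> x = 0"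
  shows "(LINT x|lborel. \<eta> x * laplacian \<theta> x) = - (LINT x|lborel. (\<Sum>b\<in>Basis. partial b \<eta> x * partial b \<theta> x))"
proof -
  have clK: "closed K" by (rule compact_imp_closed[OF K(1)])
  have \<theta>2: "Ck_on (Suc (Suc 0)) UNIV \<theta>" using \<theta> by (simp add: numeral_2_eq_2)
  have \<theta>1: "Ck_on 1 UNIV (partial b \<theta>)" if "b \<in> Basis" for b using \<theta>2 that by simp
  have z1: "partial b \<theta> x = 0" if "x \<notin> K" for b x
    by (rule partial_zero_outside[OF clK K(2) that])
  have z2: "partial b (partial b \<theta>) x = 0" if "x \<notin> K" for b x
    by (rule partial_zero_outside[OF clK z1 that])
  define F where "F b x = \<eta> x * partial b \<theta> x" for b x
  have F0: "F b x = 0" if "x \<notin> K" for b x using z1[OF that] unfolding F_def by simp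
  have F1: "Ck_on 1 UNIV (F b)" if "b \<in> Basis" for b
    unfolding F_def by (intro Ck_on_mult \<eta> \<theta>1 that) auto
  have dF: "partial b (F b) x = \<eta> x * partial b (partial b \<theta>) x + partial b \<eta> x * partial b \<theta> x" if "b \<in> Basis" for b x
    unfolding F_def by (rule partial_mult) (use \<eta> \<theta>1[OF that] in auto)
  have c\<eta>: "continuous_on UNIV \<eta>" using Ck_on_SucD[of 0 UNIV \<eta>] \<eta> by simp
  have c1: "continuous_on UNIV (partial b \<theta>)" "continuous_on UNIV (partial b (partial b \<theta>))" if "b \<in> Basis" for b
    using \<theta>1[OF that] Ck_on_SucD[of 0 UNIV "partial b \<theta>"] that by auto
  have i1: "integrable lborel (\<lambda>x. \<eta> x * partial b (partial b \<theta>) x)" if "b \<in> Basis" for b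
    by (rule compact_support_integrable[OF _ K(1)]) (auto intro!: continuous_intros c1 c\<eta> simp: z2 that)
  have i2: "integrable lborel (\<lambda>x. partial b \<eta> x * partial b \<theta> x)" if "b \<in> Basis" for b
    by (rule compact_support_integrable[OF _ K(1)]) (use \<eta> that in \<open>auto intro!: continuous_intros c1 simp: z1\<close>)
  have "0 = (LINT x|lborel. \<eta> x * partial b (partial b \<theta>) x) + (LINT x|lborel. partial b \<eta> x * partial b \<theta> x)"
    if b: "b \<in> Basis" for b
    using integral_partial_compact_support[OF F1[OF b] K(1) F0 b] i1[OF b] i2[OF b] dF[OF b] by simp
  then have "(\<Sum>b\<in>Basis. LINT x|lborel. \<eta> x * partial b (partial b \<theta>) x) =
      - (\<Sum>b\<in>Basis. LINT x|lborel. partial b \<eta> x * partial b \<theta> x)"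
    unfolding sum_negf[symmetric] by (intro sum.cong) (auto simp: eq_neg_iff_add_eq_0)
  then show ?thesis unfolding laplacian_def sum_distrib_left using i1 i2 by simp
qed

section \<open>Positivity of solutions\<close>

text \<open>If \<open>c < 0\<close>, then g' vanishes at 0 and is negative just to the right of it,
  so by the mean value theorem g falls below its minimum. The second derivative need exist only at
  0.\<close>

lemma second_derivative_nonneg_at_min:
  fixes g g' :: "real \<Rightarrow> real"
  assumes d: "d > 0" and g: "\<And>h. \<bar>h\<bar> < d \<Longrightarrow> (g has_real_derivative g' h) (at h)"
    and g': "(g' has_real_derivative c) (at 0)" and min: "\<And>h. \<bar>h\<bar> < d \<Longrightarrow> g 0 \<le> g h"
  shows "0 \<le> c"
proof (rule ccontr)
  assume "\<not> 0 \<le> c"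
  then have c: "c < 0" by simp
  have "g' 0 = 0"
    by (rule DERIV_local_min[OF g d]) (use d min in auto)
  then obtain e where e: "e > 0" "\<And>h. 0 < h \<Longrightarrow> h < e \<Longrightarrow> g' h < 0"
    using DERIV_neg_dec_right[OF g' c] by auto
  define h where "h = min d e / 2"
  have h: "0 < h" "h < d" "h < e" using d e(1) unfolding h_def by auto
  obtain z where z: "0 < z" "z < h" "g h - g 0 = (h - 0) * g' z"
    using MVT2[OF h(1), of g g'] g h(2) by (metis abs_of_nonneg order.strict_trans1)
  have "h * g' z < 0" using h(1) e(2)[of z] z h by (simp add: mult_pos_neg)
  then show False using min[of h] h z(3) by auto
qed

text \<open>The barrier \<open>\<epsilon> exp (- \<kappa> (t - t0)) s\<^sup>2\<close> with \<open>s = r\<^sup>2 + c (t - t0) - |x - x0|\<^sup>2\<close> is a subsolution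
  of \<open>v_t = \<Delta> v - M v\<close> where \<open>s > 0\<close>, provided that \<open>\<kappa>\<close> is large; \<open>c\<close> is chosen so that its support
  has grown from radius \<open>r\<close> to radius \<open>R\<close> at time \<open>t1\<close>.\<close>

lemma positivity_spreads:
  fixes u ut :: "'a::euclidean_space \<Rightarrow> real \<Rightarrow> real"
  assumes M: "M > 0" and R: "R > 0" and t01: "t0 < t1"
    and cont: "continuous_on (cball x0 R \<times> {t0..t1}) (\<lambda>(x, t). u x t)"
    and nonneg: "\<And>x t. x \<in> cball x0 R \<Longrightarrow> t \<in> {t0..t1} \<Longrightarrow> 0 \<le> u x t"
    and dt: "\<And>x t. x \<in> ball x0 R \<Longrightarrow> t \<in> {t0<..t1} \<Longrightarrow> (u x has_real_derivative ut x t) (at t)"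
    and C2: "\<And>t. t \<in> {t0<..t1} \<Longrightarrow> Ck_on 2 (ball x0 R) (\<lambda>x. u x t)"
    and super: "\<And>x t. x \<in> ball x0 R \<Longrightarrow> t \<in> {t0<..t1} \<Longrightarrow>
      laplacian (\<lambda>x. u x t) x - M * u x t \<le> ut x t"
    and pos: "u x0 t0 > 0" and y: "y \<in> ball x0 R"
  shows "u y t1 > 0"
proof (rule ccontr)
  assume neg: "\<not> u y t1 > 0"
  define m where "m = u x0 t0 / 2"
  have m: "m > 0" using pos unfolding m_def by simp
  have "continuous_on (cball x0 R) (\<lambda>x. (case (x, t0) of (x, t) \<Rightarrow> u x t))"
    by (rule continuous_on_compose2[OF cont]) (use t01 in \<open>auto intro!: continuous_intros\<close>)
  then have c0: "continuous_on (cball x0 R) (\<lambda>x. u x t0)" by simp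
  obtain r where r: "0 < r" "r < R" and ur: "\<And>x. x \<in> cball x0 r \<Longrightarrow> m \<le> u x t0"
  proof -
    obtain d where d: "d > 0" "\<And>x. x \<in> cball x0 R \<Longrightarrow> dist x x0 < d \<Longrightarrow> dist (u x t0) (u x0 t0) < m"
      using c0 m R unfolding continuous_on_iff by (metis centre_in_cball less_imp_le)
    define r where "r = min d R / 2"
    have r: "0 < r" "r < R" "r < d" unfolding r_def using d(1) R by auto
    have "m \<le> u x t0" if "x \<in> cball x0 r" for x
    proof -
      have "dist (u x t0) (u x0 t0) < m" using d(2)[of x] that r by (auto simp: dist_commute)
      then show ?thesis unfolding m_def dist_real_def by linarith
    qed
    then show ?thesis using that r by blast
  qed
  define c where "c = (R\<^sup>2 - r\<^sup>2) / (t1 - t0)"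
  have "r\<^sup>2 < R\<^sup>2" using r by (intro power_strict_mono) auto
  then have c: "c > 0" unfolding c_def using t01 by simp
  define n where "n = real DIM('a)"
  \<comment> \<open>\<open>B\<close> collects the coefficients of \<open>s\<close> in the final
    inequality: 2c from the time derivative, 4n from the Laplacian, 8 from replacing |x - x0|^2 by
    r^2 - s. With the \<open>\<kappa>\<close> below,
    \<open>(\<kappa> - M) * s\<^sup>2 - B * s + 8 * r\<^sup>2\<close> is a perfect square.\<close>
  define B where "B = 2 * c + 4 * n + 8"
  define \<kappa> where "\<kappa> = M + B\<^sup>2 / (32 * r\<^sup>2)"
  \<comment> \<open>Chosen so that at time t0, where s is at most r^2, the barrier does not exceed
    \<open>m\<close>.\<close>
  define \<epsilon> where "\<epsilon> = m / (r\<^sup>2)\<^sup>2"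
  have \<epsilon>: "\<epsilon> > 0" using m r unfolding \<epsilon>_def by simp
  define s where "s x t = r\<^sup>2 + c * (t - t0) - (norm (x - x0))\<^sup>2" for x t
  define v where "v x t = \<epsilon> * exp (- \<kappa> * (t - t0)) * (s x t)\<^sup>2" for x t
  \<comment> \<open>The part of the cylinder that carries the barrier. It is compact, so
    \<open>u - v\<close> attains its minimum on it.\<close>
  define Q where "Q = {(x, t). x \<in> cball x0 R \<and> t \<in> {t0..t1} \<and> 0 \<le> s x t}"
  have sR: "s x t1 = R\<^sup>2 - (norm (x - x0))\<^sup>2" for x
    using t01 unfolding s_def c_def by simp
  have cs: "continuous_on UNIV (\<lambda>(x, t). s x t)"
    unfolding s_def case_prod_beta by (intro continuous_intros)
  have Qeq: "Q = (cball x0 R \<times> {t0..t1}) \<inter> {z. 0 \<le> (case z of (x, t) \<Rightarrow> s x t)}"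
    unfolding Q_def by auto
  have "compact Q" unfolding Qeq
    using closed_Collect_le[OF continuous_on_const cs, of 0] by (intro compact_Int_closed compact_Times) auto
  have "(norm (y - x0))\<^sup>2 \<le> R\<^sup>2"
    using y by (intro power_mono) (auto simp: dist_norm norm_minus_commute)
  then have yQ: "(y, t1) \<in> Q" using y t01 sR[of y] unfolding Q_def by simp
  have cw: "continuous_on Q (\<lambda>(x, t). u x t - v x t)"
  proof -
    have "continuous_on Q (\<lambda>(x, t). v x t)" unfolding v_def s_def case_prod_beta by (intro continuous_intros)
    moreover have "continuous_on Q (\<lambda>(x, t). u x t)" by (rule continuous_on_subset[OF cont]) (auto simp: Q_def)
    ultimately show ?thesis unfolding case_prod_beta by (intro continuous_intros)
  qed
  obtain z where z: "z \<in> Q" "\<And>z'. z' \<in> Q \<Longrightarrow> (case z of (x, t) \<Rightarrow> u x t - v x t) \<le> (case z' of (x, t) \<Rightarrow> u x t - v x t)"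
    using continuous_attains_inf[OF \<open>compact Q\<close> _ cw] yQ by blast
  obtain x t where xt: "z = (x, t)" by (cases z)
  have inQ: "x \<in> cball x0 R" "t \<in> {t0..t1}" "0 \<le> s x t" using z(1) unfolding xt Q_def by auto
  have min: "u x t - v x t \<le> u x' t' - v x' t'" if "(x', t') \<in> Q" for x' t'
    using z(2)[OF that] unfolding xt by simp
  have "v y t1 > 0"
  proof -
    have "norm (y - x0) < R" using y by (simp add: dist_norm norm_minus_commute)
    then have "(norm (y - x0))\<^sup>2 < R\<^sup>2" by (intro power_strict_mono) auto
    then have "s y t1 > 0" unfolding sR by simp
    then show ?thesis unfolding v_def using \<epsilon> by simp
  qed
  \<comment> \<open>At the minimum the barrier exceeds \<open>u\<close> and is therefore positive,
    which keeps the point off the lateral boundary s = 0. The initial time is excluded afterwards,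
    so the equation may be used at this point.\<close>
  then have uv: "u x t < v x t" using min[OF yQ] neg by linarith
  then have v0: "v x t > 0" using nonneg[OF inQ(1,2)] by linarith
  then have s0: "s x t > 0" using inQ(3) unfolding v_def by (cases "s x t = 0") auto
  have tt: "t > t0"
  proof (rule ccontr)
    assume "\<not> t > t0"
    then have "t = t0" using inQ by simp
    then have nr: "(norm (x - x0))\<^sup>2 \<le> r\<^sup>2" using inQ(3) unfolding s_def by simp
    then have "norm (x - x0) \<le> r" by (rule power2_le_imp_le) (use r in auto)
    then have 1: "m \<le> u x t" using ur[of x] \<open>t = t0\<close> by (simp add: dist_norm norm_minus_commute)
    have "(s x t)\<^sup>2 \<le> (r\<^sup>2)\<^sup>2" using inQ(3) unfolding s_def \<open>t = t0\<close> by (intro power_mono) auto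
    then have "\<epsilon> * (s x t)\<^sup>2 \<le> \<epsilon> * (r\<^sup>2)\<^sup>2" using \<epsilon> by (intro mult_left_mono) auto
    also have "\<dots> = m" unfolding \<epsilon>_def using r by simp
    finally have "v x t \<le> m" unfolding v_def \<open>t = t0\<close> by simp
    then show False using 1 uv by linarith
  qed
  have t': "t \<in> {t0<..t1}" using tt inQ by simp
  have sle: "s x' t \<le> R\<^sup>2 - (norm (x' - x0))\<^sup>2" for x'
  proof -
    have "c * (t - t0) \<le> c * (t1 - t0)" using c inQ by (intro mult_left_mono) auto
    then show ?thesis using sR[of x'] unfolding s_def by linarith
  qed
  have inball: "x' \<in> ball x0 R" if "s x' t > 0" for x'
  proof -
    have "(norm (x' - x0))\<^sup>2 < R\<^sup>2" using sle[of x'] that by linarith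
    then have "norm (x' - x0) < R" by (rule power_less_imp_less_base) (use R in simp)
    then show ?thesis by (simp add: dist_norm norm_minus_commute)
  qed
  have xb: "x \<in> ball x0 R" by (rule inball[OF s0])
  define A where "A = \<epsilon> * exp (- \<kappa> * (t - t0))"
  have A: "A > 0" unfolding A_def using \<epsilon> by simp
  let ?y = "x - x0"
  \<comment> \<open>The minimum may occur at the final time, so only earlier times are compared: a
    positive time derivative of \<open>u - v\<close> would give a smaller value just before
    \<open>t\<close>.\<close>
  have time: "ut x t \<le> A * (2 * c * s x t - \<kappa> * (s x t)\<^sup>2)"
  proof (rule ccontr)
    assume "\<not> ?thesis"
    then have l: "0 < ut x t - A * (2 * c * s x t - \<kappa> * (s x t)\<^sup>2)" by simp
    have "((\<lambda>\<tau>. v x \<tau>) has_real_derivative A * (2 * c * s x t - \<kappa> * (s x t)\<^sup>2)) (at t)"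
      unfolding v_def s_def A_def
      by (auto intro!: derivative_eq_intros simp: algebra_simps power2_eq_square)
    from DERIV_diff[OF dt[OF xb t'] this] l
    obtain e where e: "e > 0" "\<And>h. h > 0 \<Longrightarrow> h < e \<Longrightarrow> u x (t - h) - v x (t - h) < u x t - v x t"
      using DERIV_pos_inc_left by blast
    \<comment> \<open>The backward step must stay after t0, and \<open>c * h \<le> s x t\<close>
      keeps the earlier point inside \<open>Q\<close>.\<close>
    define h where "h = min (e / 2) (min (t - t0) (s x t / c))"
    have h: "h > 0" "h < e" "h \<le> t - t0" "h \<le> s x t / c"
      unfolding h_def using e(1) tt s0 c by auto
    have "c * h \<le> s x t" using h(4) c by (simp add: field_simps)
    then have "(x, t - h) \<in> Q" using h inQ unfolding Q_def s_def by (auto simp: algebra_simps)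
    then show False using min e(2)[OF h(1,2)] by force
  qed
  \<comment> \<open>The second derivative test for \<open>u - v\<close> on the line through
    \<open>x\<close> in direction \<open>b\<close>; the left side is the second derivative of the
    barrier.\<close>
  have space: "A * (8 * (?y \<bullet> b)\<^sup>2 - 4 * s x t) \<le> partial b (partial b (\<lambda>x. u x t)) x" if b: "b \<in> Basis" for b
  proof -
    have os: "open {x'. 0 < s x' t}"
      unfolding s_def by (intro open_Collect_less continuous_intros)
    then obtain d where d: "d > 0" "ball x d \<subseteq> {x'. 0 < s x' t}"
      using s0 open_contains_ball by (metis mem_Collect_eq)
    have xs: "0 < s (x + h *\<^sub>R b) t" if "\<bar>h\<bar> < d" for h
    proof -
      have "x + h *\<^sub>R b \<in> ball x d" using that b by (simp add: dist_norm)
      then show ?thesis using d(2) by blast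
    qed
    have sh: "s (x + h *\<^sub>R b) t = s x t - 2 * h * (?y \<bullet> b) - h\<^sup>2" for h
    proof -
      have e: "x + h *\<^sub>R b - x0 = ?y + h *\<^sub>R b" by simp
      then have "(norm (x + h *\<^sub>R b - x0))\<^sup>2 = (norm ?y)\<^sup>2 + 2 * h * (?y \<bullet> b) + h\<^sup>2"
        unfolding e power2_norm_eq_inner inner_add_left inner_add_right
        using b inner_commute[of b ?y] by (simp add: power2_eq_square)
      then show ?thesis unfolding s_def by simp
    qed
    have C2': "Ck_on (Suc (Suc 0)) (ball x0 R) (\<lambda>x. u x t)" using C2[OF t'] by (simp add: numeral_2_eq_2)
    have "0 \<le> partial b (partial b (\<lambda>x. u x t)) x - A * (8 * (?y \<bullet> b)\<^sup>2 - 4 * s x t)"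
    proof (rule second_derivative_nonneg_at_min[OF d(1)])
      fix h :: real assume h: "\<bar>h\<bar> < d"
      have "(\<lambda>x. u x t) differentiable at (x + h *\<^sub>R b)" using C2' inball[OF xs[OF h]] by simp
      from has_derivative_along_line[OF this]
      have "((\<lambda>h. u (x + h *\<^sub>R b) t) has_real_derivative partial b (\<lambda>x. u x t) (x + h *\<^sub>R b)) (at h)" .
      moreover have "((\<lambda>h. A * (s x t - 2 * h * (?y \<bullet> b) - h\<^sup>2)\<^sup>2) has_real_derivative
          A * (2 * (s x t - 2 * h * (?y \<bullet> b) - h\<^sup>2) * (- 2 * (?y \<bullet> b) - 2 * h))) (at h)"
        by (auto intro!: derivative_eq_intros)
      ultimately show "((\<lambda>h. u (x + h *\<^sub>R b) t - A * (s x t - 2 * h * (?y \<bullet> b) - h\<^sup>2)\<^sup>2) has_real_derivative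
          partial b (\<lambda>x. u x t) (x + h *\<^sub>R b) - A * (2 * (s x t - 2 * h * (?y \<bullet> b) - h\<^sup>2) * (- 2 * (?y \<bullet> b) - 2 * h))) (at h)"
        by (rule DERIV_diff)
      have "(x + h *\<^sub>R b, t) \<in> Q"
        using inball[OF xs[OF h]] xs[OF h] inQ unfolding Q_def by auto
      from min[OF this]
      show "u (x + 0 *\<^sub>R b) t - A * (s x t - 2 * 0 * (?y \<bullet> b) - 0\<^sup>2)\<^sup>2 \<le>
          u (x + h *\<^sub>R b) t - A * (s x t - 2 * h * (?y \<bullet> b) - h\<^sup>2)\<^sup>2"
        unfolding v_def sh A_def by simp
    next
      have "partial b (\<lambda>x. u x t) differentiable at (x + 0 *\<^sub>R b)" using C2' xb b by simp
      from has_derivative_along_line[OF this]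
      have "((\<lambda>h. partial b (\<lambda>x. u x t) (x + h *\<^sub>R b)) has_real_derivative partial b (partial b (\<lambda>x. u x t)) x) (at 0)" by simp
      moreover have "((\<lambda>h. A * (2 * (s x t - 2 * h * (?y \<bullet> b) - h\<^sup>2) * (- 2 * (?y \<bullet> b) - 2 * h))) has_real_derivative
          A * (8 * (?y \<bullet> b)\<^sup>2 - 4 * s x t)) (at 0)"
        by (auto intro!: derivative_eq_intros simp: power2_eq_square)
      ultimately show "((\<lambda>h. partial b (\<lambda>x. u x t) (x + h *\<^sub>R b) - A * (2 * (s x t - 2 * h * (?y \<bullet> b) - h\<^sup>2) * (- 2 * (?y \<bullet> b) - 2 * h))) has_real_derivative
          partial b (partial b (\<lambda>x. u x t)) x - A * (8 * (?y \<bullet> b)\<^sup>2 - 4 * s x t)) (at 0)"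
        by (rule DERIV_diff)
    qed
    then show ?thesis by simp
  qed
  have lap: "A * (8 * (norm ?y)\<^sup>2 - 4 * n * s x t) \<le> laplacian (\<lambda>x. u x t) x"
  proof -
    have "(\<Sum>b\<in>Basis. A * (8 * (?y \<bullet> b)\<^sup>2 - 4 * s x t)) \<le> laplacian (\<lambda>x. u x t) x"
      unfolding laplacian_def by (rule sum_mono[OF space])
    moreover have "(\<Sum>b\<in>Basis. A * (8 * (?y \<bullet> b)\<^sup>2 - 4 * s x t)) = A * (8 * (\<Sum>b\<in>Basis. (?y \<bullet> b)\<^sup>2) - 4 * n * s x t)"
      by (simp add: sum_distrib_left[symmetric] sum_subtractf n_def)
    moreover have "(\<Sum>b\<in>Basis. (?y \<bullet> b)\<^sup>2) = (norm ?y)\<^sup>2"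
      unfolding power2_norm_eq_inner euclidean_inner[of ?y ?y] by (simp add: power2_eq_square)
    ultimately show ?thesis by simp
  qed
  have "M * u x t < M * v x t" using uv M by simp
  then have "A * (8 * (norm ?y)\<^sup>2 - 4 * n * s x t) - M * v x t < A * (2 * c * s x t - \<kappa> * (s x t)\<^sup>2)"
    using time lap super[OF xb t'] by linarith
  moreover have "v x t = A * (s x t)\<^sup>2" unfolding v_def A_def ..
  ultimately have "A * (8 * (norm ?y)\<^sup>2 - 4 * n * s x t - M * (s x t)\<^sup>2) < A * (2 * c * s x t - \<kappa> * (s x t)\<^sup>2)"
    by (simp add: algebra_simps)
  then have 1: "8 * (norm ?y)\<^sup>2 - 4 * n * s x t - M * (s x t)\<^sup>2 < 2 * c * s x t - \<kappa> * (s x t)\<^sup>2"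
    using A by simp
  have "0 \<le> c * (t - t0)" using c tt by simp
  then have 2: "r\<^sup>2 - s x t \<le> (norm ?y)\<^sup>2" unfolding s_def by simp
  \<comment> \<open>The perfect square for which \<kappa> was chosen. Together with 2 it contradicts
    the strict inequality 1, whose strictness stems from \<open>u < v\<close> at the
    minimum.\<close>
  have "0 \<le> (B * s x t - 16 * r\<^sup>2)\<^sup>2 / (32 * r\<^sup>2)" by simp
  also have "\<dots> = B\<^sup>2 / (32 * r\<^sup>2) * (s x t)\<^sup>2 - B * s x t + 8 * r\<^sup>2"
    using r by (simp add: field_simps power2_eq_square)
  also have "B\<^sup>2 / (32 * r\<^sup>2) = \<kappa> - M" unfolding \<kappa>_def by simp
  finally have "B * s x t \<le> (\<kappa> - M) * (s x t)\<^sup>2 + 8 * r\<^sup>2" by linarith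
  then have "2 * c * s x t + 4 * n * s x t + 8 * s x t \<le> \<kappa> * (s x t)\<^sup>2 - M * (s x t)\<^sup>2 + 8 * r\<^sup>2"
    unfolding B_def by (simp add: algebra_simps)
  then show False using 1 2 by argo
qed

section \<open>Positivity of global solutions\<close>

lemma locally_holder_imp_continuous:
  fixes f :: "'a::euclidean_space \<Rightarrow> real"
  assumes "locally_holder_on \<beta> S f" "\<beta> > 0" "open S"
  shows "continuous_on S f"
proof (rule continuous_at_imp_continuous_on, rule ballI)
  fix x assume "x \<in> S"
  then obtain e where e: "e > 0" "cball x e \<subseteq> S" using assms(3) open_contains_cball by blast
  then obtain C where C: "\<And>y z. y \<in> cball x e \<Longrightarrow> z \<in> cball x e \<Longrightarrow> \<bar>f y - f z\<bar> \<le> C * dist y z powr \<beta>"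
    using assms(1) unfolding locally_holder_on_def by (meson compact_cball)
  have "((\<lambda>y. dist y x) \<longlongrightarrow> 0) (at x)" using tendsto_dist[OF tendsto_ident_at tendsto_const, of x x UNIV] by simp
  then have "((\<lambda>y. C * dist y x powr \<beta>) \<longlongrightarrow> C * 0 powr \<beta>) (at x)"
    using assms(2) by (intro tendsto_intros tendsto_powr') auto
  then have "((\<lambda>y. C * dist y x powr \<beta>) \<longlongrightarrow> 0) (at x)" using assms(2) by simp
  moreover have "eventually (\<lambda>y. y \<in> ball x e) (at x)"
    using e(1) by (intro eventually_at_in_open') auto
  then have "eventually (\<lambda>y. norm (f y - f x) \<le> C * dist y x powr \<beta>) (at x)"
    by eventually_elim (use C e in auto)
  ultimately have "((\<lambda>y. f y - f x) \<longlongrightarrow> 0) (at x)" by (rule Lim_null_comparison[rotated])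
  then show "isCont f x" unfolding isCont_def by (simp add: LIM_zero_iff)
qed

lemma global_solutionD:
  fixes u :: "'a::euclidean_space \<Rightarrow> real \<Rightarrow> real"
  assumes "global_solution V a p \<phi> u"
  shows "\<And>x t. 0 \<le> t \<Longrightarrow> 0 \<le> u x t" and "\<And>x. u x 0 = \<phi> x"
    and "continuous_on ((- {0}) \<times> {0..}) (\<lambda>(x, t). u x t)"
    and "\<And>x t. x \<noteq> 0 \<Longrightarrow> t > 0 \<Longrightarrow> (u x has_real_derivative deriv (u x) t) (at t)"
    and "\<And>t. t > 0 \<Longrightarrow> Ck_on 2 (- {0}) (\<lambda>x. u x t)"
    and "continuous_on ((- {0}) \<times> {0<..}) (\<lambda>(x, t). deriv (u x) t)"
    and "\<And>x t. x \<noteq> 0 \<Longrightarrow> t > 0 \<Longrightarrow>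
      deriv (u x) t = laplacian (\<lambda>y. u y t) x - V x * u x t + a x * u x t powr p"
proof -
  have I: "{t::real. 0 < t \<and> ereal t < \<infinity>} = {0<..}" "{t::real. 0 \<le> t \<and> ereal t < \<infinity>} = {0..}" by auto
  note s = assms[unfolded global_solution_def solution_def Let_def I]
  show "\<And>x t. 0 \<le> t \<Longrightarrow> 0 \<le> u x t" "\<And>x. u x 0 = \<phi> x"
    "continuous_on ((- {0}) \<times> {0..}) (\<lambda>(x, t). u x t)"
    "\<And>t. t > 0 \<Longrightarrow> Ck_on 2 (- {0}) (\<lambda>x. u x t)"
    "continuous_on ((- {0}) \<times> {0<..}) (\<lambda>(x, t). deriv (u x) t)"
    "\<And>x t. x \<noteq> 0 \<Longrightarrow> t > 0 \<Longrightarrow>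
      deriv (u x) t = laplacian (\<lambda>y. u y t) x - V x * u x t + a x * u x t powr p"
    using s by auto
  show "\<And>x t. x \<noteq> 0 \<Longrightarrow> t > 0 \<Longrightarrow> (u x has_real_derivative deriv (u x) t) (at t)"
    unfolding DERIV_deriv_iff_real_differentiable using s by auto
qed

text \<open>The ball about \<open>x0\<close> of radius \<open>norm x0\<close> is the largest that
  misses the origin. On a smaller closed ball \<open>V\<close> is bounded, and since the nonlinear
  term is nonnegative, \<open>u\<close> is a supersolution as \<open>positivity_spreads\<close>
  requires.\<close>

lemma global_solution_positive_near:
  fixes u :: "'a::euclidean_space \<Rightarrow> real \<Rightarrow> real"
  assumes sol: "global_solution V a p \<phi> u" and V: "continuous_on (- {0}) V" and a: "\<forall>x. a x \<ge> 0"
    and pos: "u x0 t0 > 0" "0 \<le> t0" "t0 < t1" and y: "y \<in> ball x0 (norm x0)"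
  shows "u y t1 > 0"
proof -
  note s = global_solutionD[OF sol]
  \<comment> \<open>Strictly between the distance to \<open>y\<close> and the norm of
    \<open>x0\<close>: the ball contains \<open>y\<close>, and its closure misses the
    origin.\<close>
  define R where "R = (dist x0 y + norm x0) / 2"
  have R: "dist x0 y < R" "R < norm x0" using y unfolding R_def by auto
  then have R0: "R > 0" using zero_le_dist[of x0 y] by linarith
  have nz: "cball x0 R \<subseteq> - {0}" using R by auto
  have "bounded (V ` cball x0 R)"
    by (intro compact_imp_bounded compact_continuous_image continuous_on_subset[OF V] nz compact_cball)
  then obtain M where M: "M > 0" "\<And>x. x \<in> cball x0 R \<Longrightarrow> \<bar>V x\<bar> \<le> M"
    unfolding bounded_pos by (metis imageI real_norm_def)
  show ?thesis
  proof (rule positivity_spreads[OF M(1) R0 pos(3), where u=u and ut="\<lambda>x. deriv (u x)" and ?x0.0=x0])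
    show "continuous_on (cball x0 R \<times> {t0..t1}) (\<lambda>(x, t). u x t)"
      by (rule continuous_on_subset[OF s(3)]) (use nz pos in auto)
    show "0 \<le> u x t" if "x \<in> cball x0 R" "t \<in> {t0..t1}" for x t
      using s(1) that pos by auto
    fix t assume t: "t \<in> {t0<..t1}"
    then have t0: "t > 0" using pos by auto
    show "Ck_on 2 (ball x0 R) (\<lambda>x. u x t)"
      by (rule Ck_on_subset[OF s(5)[OF t0]]) (use nz in auto)
    fix x assume x: "x \<in> ball x0 R"
    then have x0: "x \<noteq> 0" using nz by auto
    show "(u x has_real_derivative deriv (u x) t) (at t)" by (rule s(4)[OF x0 t0])
    have "V x * u x t \<le> M * u x t"
      using M(2)[of x] x s(1)[of t x] t0 by (intro mult_right_mono) auto
    moreover have "0 \<le> a x * u x t powr p" using a by simp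
    ultimately show "laplacian (\<lambda>x. u x t) x - M * u x t \<le> deriv (u x) t"
      unfolding s(7)[OF x0 t0] by linarith
  qed (use pos R in auto)
qed

text \<open>The set of points at which \<open>u\<close> is positive for all positive times is open
  and relatively closed in the punctured space, which is connected in dimension at least
  two.\<close>

lemma global_solution_positive:
  fixes u :: "'a::euclidean_space \<Rightarrow> real \<Rightarrow> real"
  assumes dim: "DIM('a) \<ge> 2"
    and sol: "global_solution V a p \<phi> u" and V: "continuous_on (- {0}) V" and a: "\<forall>x. a x \<ge> 0"
    and \<phi>: "continuous_on UNIV \<phi>" "\<forall>x. \<phi> x \<ge> 0" "\<exists>x. \<phi> x \<noteq> 0"
    and x: "x \<noteq> 0" "t > 0"
  shows "u x t > 0"
proof -
  note s = global_solutionD[OF sol]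
  note near = global_solution_positive_near[OF sol V a]
  define A where "A = {x. x \<noteq> 0 \<and> (\<forall>t>0. u x t > 0)}"
  \<comment> \<open>Positivity at \<open>x\<close> at time t/2 spreads to \<open>y\<close> by time
    t.\<close>
  have step: "y \<in> A" if "x \<in> A" "y \<in> ball x (norm x)" for x y
  proof -
    have "u y t > 0" if "t > 0" for t
      by (rule near[of x "t/2"]) (use \<open>x \<in> A\<close> \<open>y \<in> ball x (norm x)\<close> that in \<open>auto simp: A_def\<close>)
    moreover have "y \<noteq> 0" using that by auto
    ultimately show ?thesis unfolding A_def by simp
  qed
  have A0: "A \<subseteq> - {0}" unfolding A_def by auto
  have oA: "open A"
  proof (rule openI)
    fix x assume "x \<in> A"
    then show "\<exists>e>0. ball x e \<subseteq> A" using step A0 by (intro exI[of _ "norm x"]) auto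
  qed
  have oB: "open (- {0} - A)"
  proof (rule openI)
    fix y assume y: "y \<in> - {0} - A"
    \<comment> \<open>The radius is such that \<open>y\<close> is closer to \<open>z\<close> than
      \<open>z\<close> is to the origin, so positivity at \<open>z\<close> would pass to
      \<open>y\<close>.\<close>
    have "z \<notin> A" if z: "z \<in> ball y (norm y / 2)" for z
    proof
      assume "z \<in> A"
      have "norm y \<le> norm z + dist z y" by norm
      then have "dist z y < norm z" using z by (simp add: dist_commute)
      then have "y \<in> A" using step[OF \<open>z \<in> A\<close>, of y] by simp
      then show False using y by simp
    qed
    then have "ball y (norm y / 2) \<subseteq> - {0} - A" by auto
    then show "\<exists>e>0. ball y e \<subseteq> - {0} - A" using y by (intro exI[of _ "norm y / 2"]) auto
  qed
  obtain x1 where x1: "x1 \<noteq> 0" "\<phi> x1 > 0"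
  proof -
    obtain x2 where x2: "\<phi> x2 > 0" using \<phi> by (metis less_eq_real_def)
    have "open {x. 0 < \<phi> x}" by (intro open_Collect_less \<phi> continuous_intros)
    then obtain e where e: "e > 0" "ball x2 e \<subseteq> {x. 0 < \<phi> x}" using x2 open_contains_ball by (metis mem_Collect_eq)
    show ?thesis
    proof (cases "x2 = 0")
      case False then show ?thesis using that x2 by blast
    next
      case True
      obtain b :: 'a where b: "b \<in> Basis" using nonempty_Basis by blast
      have "(e/2) *\<^sub>R b \<in> ball x2 e" using True b e(1) by simp
      then show ?thesis using that[of "(e/2) *\<^sub>R b"] e b nonzero_Basis[OF b] by (auto simp: subset_iff)
    qed
  qed
  have "x1 \<in> A" unfolding A_def
    using near[of x1 0 _ x1] x1 s(2)[of x1] by auto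
  moreover have "connected (- {0::'a})" using connected_punctured_universe[OF dim] .
  ultimately have "- {0} - A = {}"
    using connectedD[OF _ oA oB, of "- {0}"] x1 A0 by auto
  then show ?thesis using x unfolding A_def by auto
qed

section \<open>Blow-up\<close>

lemma integral_square_pos:
  fixes \<eta> :: "'a::euclidean_space \<Rightarrow> real"
  assumes "continuous_on UNIV \<eta>" "compact K" "\<And>x. x \<notin> K \<Longrightarrow> \<eta> x = 0" "\<eta> x0 \<noteq> 0"
  shows "(LINT x|lborel. (\<eta> x)\<^sup>2) > 0"
proof -
  have "bounded (insert x0 K)" using assms(2) by (simp add: compact_imp_bounded)
  then obtain c where c: "insert x0 K \<subseteq> box (- c) c" using bounded_subset_box_symmetric by blast
  have cs: "continuous_on UNIV (\<lambda>x. (\<eta> x)\<^sup>2)" by (intro continuous_intros assms)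
  have e: "integral (cbox (- c) c) (\<lambda>x. (\<eta> x)\<^sup>2) = (LINT x|lborel. (\<eta> x)\<^sup>2)"
    by (rule compact_support_integral_cbox[OF cs]) (use assms(3) c box_subset_cbox in force)
  have "(LINT x|lborel. (\<eta> x)\<^sup>2) \<noteq> 0"
  proof
    assume "(LINT x|lborel. (\<eta> x)\<^sup>2) = 0"
    then have "\<forall>x\<in>cbox (- c) c. (\<eta> x)\<^sup>2 = 0"
      using e c by (subst integral_cbox_eq_0_iff[symmetric]) (auto intro: continuous_on_subset[OF cs])
    then show False using c box_subset_cbox assms(4) by fastforce
  qed
  moreover have "(LINT x|lborel. (\<eta> x)\<^sup>2) \<ge> 0" by (rule integral_nonneg_AE) simp
  ultimately show ?thesis by linarith
qed

text \<open>Differentiating \<open>\<integral> \<eta>\<^sup>2 ln u\<close> in time and bounding \<open>- \<eta>\<^sup>2 \<Delta>u / u\<close> by Hardy's inequality with the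
  field \<open>- \<nabla>u / u\<close> gives \<open>G' \<ge> - q(\<eta>) + \<alpha> \<integral> \<eta>\<^sup>2 u^(p-1)\<close>; by Jensen, \<open>G\<close> blows up when \<open>q(\<eta>) < 0\<close>.\<close>

lemma quadratic_form_nonneg:
  fixes u :: "'a::euclidean_space \<Rightarrow> real \<Rightarrow> real"
  assumes sol: "global_solution V a p \<phi> u" and p: "p > 1"
    and pos: "\<And>x t. x \<noteq> 0 \<Longrightarrow> t > 0 \<Longrightarrow> u x t > 0"
    and V: "continuous_on (- {0}) V" and a: "\<alpha> > 0" "\<And>x. x \<in> D \<Longrightarrow> \<alpha> \<le> a x"
    and \<eta>: "Ck_on 1 UNIV \<eta>" and K: "compact K" "K \<subseteq> D - {0}" "\<And>x. x \<notin> K \<Longrightarrow> \<eta> x = 0"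
  shows "0 \<le> (LINT x|lborel. (\<Sum>b\<in>Basis. (partial b \<eta> x)\<^sup>2)) + (LINT x|lborel. V x * (\<eta> x)\<^sup>2)"
proof (rule ccontr)
  note s = global_solutionD[OF sol]
  define Q1 where "Q1 = (LINT x|lborel. (\<Sum>b\<in>Basis. (partial b \<eta> x)\<^sup>2))"
  define Q2 where "Q2 = (LINT x|lborel. V x * (\<eta> x)\<^sup>2)"
  assume "\<not> ?thesis"
  then have q: "Q1 + Q2 < 0" unfolding Q1_def Q2_def by simp
  have clK: "closed K" by (rule compact_imp_closed[OF K(1)])
  have K0: "K \<subseteq> - {0}" using K by auto
  have o0: "open (- {0::'a})" by auto
  have c\<eta>: "continuous_on UNIV \<eta>" using Ck_on_SucD[of 0 UNIV \<eta>] \<eta> by simp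
  have glue: "continuous_on UNIV (\<lambda>x. (\<eta> x)\<^sup>2 * F x)" if "continuous_on (- {0}) F" for F
    by (rule continuous_on_glue[OF clK _ o0 K0])
      (use K(3) in \<open>auto intro!: continuous_intros that continuous_on_subset[OF c\<eta>]\<close>)
  have int: "integrable lborel (\<lambda>x. (\<eta> x)\<^sup>2 * F x)" if "continuous_on (- {0}) F" for F
    by (rule compact_support_integrable[OF glue[OF that] K(1)]) (simp add: K)
  \<comment> \<open>A vanishing \<eta> would make the form zero. Nontriviality gives
    \<open>m > 0\<close>, by which is divided below.\<close>
  obtain x0 where x0: "\<eta> x0 \<noteq> 0"
  proof (rule ccontr)
    assume "\<not> thesis"
    then have z: "\<eta> x = 0" for x using that by blast
    have "partial b \<eta> x = 0" for b x by (rule partial_zero_outside[of "{}"]) (use z in auto)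
    then have "Q1 = 0" "Q2 = 0" unfolding Q1_def Q2_def using z by auto
    then show False using q by simp
  qed
  define m where "m = (LINT x|lborel. (\<eta> x)\<^sup>2)"
  have m: "m > 0" unfolding m_def by (rule integral_square_pos[OF c\<eta> K(1) K(3) x0])
  define G where "G t = (LINT x|lborel. (\<eta> x)\<^sup>2 * ln (u x t))" for t
  define G' where "G' t = (LINT x|lborel. (\<eta> x)\<^sup>2 * (deriv (u x) t / u x t))" for t
  have cu: "continuous_on ({0<..} \<times> (- {0})) (\<lambda>(t, x). u x t)"
  proof -
    have "continuous_on ({0<..} \<times> (- {0})) (\<lambda>z. (case (snd z, fst z) of (x, t) \<Rightarrow> u x t))"
      by (rule continuous_on_compose2[OF s(3)]) (auto intro!: continuous_intros)
    then show ?thesis by (simp add: case_prod_beta)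
  qed
  have cdu: "continuous_on ({0<..} \<times> (- {0})) (\<lambda>(t, x). deriv (u x) t)"
  proof -
    have "continuous_on ({0<..} \<times> (- {0})) (\<lambda>z. (case (snd z, fst z) of (x, t) \<Rightarrow> deriv (u x) t))"
      by (rule continuous_on_compose2[OF s(6)]) (auto intro!: continuous_intros)
    then show ?thesis by (simp add: case_prod_beta)
  qed
  have slice: "continuous_on (- {0}) (\<lambda>x. f t x)"
    if "continuous_on ({0<..} \<times> (- {0})) (\<lambda>(t, x). f t x)" "t > 0" for f :: "real \<Rightarrow> 'a \<Rightarrow> real" and t
  proof -
    have "continuous_on (- {0}) (\<lambda>x. (case (t, x) of (t, x) \<Rightarrow> f t x))"
      by (rule continuous_on_compose2[OF that(1)]) (use that(2) in \<open>auto intro!: continuous_intros\<close>)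
    then show ?thesis by simp
  qed
  have cu1: "continuous_on (- {0}) (\<lambda>x. u x t)" if "t > 0" for t by (rule slice[OF cu that])
  have cdu1: "continuous_on (- {0}) (\<lambda>x. deriv (u x) t)" if "t > 0" for t by (rule slice[OF cdu that])
  have cln: "continuous_on (- {0}) (\<lambda>x. ln (u x t))" if "t > 0" for t
    using pos[OF _ that] by (intro continuous_on_ln cu1[OF that]) force
  have cq: "continuous_on (- {0}) (\<lambda>x. deriv (u x) t / u x t)" if "t > 0" for t
    using pos[OF _ that] by (intro continuous_on_divide cu1[OF that] cdu1[OF that]) force
  have dG: "(G has_real_derivative G' t) (at t)" if t: "t > 0" for t
  proof -
    have "((\<lambda>t. LINT x|lborel. (\<eta> x)\<^sup>2 * ln (u x t)) has_field_derivative
        (LINT x|lborel. (\<eta> x)\<^sup>2 * (deriv (u x) t / u x t))) (at t within {0<..})"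
    proof (rule compact_support_leibniz[OF K(1)])
      show "continuous_on UNIV (\<lambda>x. (\<eta> x)\<^sup>2 * ln (u x t))" if "t \<in> {0<..}" for t
        by (rule glue[OF cln]) (use that in simp)
      have "continuous_on ({0<..} \<times> (- {0}) \<union> {0<..} \<times> (- K)) (\<lambda>(t, x). (\<eta> x)\<^sup>2 * (deriv (u x) t / u x t))"
      proof (rule continuous_on_open_Un)
        have "continuous_on ({0<..} \<times> (- {0})) (\<lambda>z. \<eta> (snd z))"
          by (rule continuous_on_compose2[OF c\<eta>]) (auto intro!: continuous_intros)
        then show "continuous_on ({0<..} \<times> (- {0})) (\<lambda>(t, x). (\<eta> x)\<^sup>2 * (deriv (u x) t / u x t))"
          using cu cdu pos unfolding case_prod_beta by (intro continuous_intros) force+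
        show "continuous_on ({0<..} \<times> (- K)) (\<lambda>(t, x). (\<eta> x)\<^sup>2 * (deriv (u x) t / u x t))"
          by (rule continuous_on_eq[OF continuous_on_const[of _ 0]]) (use K(3) in auto)
      qed (auto intro!: open_Times clK)
      also have "{0<..} \<times> (- {0}) \<union> {0<..} \<times> (- K) = {0<..} \<times> UNIV" using K0 by auto
      finally show "continuous_on ({0<..} \<times> UNIV) (\<lambda>(t, x). (\<eta> x)\<^sup>2 * (deriv (u x) t / u x t))" .
      show "((\<lambda>t. (\<eta> x)\<^sup>2 * ln (u x t)) has_real_derivative (\<eta> x)\<^sup>2 * (deriv (u x) t / u x t)) (at t within {0<..})"
        if t: "t \<in> {0<..}" for t x
      proof (cases "x \<in> K")
        case True
        then have x: "x \<noteq> 0" using K0 by auto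
        have "((\<lambda>t. ln (u x t)) has_real_derivative (1 / u x t) * deriv (u x) t) (at t)"
          by (rule DERIV_chain2[OF DERIV_ln_divide[OF pos[OF x]] s(4)[OF x]]) (use t in auto)
        from DERIV_cmult[OF this] show ?thesis by (auto intro: has_field_derivative_at_within)
      qed (use K(3) in simp)
    qed (use K(3) t in auto)
    then show ?thesis unfolding G_def G'_def using t by (simp add: at_within_open[of t "{0<..}"])
  qed
  define k where "k = (p - 1) / m"
  have k: "k > 0" unfolding k_def using p m by simp
  \<comment> \<open>The contribution of the form has the favourable sign and is dropped; the
    exponential alone forces blow-up from any value of \<open>G\<close>.\<close>
  have G'_ge: "\<alpha> * m * exp (k * G t) \<le> G' t" if t: "t > 0" for t
  proof -
    have C2: "Ck_on (Suc (Suc 0)) (- {0}) (\<lambda>x. u x t)" using s(5)[OF t] by (simp add: numeral_2_eq_2)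
    let ?ut = "\<lambda>x. u x t"
    \<comment> \<open>The field -grad u / u: in div X - |X|^2 the squares of the gradient cancel,
      and -\<Delta>u / u remains.\<close>
    define X where "X b x = - 1 * (partial b ?ut x / u x t)" for b x
    have X1: "Ck_on 1 (- {0}) (X b)" if "b \<in> Basis" for b
    proof -
      have 1: "Ck_on 1 (- {0}) ?ut" using Ck_on_SucD[OF C2] by simp
      have 2: "Ck_on 1 (- {0}) (partial b ?ut)" using C2 that by simp
      show ?thesis unfolding X_def
        by (intro Ck_on_cmult Ck_on_divide 1 2 o0) (use pos[OF _ t] in force)
    qed
    have dX: "partial b (X b) x - (X b x)\<^sup>2 = - (partial b (partial b ?ut) x / u x t)"
      if b: "b \<in> Basis" and x: "x \<noteq> 0" for b x
    proof -
      have d1: "?ut differentiable at x" "partial b ?ut differentiable at x" using C2 b x by auto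
      have u0: "u x t > 0" by (rule pos[OF x t])
      have "((\<lambda>x. partial b ?ut x / u x t) has_derivative
          (\<lambda>h. - partial b ?ut x * (inverse (u x t) * frechet_derivative ?ut (at x) h * inverse (u x t)) +
            frechet_derivative (partial b ?ut) (at x) h / u x t)) (at x)"
        by (rule has_derivative_divide[OF partial_works[OF d1(2)] partial_works[OF d1(1)]]) (use u0 in simp)
      from has_derivative_mult_right[OF this, of "-1"]
      have e: "partial b (X b) x = - 1 * (- partial b ?ut x * (inverse (u x t) * partial b ?ut x * inverse (u x t)) +
            partial b (partial b ?ut) x / u x t)"
        unfolding X_def partial_def[of b ?ut] partial_def[of b "partial b ?ut"] by (rule partial_eqI)
      show ?thesis unfolding e unfolding X_def using u0 by (simp add: field_simps power2_eq_square)
    qed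
    have sX: "(\<eta> x)\<^sup>2 * (\<Sum>b\<in>Basis. partial b (X b) x - (X b x)\<^sup>2) = (\<eta> x)\<^sup>2 * - (laplacian ?ut x / u x t)" for x
    proof (cases "x \<in> K")
      case True
      then have "x \<noteq> 0" using K0 by auto
      then have "(\<Sum>b\<in>Basis. partial b (X b) x - (X b x)\<^sup>2) = - (laplacian ?ut x / u x t)"
        unfolding laplacian_def sum_divide_distrib sum_negf[symmetric] by (intro sum.cong refl dX) auto
      then show ?thesis by simp
    qed (simp add: K)
    have hardy: "(LINT x|lborel. (\<eta> x)\<^sup>2 * - (laplacian ?ut x / u x t)) \<le> Q1"
      unfolding sX[symmetric] Q1_def by (rule hardy_vector_field[OF \<eta> K(1) K(3) o0 K0 X1])
    have clap: "continuous_on (- {0}) (\<lambda>x. - (laplacian ?ut x / u x t))"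
    proof -
      have "continuous_on (- {0}) (\<lambda>x. laplacian ?ut x)"
        unfolding laplacian_def by (intro continuous_on_sum) (use C2 in simp)
      then show ?thesis using pos[OF _ t] by (intro continuous_intros cu1[OF t]) force+
    qed
    \<comment> \<open>The mean of \<open>ln u\<close> for the weight \<eta>^2 / m. Jensen's
      inequality is carried out with the tangent line of the exponential at this mean, whose linear
      term integrates to zero.\<close>
    define c where "c = G t / m"
    define E where "E = exp ((p - 1) * c)"
    let ?R = "\<lambda>x. - (- (laplacian ?ut x / u x t)) - V x + \<alpha> * E * (1 + (p - 1) * (ln (u x t) - c))"
    have cR: "continuous_on (- {0}) (\<lambda>x. ?R x)"
      by (intro continuous_intros clap V cln[OF t])
    have "(LINT x|lborel. (\<eta> x)\<^sup>2 * ?R x) \<le> G' t"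
      unfolding G'_def
    proof (rule integral_mono[OF int[OF cR] int[OF cq[OF t]]])
      fix x
      show "(\<eta> x)\<^sup>2 * ?R x \<le> (\<eta> x)\<^sup>2 * (deriv (u x) t / u x t)"
      proof (cases "x \<in> K")
        case True
        then have x: "x \<noteq> 0" "x \<in> D" using K by auto
        have u0: "u x t > 0" by (rule pos[OF x(1) t])
        have "u x t powr p = exp ((p - 1) * ln (u x t)) * u x t"
          using u0 by (simp add: powr_def exp_diff algebra_simps)
        then have d: "deriv (u x) t / u x t = laplacian ?ut x / u x t - V x + a x * exp ((p - 1) * ln (u x t))"
          unfolding s(7)[OF x(1) t] using u0 by (simp add: add_divide_distrib diff_divide_distrib)
        have "E * (1 + (p - 1) * (ln (u x t) - c)) \<le> E * exp ((p - 1) * (ln (u x t) - c))"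
          unfolding E_def by (intro mult_left_mono exp_ge_add_one_self) auto
        also have "\<dots> = exp ((p - 1) * ln (u x t))"
          unfolding E_def by (simp add: exp_add[symmetric] algebra_simps)
        finally have "\<alpha> * (E * (1 + (p - 1) * (ln (u x t) - c))) \<le> a x * exp ((p - 1) * ln (u x t))"
          using a(2)[OF x(2)] a(1) by (meson exp_ge_zero mult_left_mono mult_right_mono less_imp_le order.trans)
        then have "?R x \<le> deriv (u x) t / u x t" unfolding d by (simp add: mult.assoc)
        then show ?thesis by (intro mult_left_mono) auto
      qed (simp add: K)
    qed
    moreover have "(LINT x|lborel. (\<eta> x)\<^sup>2 * ?R x) =
        - (LINT x|lborel. (\<eta> x)\<^sup>2 * - (laplacian ?ut x / u x t)) - Q2 + \<alpha> * E * m"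
    proof -
      have iln: "integrable lborel (\<lambda>x. (\<eta> x)\<^sup>2 * ln (u x t))" by (rule int[OF cln[OF t]])
      have i2: "integrable lborel (\<lambda>x. (\<eta> x)\<^sup>2)" using int[of "\<lambda>x. 1"] by simp
      have iV: "integrable lborel (\<lambda>x. V x * (\<eta> x)\<^sup>2)" using int[OF V] by (simp add: mult.commute)
      have e: "(\<lambda>x. (\<eta> x)\<^sup>2 * ?R x) = (\<lambda>x. - ((\<eta> x)\<^sup>2 * - (laplacian ?ut x / u x t)) - V x * (\<eta> x)\<^sup>2
          + (\<alpha> * E * (1 - (p - 1) * c) * (\<eta> x)\<^sup>2 + \<alpha> * E * (p - 1) * ((\<eta> x)\<^sup>2 * ln (u x t))))"
        by (rule ext) (simp add: algebra_simps)
      have "(LINT x|lborel. (\<eta> x)\<^sup>2 * ?R x) = - (LINT x|lborel. (\<eta> x)\<^sup>2 * - (laplacian ?ut x / u x t)) - Q2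
          + (\<alpha> * E * (1 - (p - 1) * c) * m + \<alpha> * E * (p - 1) * G t)"
        unfolding e using iln i2 iV int[OF clap] unfolding Q2_def m_def G_def by simp
      also have "G t = c * m" unfolding c_def using m by simp
      finally show ?thesis by (simp add: algebra_simps)
    qed
    moreover have "E = exp (k * G t)" unfolding E_def c_def k_def by simp
    ultimately show ?thesis using hardy q by (simp add: mult_ac)
  qed
  \<comment> \<open>By \<open>G'_ge\<close> and \<open>k * m = p - 1\<close>, the function exp (-k
    G) decreases at least at the rate (p - 1) \<alpha>; hence \<open>W\<close> is
    nonincreasing.\<close>
  define W where "W t = exp (- k * G t) + (p - 1) * \<alpha> * t" for t
  have dW: "(W has_real_derivative - k * G' t * exp (- k * G t) + (p - 1) * \<alpha>) (at t)" if "t > 0" for t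
    unfolding W_def by (auto intro!: derivative_eq_intros dG that)
  have dW0: "- k * G' t * exp (- k * G t) + (p - 1) * \<alpha> \<le> 0" if "t > 0" for t
  proof -
    have "k * (\<alpha> * m * exp (k * G t)) * exp (- k * G t) \<le> k * G' t * exp (- k * G t)"
      using k G'_ge[OF that] by (intro mult_right_mono mult_left_mono) auto
    moreover have "k * (\<alpha> * m * exp (k * G t)) * exp (- k * G t) = (p - 1) * \<alpha>"
      using m unfolding k_def by (simp add: exp_minus)
    moreover have "- k * G' t * exp (- k * G t) = - (k * G' t * exp (- k * G t))" by simp
    ultimately show ?thesis by linarith
  qed
  \<comment> \<open>By this time the linear part of \<open>W\<close> alone exceeds
    \<open>W 1\<close>. The comparison starts at time 1 because the derivative of \<open>G\<close>
    is known for positive times only.\<close>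
  define T where "T = 1 + W 1 / ((p - 1) * \<alpha>)"
  have W1: "W 1 > 0" unfolding W_def using p a(1) by (simp add: add_pos_pos)
  have T: "T \<ge> 1" unfolding T_def using W1 p a(1) by simp
  have "W T \<le> W 1"
    by (rule DERIV_nonpos_imp_nonincreasing[OF T]) (meson dW dW0 less_le_trans zero_less_one)
  moreover have "W T > (p - 1) * \<alpha> * T" unfolding W_def by simp
  moreover have "(p - 1) * \<alpha> * T = (p - 1) * \<alpha> + W 1" unfolding T_def using p a(1) by (simp add: field_simps)
  moreover have "(p - 1) * \<alpha> > 0" using p a(1) by simp
  ultimately show False by linarith
qed

section \<open>Localization of the quadratic form\<close>

definition L2_lim :: "'x measure \<Rightarrow> (nat \<Rightarrow> 'x \<Rightarrow> real) \<Rightarrow> ('x \<Rightarrow> real) \<Rightarrow> bool" where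
  "L2_lim M X A \<longleftrightarrow> (\<forall>k. sqint M (X k)) \<and> sqint M A \<and> (\<lambda>k. nrm M (\<lambda>x. X k x - A x)) \<longlonglongrightarrow> 0"

lemma L2_lim_const: "sqint M A \<Longrightarrow> L2_lim M (\<lambda>_. A) A"
  unfolding L2_lim_def by (simp add: nrm_def)

lemma L2_lim_add:
  assumes "L2_lim M X A" "L2_lim M Y B"
  shows "L2_lim M (\<lambda>k x. X k x + Y k x) (\<lambda>x. A x + B x)"
proof -
  have s: "sqint M (X k)" "sqint M (Y k)" "sqint M A" "sqint M B" for k
    using assms unfolding L2_lim_def by auto
  have "(\<lambda>k. nrm M (\<lambda>x. (X k x + Y k x) - (A x + B x))) \<longlonglongrightarrow> 0"
  proof (rule Lim_null_comparison[OF always_eventually])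
    show "(\<lambda>k. nrm M (\<lambda>x. X k x - A x) + nrm M (\<lambda>x. Y k x - B x)) \<longlonglongrightarrow> 0"
      using assms unfolding L2_lim_def by (auto intro: tendsto_add_zero)
    have "(\<lambda>x. (X k x + Y k x) - (A x + B x)) = (\<lambda>x. (X k x - A x) + (Y k x - B x))" for k by auto
    then show "\<forall>k. norm (nrm M (\<lambda>x. (X k x + Y k x) - (A x + B x))) \<le> nrm M (\<lambda>x. X k x - A x) + nrm M (\<lambda>x. Y k x - B x)"
      using nrm_triangle[OF sqint_diff[OF s(1,3)] sqint_diff[OF s(2,4)]] by simp
  qed
  then show ?thesis unfolding L2_lim_def using s by (simp add: sqint_add)
qed

lemma nrm_mult_bounded_le:
  fixes f w :: "'x \<Rightarrow> real"
  assumes "sqint M f" "w \<in> borel_measurable M" "\<And>x. \<bar>w x\<bar> \<le> C"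
  shows "nrm M (\<lambda>x. w x * f x) \<le> C * nrm M f"
proof -
  have C: "C \<ge> 0" using assms(3)[of undefined] by linarith
  have "(nrm M (\<lambda>x. w x * f x))\<^sup>2 \<le> (LINT x|M. C\<^sup>2 * (norm (f x))\<^sup>2)"
    unfolding nrm_sq
  proof (rule integral_mono)
    show "integrable M (\<lambda>x. (norm (w x * f x))\<^sup>2)"
      using sqint_mult_bounded[of M f w C] assms unfolding sqint_def by simp
    show "(norm (w x * f x))\<^sup>2 \<le> C\<^sup>2 * (norm (f x))\<^sup>2" for x
      using assms(3)[of x] by (simp add: power_mult_distrib mult_right_mono abs_le_square_iff[symmetric] abs_le_iff)
  qed (use assms in \<open>auto simp: sqint_def\<close>)
  also have "\<dots> = (C * nrm M f)\<^sup>2" by (simp add: nrm_sq power_mult_distrib)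
  finally show ?thesis by (rule power2_le_imp_le) (use C in simp)
qed

lemma L2_lim_mult:
  fixes w :: "'x \<Rightarrow> real"
  assumes "L2_lim M X A" "w \<in> borel_measurable M" "\<And>x. \<bar>w x\<bar> \<le> C"
  shows "L2_lim M (\<lambda>k x. w x * X k x) (\<lambda>x. w x * A x)"
proof -
  have s: "sqint M (X k)" "sqint M A" for k using assms unfolding L2_lim_def by auto
  have "(\<lambda>k. nrm M (\<lambda>x. w x * X k x - w x * A x)) \<longlonglongrightarrow> 0"
  proof (rule Lim_null_comparison[OF always_eventually])
    show "(\<lambda>k. C * nrm M (\<lambda>x. X k x - A x)) \<longlonglongrightarrow> 0"
      using assms(1) unfolding L2_lim_def by (auto intro: tendsto_mult_right_zero)
    show "\<forall>k. norm (nrm M (\<lambda>x. w x * X k x - w x * A x)) \<le> C * nrm M (\<lambda>x. X k x - A x)"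
      using nrm_mult_bounded_le[OF sqint_diff[OF s] assms(2,3)] by (simp add: right_diff_distrib)
  qed
  moreover have "sqint M (\<lambda>x. w x * X k x)" "sqint M (\<lambda>x. w x * A x)" for k
    using sqint_mult_bounded[OF s(1) assms(2), of C] sqint_mult_bounded[OF s(2) assms(2), of C] assms(3) by auto
  ultimately show ?thesis unfolding L2_lim_def by blast
qed

lemma L2_lim_inner:
  assumes X: "L2_lim M X A" and Y: "L2_lim M Y B"
  shows "(\<lambda>k. LINT x|M. X k x * Y k x) \<longlonglongrightarrow> (LINT x|M. A x * B x)"
proof -
  have s: "sqint M (X k)" "sqint M (Y k)" "sqint M A" "sqint M B" for k
    using assms unfolding L2_lim_def by auto
  let ?dX = "\<lambda>k. nrm M (\<lambda>x. X k x - A x)" and ?dY = "\<lambda>k. nrm M (\<lambda>x. Y k x - B x)"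
  have "(\<lambda>k. (LINT x|M. X k x * Y k x) - (LINT x|M. A x * B x)) \<longlonglongrightarrow> 0"
  proof (rule Lim_null_comparison[OF always_eventually])
    have "(\<lambda>k. ?dX k * (?dY k + nrm M B) + nrm M A * ?dY k) \<longlonglongrightarrow> 0 * (0 + nrm M B) + nrm M A * 0"
      using X Y unfolding L2_lim_def by (intro tendsto_intros) auto
    then show "(\<lambda>k. ?dX k * (?dY k + nrm M B) + nrm M A * ?dY k) \<longlonglongrightarrow> 0" by simp
    show "\<forall>k. norm ((LINT x|M. X k x * Y k x) - (LINT x|M. A x * B x)) \<le> ?dX k * (?dY k + nrm M B) + nrm M A * ?dY k"
    proof
      fix k
      note i = sqint_mult_integrable
      have e: "(LINT x|M. X k x * Y k x) - (LINT x|M. A x * B x) =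
          (LINT x|M. (X k x - A x) * Y k x) + (LINT x|M. A x * (Y k x - B x))"
        using i[OF s(1)[of k] s(2)[of k]] i[OF s(3) s(2)[of k]] i[OF s(3) s(4)] by (simp add: left_diff_distrib right_diff_distrib)
      have "nrm M (Y k) = nrm M (\<lambda>x. (Y k x - B x) + B x)" by simp
      also have "\<dots> \<le> ?dY k + nrm M B" by (rule nrm_triangle[OF sqint_diff[OF s(2,4)] s(4)])
      finally have y: "nrm M (Y k) \<le> ?dY k + nrm M B" .
      have "norm (LINT x|M. (X k x - A x) * Y k x) \<le> ?dX k * nrm M (Y k)"
        by (rule Cauchy_Schwarz_integral[OF sqint_diff[OF s(1,3)] s(2)])
      also have "\<dots> \<le> ?dX k * (?dY k + nrm M B)" by (rule mult_left_mono[OF y]) simp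
      finally have 1: "norm (LINT x|M. (X k x - A x) * Y k x) \<le> ?dX k * (?dY k + nrm M B)" .
      have 2: "norm (LINT x|M. A x * (Y k x - B x)) \<le> nrm M A * ?dY k"
        by (rule Cauchy_Schwarz_integral[OF s(3) sqint_diff[OF s(2,4)]])
      show "norm ((LINT x|M. X k x * Y k x) - (LINT x|M. A x * B x)) \<le> ?dX k * (?dY k + nrm M B) + nrm M A * ?dY k"
        unfolding e by (rule order.trans[OF norm_triangle_ineq add_mono[OF 1 2]])
    qed
  qed
  then show ?thesis by (simp add: LIM_zero_iff)
qed

section \<open>Compactly supported functions and test functions on \<open>D\<close>\<close>

lemma compact_support_bounded:
  fixes F :: "'a::euclidean_space \<Rightarrow> real"
  assumes "continuous_on UNIV F" "compact K" "\<And>x. x \<notin> K \<Longrightarrow> F x = 0"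
  obtains C where "\<And>x. \<bar>F x\<bar> \<le> C"
proof -
  have "bounded (F ` K)"
    by (intro compact_imp_bounded compact_continuous_image continuous_on_subset[OF assms(1)] assms) auto
  then obtain C where C: "C > 0" "\<And>x. x \<in> K \<Longrightarrow> \<bar>F x\<bar> \<le> C"
    unfolding bounded_pos by (metis imageI real_norm_def)
  have "\<bar>F x\<bar> \<le> C" for x using C assms(3)[of x] by (cases "x \<in> K") auto
  then show ?thesis by (rule that)
qed

lemma continuous_measurable_lebesgue_on:
  fixes F :: "'a::euclidean_space \<Rightarrow> 'b::metric_space"
  assumes "continuous_on UNIV F" shows "F \<in> borel_measurable (lebesgue_on D)"
  using borel_measurable_continuous_onI[OF assms]
  by (intro measurable_restrict_space1 measurable_completion) auto

lemma integrable_lebesgue_on: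
  fixes F :: "'a::euclidean_space \<Rightarrow> real"
  assumes "integrable lborel F" "open D"
  shows "integrable (lebesgue_on D) F"
proof -
  have D: "D \<inter> space lebesgue \<in> sets lebesgue" using assms(2) by (simp add: borel_open sets_completionI_sets)
  have "integrable lebesgue F" using assms(1) by (subst integrable_completion) auto
  then have "integrable lebesgue (\<lambda>x. indicator D x *\<^sub>R F x)"
    using D by (intro integrable_mult_indicator) auto
  then show ?thesis unfolding integrable_restrict_space[OF D] .
qed

lemma compact_support_sqint:
  fixes F :: "'a::euclidean_space \<Rightarrow> real"
  assumes "continuous_on UNIV F" "compact K" "\<And>x. x \<notin> K \<Longrightarrow> F x = 0" "open D"
  shows "sqint (lebesgue_on D) F"
proof -
  have "integrable lborel (\<lambda>x. (norm (F x))\<^sup>2)"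
    by (rule compact_support_integrable[OF _ assms(2)]) (use assms in \<open>auto intro!: continuous_intros\<close>)
  then show ?thesis unfolding sqint_def
    using integrable_lebesgue_on[OF _ assms(4)] continuous_measurable_lebesgue_on[OF assms(1)] by blast
qed

lemma test_functionD:
  assumes "test_function D \<eta>"
  obtains K where "compact K" "K \<subseteq> D" "\<And>x. x \<notin> K \<Longrightarrow> \<eta> x = 0" "\<And>k. Ck_on k UNIV \<eta>"
proof
  show "compact (closure {x. \<eta> x \<noteq> 0})" "closure {x. \<eta> x \<noteq> 0} \<subseteq> D" "\<And>k. Ck_on k UNIV \<eta>"
    using assms unfolding test_function_def by auto
  show "\<eta> x = 0" if "x \<notin> closure {x. \<eta> x \<noteq> 0}" for x
    using that closure_subset[of "{x. \<eta> x \<noteq> 0}"] by auto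
qed

lemma test_functionI:
  assumes "compact K" "K \<subseteq> D" "\<And>x. x \<notin> K \<Longrightarrow> \<eta> x = 0" "\<And>k. Ck_on k UNIV \<eta>"
  shows "test_function D \<eta>"
proof -
  have "closure {x. \<eta> x \<noteq> 0} \<subseteq> K" using assms by (intro closure_minimal compact_imp_closed) auto
  moreover have "compact (closure {x. \<eta> x \<noteq> 0})"
    using compact_Int_closed[OF assms(1) closed_closure[of "{x. \<eta> x \<noteq> 0}"]] calculation by (simp add: inf.absorb2)
  ultimately show ?thesis using assms unfolding test_function_def by blast
qed

lemma Ck_on_continuous: "Ck_on k S f \<Longrightarrow> continuous_on S f"
  using Ck_on_le[of k S f 0] by simp

lemma Ck_on_1D:
  assumes "Ck_on 1 UNIV f"
  shows "continuous_on UNIV f" "f differentiable (at x)" "b \<in> Basis \<Longrightarrow> continuous_on UNIV (partial b f)"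
  using Ck_on_continuous[OF assms] assms by simp_all

text \<open>The localization formula \<open>Re \<langle>Hf, \<zeta>\<^sup>2 f\<rangle> = q(\<zeta> f) - \<integral> \<bar>\<nabla>\<zeta>\<bar>\<^sup>2 f\<^sup>2\<close>; the \<open>\<eta> k\<close> approximate \<open>f\<close> in \<open>H\<^sup>1\<close> near
  the support of \<open>\<zeta>\<close>.\<close>

lemma localized_form_bound:
  fixes f g :: "'a::euclidean_space \<Rightarrow> real"
  defines "M \<equiv> \<lambda>D. lebesgue_on D"
  assumes D: "open D" and f: "sqint (M D) f" and g: "sqint (M D) g"
    and weak: "\<And>\<theta>. test_function (D - {0}) \<theta> \<Longrightarrow>
      (LINT x|M D. f x * (- laplacian \<theta> x + V x * \<theta> x)) = (LINT x|M D. g x * \<theta> x)"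
    and V: "continuous_on (- {0}) V"
    and form: "\<And>\<theta>. test_function (D - {0}) \<theta> \<Longrightarrow>
      0 \<le> (LINT x|lborel. (\<Sum>b\<in>Basis. (partial b \<theta> x)\<^sup>2)) + (LINT x|lborel. V x * (\<theta> x)\<^sup>2)"
    and \<zeta>: "\<And>k. Ck_on k UNIV \<zeta>" and K: "compact K" "K \<subseteq> - {0}" "\<And>x. x \<notin> K \<Longrightarrow> \<zeta> x = 0"
    and \<zeta>1: "\<And>x. x \<in> K \<Longrightarrow> \<zeta>1 x = 1"
    and \<eta>: "\<And>k. test_function D (\<eta> k)" "L2_lim (M D) \<eta> (\<lambda>x. \<zeta>1 x * f x)"
    and F: "\<And>b. b \<in> Basis \<Longrightarrow> L2_lim (M D) (\<lambda>k. partial b (\<eta> k)) (F b)"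
  shows "0 \<le> (LINT x|M D. (\<zeta> x)\<^sup>2 * (g x * f x)) + (LINT x|M D. (\<Sum>b\<in>Basis. (partial b \<zeta> x)\<^sup>2) * (f x)\<^sup>2)"
proof -
  let ?M = "M D"
  have clK: "closed K" by (rule compact_imp_closed[OF K(1)])
  have c\<zeta>: "continuous_on UNIV \<zeta>" "\<zeta> differentiable at x" "b \<in> Basis \<Longrightarrow> continuous_on UNIV (partial b \<zeta>)" for b x
    using Ck_on_1D[OF \<zeta>] by auto
  have d\<zeta>0: "partial b \<zeta> x = 0" if "x \<notin> K" for b x
    by (rule partial_zero_outside[OF clK K(3) that])
  have c\<eta>: "continuous_on UNIV (\<eta> k)" "\<eta> k differentiable at x" "b \<in> Basis \<Longrightarrow> continuous_on UNIV (partial b (\<eta> k))" for k b x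
    using \<eta>(1)[of k] Ck_on_1D[of "\<eta> k"] unfolding test_function_def by auto
  have cV: "continuous_on UNIV (\<lambda>x. V x * (\<zeta> x)\<^sup>2)"
    by (rule continuous_on_glue[OF clK _ _ K(2)])
      (use K(3) in \<open>auto intro!: continuous_intros V continuous_on_subset[OF c\<zeta>(1)]\<close>)
  have meas: "w \<in> borel_measurable ?M" if "continuous_on UNIV w" for w :: "'a \<Rightarrow> real"
    unfolding M_def by (rule continuous_measurable_lebesgue_on[OF that])
  have lim_mult: "L2_lim ?M (\<lambda>k x. w x * X k x) (\<lambda>x. w x * A x)"
    if "L2_lim ?M X A" "continuous_on UNIV w" "\<And>x. x \<notin> K \<Longrightarrow> w x = 0" for w X A
    using compact_support_bounded[OF that(2) K(1) that(3)] L2_lim_mult[OF that(1) meas[OF that(2)]] by metis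
  define N where "N x = (\<Sum>b\<in>Basis. (partial b \<zeta> x)\<^sup>2)" for x
  have cN: "continuous_on UNIV N" unfolding N_def by (intro continuous_intros c\<zeta>)
  have N0: "N x = 0" if "x \<notin> K" for x unfolding N_def using d\<zeta>0[OF that] by simp
  \<comment> \<open>\<open>\<theta> k\<close> is the test function for the weak equation, and
    \<open>\<omega> k\<close> below is the one for the quadratic form; the powers of \<zeta> differ
    so that the two results can be compared.\<close>
  define \<theta> where "\<theta> k x = \<zeta> x * \<zeta> x * \<eta> k x" for k x
  define \<omega> where "\<omega> k x = \<zeta> x * \<eta> k x" for k x
  define d\<theta> where "d\<theta> b k x = 2 * \<zeta> x * partial b \<zeta> x * \<eta> k x + (\<zeta> x)\<^sup>2 * partial b (\<eta> k) x" for b k x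
  define P where "P b x = 2 * \<zeta> x * partial b \<zeta> x * (\<zeta>1 x * f x) + (\<zeta> x)\<^sup>2 * F b x" for b x
  have p\<theta>: "partial b (\<theta> k) x = d\<theta> b k x" for b k x
    unfolding \<theta>_def d\<theta>_def using c\<zeta>(2) c\<eta>(2)
    by (subst partial_mult) (auto intro: differentiable_mult simp: partial_mult power2_eq_square algebra_simps)
  have p\<omega>: "partial b (\<omega> k) x = \<zeta> x * partial b (\<eta> k) x + partial b \<zeta> x * \<eta> k x" for b k x
    unfolding \<omega>_def by (rule partial_mult[OF c\<zeta>(2) c\<eta>(2)])
  have supp: "\<exists>K'. compact K' \<and> K' \<subseteq> D - {0} \<and> K' \<subseteq> K \<and> (\<forall>x. x \<notin> K' \<longrightarrow> \<zeta> x * \<eta> k x = 0)" for k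
  proof -
    obtain Kk where Kk: "compact Kk" "Kk \<subseteq> D" "\<And>x. x \<notin> Kk \<Longrightarrow> \<eta> k x = 0"
      using test_functionD[OF \<eta>(1)[of k]] by metis
    show ?thesis using Kk K by (intro exI[of _ "K \<inter> Kk"]) (auto intro: compact_Int)
  qed
  then obtain K' where K': "\<And>k. compact (K' k)" "\<And>k. K' k \<subseteq> D - {0}" "\<And>k. K' k \<subseteq> K"
      "\<And>k x. x \<notin> K' k \<Longrightarrow> \<zeta> x * \<eta> k x = 0" by metis
  have S\<eta>: "Ck_on j UNIV (\<eta> k)" for j k using \<eta>(1)[of k] unfolding test_function_def by blast
  have S\<theta>: "Ck_on j UNIV (\<theta> k)" for j k unfolding \<theta>_def by (intro Ck_on_mult \<zeta> S\<eta> open_UNIV)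
  have S\<omega>: "Ck_on j UNIV (\<omega> k)" for j k unfolding \<omega>_def by (intro Ck_on_mult \<zeta> S\<eta> open_UNIV)
  have \<omega>0: "\<omega> k x = 0" if "x \<notin> K' k" for k x unfolding \<omega>_def by (rule K'(4)[OF that])
  have \<theta>0: "\<theta> k x = 0" if "x \<notin> K' k" for k x using K'(4)[OF that] unfolding \<theta>_def by (simp add: mult.assoc)
  have t\<theta>: "test_function (D - {0}) (\<theta> k)" for k by (rule test_functionI[OF K'(1,2) \<theta>0 S\<theta>])
  have t\<omega>: "test_function (D - {0}) (\<omega> k)" for k by (rule test_functionI[OF K'(1,2) \<omega>0 S\<omega>])
  have transfer: "(LINT x|?M. h x) = (LINT x|lborel. h x)" "integrable ?M h"
    if "continuous_on UNIV h" "\<And>x. x \<notin> K' k \<Longrightarrow> h x = 0" for h :: "'a \<Rightarrow> real" and k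
  proof -
    have "K' k \<subseteq> D" using K'(2)[of k] by auto
    then show "(LINT x|?M. h x) = (LINT x|lborel. h x)" "integrable ?M h"
      unfolding M_def using compact_support_integral_lebesgue_on[OF that(1) K'(1)[of k] that(2) _ D] by auto
  qed
  have clK': "closed (K' k)" for k by (rule compact_imp_closed[OF K'(1)])
  have lim\<theta>: "L2_lim ?M (\<lambda>k. d\<theta> b k) (P b)" if b: "b \<in> Basis" for b
    unfolding d\<theta>_def P_def
    by (intro L2_lim_add lim_mult \<eta>(2) F b continuous_intros c\<zeta>) (auto simp: K(3))
  \<comment> \<open>The weak equation tested with \<open>\<theta> k\<close>. Since \<open>f\<close>
    has a gradient only as a limit, the Laplacian is integrated by parts against
    \<open>\<eta> j\<close> with \<open>k\<close> fixed, and then j tends to infinity.\<close>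
  have eq1: "(\<Sum>b\<in>Basis. LINT x|?M. F b x * d\<theta> b k x) + (LINT x|?M. f x * (V x * (\<zeta> x)\<^sup>2 * \<eta> k x)) =
      (LINT x|?M. g x * ((\<zeta> x)\<^sup>2 * \<eta> k x))" for k
  proof -
    have C2: "Ck_on (Suc (Suc 0)) UNIV (\<theta> k)" by (rule S\<theta>)
    have cl: "continuous_on UNIV (laplacian (\<theta> k))" unfolding laplacian_def[abs_def]
      by (intro continuous_on_sum) (use C2 in simp)
    have l0: "laplacian (\<theta> k) x = 0" if "x \<notin> K' k" for x
      unfolding laplacian_def using partial_zero_outside[OF clK' partial_zero_outside[OF clK' \<theta>0] that] by simp
    have sl: "sqint ?M (laplacian (\<theta> k))"
      unfolding M_def by (rule compact_support_sqint[OF cl K'(1) l0 D])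
    have cd: "continuous_on UNIV (d\<theta> b k)" if "b \<in> Basis" for b
      using Ck_on_1D(3)[OF S\<theta> that, of k] unfolding p\<theta>[abs_def] .
    have d0: "d\<theta> b k x = 0" if "x \<notin> K' k" for b x
      unfolding p\<theta>[symmetric] by (rule partial_zero_outside[OF clK' \<theta>0 that])
    have sd: "sqint ?M (d\<theta> b k)" if "b \<in> Basis" for b
      unfolding M_def by (rule compact_support_sqint[OF cd[OF that] K'(1) d0 D])
    have lim_a: "(\<lambda>j. LINT x|?M. \<eta> j x * laplacian (\<theta> k) x) \<longlonglongrightarrow> (LINT x|?M. (\<zeta>1 x * f x) * laplacian (\<theta> k) x)"
      by (rule L2_lim_inner[OF \<eta>(2) L2_lim_const[OF sl]])
    have parts: "(LINT x|?M. \<eta> j x * laplacian (\<theta> k) x) = - (\<Sum>b\<in>Basis. LINT x|?M. partial b (\<eta> j) x * d\<theta> b k x)" for j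
    proof -
      have "(LINT x|?M. \<eta> j x * laplacian (\<theta> k) x) = (LINT x|lborel. \<eta> j x * laplacian (\<theta> k) x)"
        by (rule transfer(1)[of _ k]) (auto intro!: continuous_intros cl c\<eta> simp: l0)
      also have "\<dots> = - (LINT x|lborel. (\<Sum>b\<in>Basis. partial b (\<eta> j) x * partial b (\<theta> k) x))"
        by (rule integration_by_parts_laplacian[OF S\<eta> S\<theta> K'(1) \<theta>0])
      also have "\<dots> = - (LINT x|?M. (\<Sum>b\<in>Basis. partial b (\<eta> j) x * d\<theta> b k x))"
        unfolding p\<theta> by (subst transfer(1)[of _ k]) (auto intro!: continuous_intros cd c\<eta> simp: d0)
      also have "\<dots> = - (\<Sum>b\<in>Basis. LINT x|?M. partial b (\<eta> j) x * d\<theta> b k x)"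
        by (subst Bochner_Integration.integral_sum) (auto intro!: transfer(2)[of _ k] continuous_intros cd c\<eta> simp: d0)
      finally show ?thesis .
    qed
    have lim_b: "(\<lambda>j. - (\<Sum>b\<in>Basis. LINT x|?M. partial b (\<eta> j) x * d\<theta> b k x)) \<longlonglongrightarrow>
        - (\<Sum>b\<in>Basis. LINT x|?M. F b x * d\<theta> b k x)"
      by (intro tendsto_minus tendsto_sum L2_lim_inner F L2_lim_const sd)
    have lap: "(LINT x|?M. (\<zeta>1 x * f x) * laplacian (\<theta> k) x) = - (\<Sum>b\<in>Basis. LINT x|?M. F b x * d\<theta> b k x)"
      by (rule LIMSEQ_unique[OF lim_a[unfolded parts] lim_b])
    \<comment> \<open>\<open>\<zeta>1\<close> is 1 on \<open>K\<close>, which contains the support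
      of \<open>\<theta> k\<close>, so the localizing factor disappears.\<close>
    have e1: "(\<zeta>1 x * f x) * laplacian (\<theta> k) x = f x * laplacian (\<theta> k) x" for x
      using l0[of x] \<zeta>1[of x] K'(3)[of k] by (cases "x \<in> K' k") auto
    have cVk: "continuous_on UNIV (\<lambda>x. V x * (\<zeta> x)\<^sup>2 * \<eta> k x)" by (intro continuous_on_mult cV c\<eta>)
    have sV: "sqint ?M (\<lambda>x. V x * (\<zeta> x)\<^sup>2 * \<eta> k x)"
      unfolding M_def by (rule compact_support_sqint[OF cVk K(1) _ D]) (simp add: K)
    have "(LINT x|?M. f x * (- laplacian (\<theta> k) x + V x * \<theta> k x)) =
        (LINT x|?M. - (f x * laplacian (\<theta> k) x) + f x * (V x * (\<zeta> x)\<^sup>2 * \<eta> k x))"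
      by (rule Bochner_Integration.integral_cong) (auto simp: \<theta>_def algebra_simps power2_eq_square)
    also have "\<dots> = - (LINT x|?M. f x * laplacian (\<theta> k) x) + (LINT x|?M. f x * (V x * (\<zeta> x)\<^sup>2 * \<eta> k x))"
      using sqint_mult_integrable[OF f sl] sqint_mult_integrable[OF f sV] by simp
    finally have "(LINT x|?M. g x * \<theta> k x) = - (LINT x|?M. f x * laplacian (\<theta> k) x) + (LINT x|?M. f x * (V x * (\<zeta> x)\<^sup>2 * \<eta> k x))"
      unfolding weak[OF t\<theta>] .
    then show ?thesis using lap unfolding e1 by (simp add: \<theta>_def power2_eq_square mult.assoc)
  qed
  \<comment> \<open>The form at \<open>\<omega> k\<close>, by the identity |grad (\<zeta> \<eta>)|^2
    = grad \<eta> . grad (\<zeta>^2 \<eta>) + |grad \<zeta>|^2 \<eta>^2. Its first term is the one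
    that occurs in eq1.\<close>
  have eq2: "0 \<le> (\<Sum>b\<in>Basis. LINT x|?M. partial b (\<eta> k) x * d\<theta> b k x) + (LINT x|?M. (N x * \<eta> k x) * \<eta> k x)
      + (LINT x|?M. (V x * (\<zeta> x)\<^sup>2 * \<eta> k x) * \<eta> k x)" for k
  proof -
    have d0: "d\<theta> b k x = 0" if "x \<notin> K' k" for b x
      unfolding p\<theta>[symmetric] by (rule partial_zero_outside[OF clK' \<theta>0 that])
    have dw0: "partial b (\<omega> k) x = 0" if "x \<notin> K' k" for b x
      by (rule partial_zero_outside[OF clK' \<omega>0 that])
    have cd: "continuous_on UNIV (d\<theta> b k)" if "b \<in> Basis" for b
      using Ck_on_1D(3)[OF S\<theta> that, of k] unfolding p\<theta>[abs_def] .
    have pt: "(\<Sum>b\<in>Basis. (partial b (\<omega> k) x)\<^sup>2) = (\<Sum>b\<in>Basis. partial b (\<eta> k) x * d\<theta> b k x) + (N x * \<eta> k x) * \<eta> k x" for x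
      unfolding p\<omega> d\<theta>_def N_def sum_distrib_right sum.distrib[symmetric]
      by (rule sum.cong) (auto simp: power2_eq_square algebra_simps)
    have cw: "continuous_on UNIV (\<lambda>x. \<Sum>b\<in>Basis. (partial b (\<omega> k) x)\<^sup>2)"
      by (intro continuous_intros Ck_on_1D(3)[OF S\<omega>])
    have i1: "integrable ?M (\<lambda>x. partial b (\<eta> k) x * d\<theta> b k x)" if "b \<in> Basis" for b
      by (rule transfer(2)[of _ k]) (auto intro!: continuous_intros cd c\<eta> that simp: d0)
    have i3: "integrable ?M (\<lambda>x. (N x * \<eta> k x) * \<eta> k x)"
    proof -
      have "sqint ?M (\<lambda>x. N x * \<eta> k x)" "sqint ?M (\<eta> k)"
        using lim_mult[OF \<eta>(2) cN N0] \<eta>(2) unfolding L2_lim_def by auto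
      then show ?thesis by (rule sqint_mult_integrable)
    qed
    have "(LINT x|lborel. (\<Sum>b\<in>Basis. (partial b (\<omega> k) x)\<^sup>2)) = (LINT x|?M. (\<Sum>b\<in>Basis. (partial b (\<omega> k) x)\<^sup>2))"
      by (rule transfer(1)[symmetric, of _ k]) (auto simp: dw0 intro: cw)
    also have "\<dots> = (\<Sum>b\<in>Basis. LINT x|?M. partial b (\<eta> k) x * d\<theta> b k x) + (LINT x|?M. (N x * \<eta> k x) * \<eta> k x)"
      unfolding pt using i1 i3 by simp
    finally have 1: "(LINT x|lborel. (\<Sum>b\<in>Basis. (partial b (\<omega> k) x)\<^sup>2)) =
      (\<Sum>b\<in>Basis. LINT x|?M. partial b (\<eta> k) x * d\<theta> b k x) + (LINT x|?M. (N x * \<eta> k x) * \<eta> k x)" .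
    have e: "V x * (\<omega> k x)\<^sup>2 = (V x * (\<zeta> x)\<^sup>2 * \<eta> k x) * \<eta> k x" for x
      unfolding \<omega>_def by (simp add: power2_eq_square)
    have "(LINT x|lborel. V x * (\<omega> k x)\<^sup>2) = (LINT x|?M. (V x * (\<zeta> x)\<^sup>2 * \<eta> k x) * \<eta> k x)"
      unfolding e by (rule transfer(1)[symmetric, of _ k], intro continuous_on_mult cV c\<eta>) (metis e \<omega>0 mult_zero_right power_zero_numeral)
    then show ?thesis using form[OF t\<omega>[of k]] 1 by simp
  qed
  define h where "h x = \<zeta>1 x * f x" for x
  have h: "sqint ?M h" using \<eta>(2) unfolding L2_lim_def h_def by blast
  \<comment> \<open>Now k tends to infinity. The gradient and potential terms of lim1 and lim2
    agree, so comparing the two eliminates them and leaves only \<open>g\<close>, \<open>f\<close>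
    and the gradient of \<zeta>.\<close>
  have lim1: "(\<Sum>b\<in>Basis. LINT x|?M. F b x * P b x) + (LINT x|?M. f x * (V x * (\<zeta> x)\<^sup>2 * h x)) =
      (LINT x|?M. g x * ((\<zeta> x)\<^sup>2 * h x))"
  proof (rule LIMSEQ_unique)
    have sF: "sqint ?M (F b)" if "b \<in> Basis" for b using F[OF that] unfolding L2_lim_def by blast
    show "(\<lambda>k. LINT x|?M. g x * ((\<zeta> x)\<^sup>2 * \<eta> k x)) \<longlonglongrightarrow> (LINT x|?M. g x * ((\<zeta> x)\<^sup>2 * h x))"
      unfolding h_def by (intro L2_lim_inner L2_lim_const g lim_mult \<eta>(2) continuous_intros c\<zeta>) (simp add: K)
    show "(\<lambda>k. LINT x|?M. g x * ((\<zeta> x)\<^sup>2 * \<eta> k x)) \<longlonglongrightarrow>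
        (\<Sum>b\<in>Basis. LINT x|?M. F b x * P b x) + (LINT x|?M. f x * (V x * (\<zeta> x)\<^sup>2 * h x))"
      unfolding eq1[symmetric] h_def
      by (intro tendsto_add tendsto_sum L2_lim_inner L2_lim_const sF f lim\<theta> lim_mult \<eta>(2) cV) (use K(3) in auto)
  qed
  have lim2: "0 \<le> (\<Sum>b\<in>Basis. LINT x|?M. F b x * P b x) + (LINT x|?M. (N x * h x) * h x)
      + (LINT x|?M. (V x * (\<zeta> x)\<^sup>2 * h x) * h x)"
  proof (rule LIMSEQ_le_const)
    show "(\<lambda>k. (\<Sum>b\<in>Basis. LINT x|?M. partial b (\<eta> k) x * d\<theta> b k x) + (LINT x|?M. (N x * \<eta> k x) * \<eta> k x)
      + (LINT x|?M. (V x * (\<zeta> x)\<^sup>2 * \<eta> k x) * \<eta> k x)) \<longlonglongrightarrow>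
      (\<Sum>b\<in>Basis. LINT x|?M. F b x * P b x) + (LINT x|?M. (N x * h x) * h x)
      + (LINT x|?M. (V x * (\<zeta> x)\<^sup>2 * h x) * h x)"
      unfolding h_def
      by (intro tendsto_add tendsto_sum L2_lim_inner F lim\<theta> lim_mult \<eta>(2) cV cN N0) (use K(3) in auto)
  qed (use eq2 in blast)
  have e1: "f x * (V x * (\<zeta> x)\<^sup>2 * h x) = (V x * (\<zeta> x)\<^sup>2 * h x) * h x" for x
    using \<zeta>1[of x] K(3)[of x] unfolding h_def by (cases "x \<in> K") auto
  have e2: "g x * ((\<zeta> x)\<^sup>2 * h x) = (\<zeta> x)\<^sup>2 * (g x * f x)" for x
    using \<zeta>1[of x] K(3)[of x] unfolding h_def by (cases "x \<in> K") auto
  have e3: "(N x * h x) * h x = N x * (f x)\<^sup>2" for x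
    using \<zeta>1[of x] N0[of x] unfolding h_def by (cases "x \<in> K") (auto simp: power2_eq_square)
  show ?thesis using lim1 lim2 unfolding e1 e2 e3 unfolding N_def by linarith
qed

section \<open>Cutoffs at infinity and at the origin\<close>

lemma sum_inner_Basis_sq: "(\<Sum>b\<in>Basis. (x \<bullet> b)\<^sup>2) = x \<bullet> (x::'a::euclidean_space)"
  unfolding euclidean_inner[of x x] by (simp add: power2_eq_square)

text \<open>Using |x|^2 / R^2 as the argument keeps the function smooth at the origin. The squared
  gradient is 4 c^2 |x|^2 / R^4 with c the derivative of \<open>cutoff\<close>, and |x|^2 is at most
  2 R^2 wherever c does not vanish.\<close>

lemma radial_cutoff:
  fixes R :: real
  assumes R: "R > 0" and C: "\<And>s. \<bar>partial 1 cutoff s\<bar> \<le> C" "\<forall>s. s < 1 \<or> s > 2 \<longrightarrow> partial 1 cutoff s = 0"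
  defines "\<rho> \<equiv> \<lambda>x::'a::euclidean_space. cutoff (1 / R\<^sup>2 * (x \<bullet> x))"
  shows "\<And>k. Ck_on k UNIV \<rho>" and "\<And>x. 0 \<le> \<rho> x \<and> \<rho> x \<le> 1"
    and "\<And>x. norm x \<le> R \<Longrightarrow> \<rho> x = 1" and "\<And>x. x \<notin> cball 0 (2 * R) \<Longrightarrow> \<rho> x = 0"
    and "\<And>x. (\<Sum>b\<in>Basis. (partial b \<rho> x)\<^sup>2) \<le> 8 * C\<^sup>2 / R\<^sup>2"
proof -
  have S: "Ck_on k UNIV (\<lambda>x::'a. 1 / R\<^sup>2 * (x \<bullet> x))" for k
    by (intro Ck_on_cmult Ck_on_inner_self open_UNIV)
  show "Ck_on k UNIV \<rho>" for k
    unfolding \<rho>_def by (rule Ck_on_compose[OF _ _ Ck_on_cutoff S]) auto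
  show "0 \<le> \<rho> x \<and> \<rho> x \<le> 1" for x unfolding \<rho>_def by (simp add: cutoff_range)
  show "\<rho> x = 1" if "norm x \<le> R" for x
  proof -
    have "(norm x)\<^sup>2 \<le> R\<^sup>2" using that by (intro power_mono) auto
    then show ?thesis unfolding \<rho>_def using R by (intro cutoff_one) (simp add: power2_norm_eq_inner[symmetric])
  qed
  show "\<rho> x = 0" if "x \<notin> cball 0 (2 * R)" for x
  proof -
    have "(2 * R)\<^sup>2 \<le> (norm x)\<^sup>2" using that R by (intro power_mono) auto
    then have "4 \<le> 1 / R\<^sup>2 * (norm x)\<^sup>2" using R by (simp add: field_simps power_mult_distrib)
    then show ?thesis unfolding \<rho>_def power2_norm_eq_inner by (intro cutoff_zero) simp
  qed
  show "(\<Sum>b\<in>Basis. (partial b \<rho> x)\<^sup>2) \<le> 8 * C\<^sup>2 / R\<^sup>2" for x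
  proof -
    define s where "s = 1 / R\<^sup>2 * (x \<bullet> x)"
    define c where "c = partial 1 cutoff s"
    have "partial b \<rho> x = c * (2 / R\<^sup>2 * (x \<bullet> b))" for b
    proof -
      have "partial b \<rho> x = c * partial b (\<lambda>x. 1 / R\<^sup>2 * (x \<bullet> x)) x"
        unfolding \<rho>_def c_def s_def
        by (rule partial_compose) (use S[of 1] Ck_on_cutoff[of 1] in auto)
      moreover have "partial b (\<lambda>x. 1 / R\<^sup>2 * (x \<bullet> x)) x = 2 / R\<^sup>2 * (x \<bullet> b)"
        using partial_bounded_linear[OF bounded_linear_mult_right differentiable_inner_self[of x], of b "1 / R\<^sup>2"]
        by (simp add: partial_inner_self)
      ultimately show ?thesis by simp
    qed
    then have "(\<Sum>b\<in>Basis. (partial b \<rho> x)\<^sup>2) = (\<Sum>b\<in>Basis. c\<^sup>2 * (2 / R\<^sup>2)\<^sup>2 * (x \<bullet> b)\<^sup>2)"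
      by (simp only: power_mult_distrib mult.assoc)
    also have "\<dots> = c\<^sup>2 * (2 / R\<^sup>2)\<^sup>2 * (x \<bullet> x)"
      by (simp only: sum_distrib_left[symmetric] sum_inner_Basis_sq)
    also have "\<dots> = c\<^sup>2 * s * (4 / R\<^sup>2)" unfolding s_def by (simp add: power2_eq_square)
    also have "\<dots> \<le> C\<^sup>2 * 2 * (4 / R\<^sup>2)"
    proof (cases "s > 2")
      case True then show ?thesis using C(2) unfolding c_def by simp
    next
      case False
      have "c\<^sup>2 \<le> C\<^sup>2" using C(1)[of s] unfolding c_def by (metis abs_ge_zero power2_abs power_mono)
      moreover have "s \<ge> 0" unfolding s_def by simp
      ultimately show ?thesis using False by (intro mult_right_mono mult_mono) auto
    qed
    finally show ?thesis by simp
  qed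
qed

text \<open>With \<open>L(s) = ln (s + 1) - ln (s + d)\<close>, a regularization of \<open>ln (1 + 1 / |x|\<^sup>2)\<close> at \<open>s = |x|\<^sup>2\<close>, Hardy's
  inequality for the field \<open>- \<nabla>L / (2 L)\<close> controls \<open>\<bar>\<nabla>(ln L)\<bar>\<^sup>2\<close>, uniformly in \<open>d\<close>.\<close>

lemma log_hardy:
  fixes \<eta> :: "'a::euclidean_space \<Rightarrow> real"
  assumes dim: "DIM('a) \<ge> 2" and d: "0 < d" "d \<le> 1/2"
    and \<eta>: "Ck_on 1 UNIV \<eta>" and K: "compact K" "\<And>x. x \<notin> K \<Longrightarrow> \<eta> x = 0"
  defines "\<phi> \<equiv> \<lambda>s. (1 / (s + d) - 1 / (s + 1)) / (ln (s + 1) - ln (s + d))"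
  shows "continuous_on UNIV (\<lambda>x::'a. (x \<bullet> x) * (\<phi> (x \<bullet> x))\<^sup>2)"
    and "(LINT x|lborel. (\<eta> x)\<^sup>2 * ((x \<bullet> x) * (\<phi> (x \<bullet> x))\<^sup>2))
      \<le> (LINT x|lborel. (\<Sum>b\<in>Basis. (partial b \<eta> x)\<^sup>2)) + 4 * (LINT x|lborel. (\<eta> x)\<^sup>2)"
proof -
  define L where "L s = ln (s + 1) - ln (s + d)" for s
  define c where "c s = 1 / (s + d) - 1 / (s + 1)" for s
  define \<phi>' where "\<phi>' s = (- 1 / (s + d)\<^sup>2 + 1 / (s + 1)\<^sup>2) / L s + (c s)\<^sup>2 / (L s)\<^sup>2" for s
  have \<phi>: "\<phi> s = c s / L s" for s unfolding \<phi>_def c_def L_def ..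
  \<comment> \<open>On the open half-line s > -d the value s = 0 is an interior point, so the
    composition with |x|^2 is smooth across the origin.\<close>
  have L0: "L s > 0" if "s > - d" for s using that d unfolding L_def by simp
  have dL: "(L has_real_derivative - c s) (at s)" if "s > - d" for s
    unfolding L_def c_def using that d by (auto intro!: derivative_eq_intros)
  have dc: "(c has_real_derivative - 1 / (s + d)\<^sup>2 + 1 / (s + 1)\<^sup>2) (at s)" if "s > - d" for s
    unfolding c_def using that d by (auto intro!: derivative_eq_intros simp: power2_eq_square)
  have d\<phi>: "(\<phi> has_real_derivative \<phi>' s) (at s)" if "s > - d" for s
  proof -
    have a: "((\<lambda>s. c s / L s) has_real_derivative ((- 1 / (s + d)\<^sup>2 + 1 / (s + 1)\<^sup>2) * L s - c s * - c s) / (L s * L s)) (at s)"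
      by (rule DERIV_divide[OF dc dL]) (use that L0[of s] in auto)
    have b: "((- 1 / (s + d)\<^sup>2 + 1 / (s + 1)\<^sup>2) * L s - c s * - c s) / (L s * L s) = \<phi>' s"
    proof -
      have "(A * l - k * - k) / (l * l) = A / l + k\<^sup>2 / l\<^sup>2" if "l \<noteq> 0" for A l k :: real
        using that by (simp add: field_simps power2_eq_square)
      then show ?thesis unfolding \<phi>'_def using L0[OF that] by simp
    qed
    have "\<phi> = (\<lambda>s. c s / L s)" by (rule ext) (rule \<phi>)
    then show ?thesis using a unfolding b by simp
  qed
  have od: "open {- d<..}" by simp
  have Ca: "Ck_on k {- d<..} (\<lambda>s. s + e)" for k e
    using Ck_on_subset[OF Ck_on_affine_real[of k 1 e]] by simp
  have CL: "Ck_on k {- d<..} L" for k unfolding L_def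
    by (intro Ck_on_diff Ck_on_compose[OF _ _ Ck_on_ln] Ca od) (use d in auto)
  have C\<phi>: "Ck_on k {- d<..} \<phi>" for k
    unfolding \<phi>[abs_def] c_def
    by (intro Ck_on_divide Ck_on_diff Ck_on_const Ca CL od) (use d in \<open>auto simp: less_imp_neq[OF L0, symmetric]\<close>)
  have pos: "x \<bullet> x > - d" for x :: 'a using inner_ge_zero[of x] d by linarith
  have C\<phi>x: "Ck_on k UNIV (\<lambda>x::'a. \<phi> (x \<bullet> x))" for k
    by (rule Ck_on_compose[OF _ _ C\<phi> Ck_on_inner_self]) (use pos in auto)
  then have cont\<phi>: "continuous_on UNIV (\<lambda>x::'a. \<phi> (x \<bullet> x))" using Ck_on_le[of 0 UNIV _ 0] by (metis Ck_on.simps(1))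
  show cont: "continuous_on UNIV (\<lambda>x::'a. (x \<bullet> x) * (\<phi> (x \<bullet> x))\<^sup>2)"
    by (intro continuous_intros cont\<phi>)
  define X where "X b x = \<phi> (x \<bullet> x) * (x \<bullet> b)" for b x :: 'a
  have X1: "Ck_on 1 UNIV (X b)" for b
    unfolding X_def by (intro Ck_on_mult C\<phi>x Ck_on_inner open_UNIV)
  have dX: "partial b (X b) x = \<phi> (x \<bullet> x) + 2 * \<phi>' (x \<bullet> x) * (x \<bullet> b)\<^sup>2" if "b \<in> Basis" for b x
  proof -
    have 1: "((\<lambda>x. x \<bullet> x) has_derivative (\<lambda>h. x \<bullet> h + h \<bullet> x)) (at x)"
      by (auto intro!: derivative_eq_intros)
    have 2: "(\<phi> has_derivative (\<lambda>h. \<phi>' (x \<bullet> x) * h)) (at (x \<bullet> x))"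
      using d\<phi>[OF pos[of x]] by (simp add: has_field_derivative_def)
    have "((\<lambda>x. \<phi> (x \<bullet> x)) has_derivative (\<lambda>h. (x \<bullet> h + h \<bullet> x) * \<phi>' (x \<bullet> x))) (at x)"
      using diff_chain_at[OF 1 2] by (simp add: o_def mult.commute)
    then have "(X b has_derivative (\<lambda>h. \<phi> (x \<bullet> x) * (h \<bullet> b) + (x \<bullet> h + h \<bullet> x) * \<phi>' (x \<bullet> x) * (x \<bullet> b))) (at x)"
      unfolding X_def by (rule has_derivative_mult) (auto intro!: derivative_eq_intros)
    from partial_eqI[OF this, of b] show ?thesis
      using that by (simp add: inner_commute power2_eq_square)
  qed
  have sX: "(\<Sum>b\<in>Basis. partial b (X b) x - (X b x)\<^sup>2) =
      real DIM('a) * \<phi> (x \<bullet> x) + 2 * (x \<bullet> x) * \<phi>' (x \<bullet> x) - (x \<bullet> x) * (\<phi> (x \<bullet> x))\<^sup>2" for x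
  proof -
    have "(\<Sum>b\<in>Basis. partial b (X b) x - (X b x)\<^sup>2) =
        (\<Sum>b\<in>Basis. \<phi> (x \<bullet> x) + (2 * \<phi>' (x \<bullet> x) - (\<phi> (x \<bullet> x))\<^sup>2) * (x \<bullet> b)\<^sup>2)"
      by (rule sum.cong) (auto simp: dX X_def power_mult_distrib algebra_simps)
    also have "\<dots> = real DIM('a) * \<phi> (x \<bullet> x) + (2 * \<phi>' (x \<bullet> x) - (\<phi> (x \<bullet> x))\<^sup>2) * (x \<bullet> x)"
      by (simp add: sum.distrib sum_distrib_left[symmetric] sum_inner_Basis_sq)
    finally show ?thesis by (simp add: algebra_simps)
  qed
  \<comment> \<open>Dimension at least two enters through \<open>c s \<ge> 0\<close>, which lets the
    factor \<open>DIM('a)\<close> be lowered to 2. Then c + s c' equals d / (s + d)^2 - 1 / (s +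
    1)^2: the singular part is positive, and twice the rest is at most 4 L because d is at most
    1/2.\<close>
  have lower: "s * (\<phi> s)\<^sup>2 - 4 \<le> real DIM('a) * \<phi> s + 2 * s * \<phi>' s - s * (\<phi> s)\<^sup>2" if s: "s \<ge> 0" for s
  proof -
    have sd: "s > - d" using s d by linarith
    have L: "L s > 0" by (rule L0[OF sd])
    have c: "c s \<ge> 0" unfolding c_def using s d by (simp add: field_simps)
    have "ln ((s + d) / (s + 1)) \<le> (s + d) / (s + 1) - 1" using s d by (intro ln_le_minus_one) auto
    then have "(1 - d) / (s + 1) \<le> L s" unfolding L_def using s d by (simp add: ln_div field_simps)
    moreover have "1 / 2 / (s + 1) \<le> (1 - d) / (s + 1)" using s d by (intro divide_right_mono) auto
    ultimately have L2: "1 / (2 * (s + 1)) \<le> L s" by simp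
    have "s * (- 1 / (s + d)\<^sup>2 + 1 / (s + 1)\<^sup>2) + c s = d / (s + d)\<^sup>2 - 1 / (s + 1)\<^sup>2"
    proof -
      have "1 / (s + d) = (s + d) / (s + d)\<^sup>2" "1 / (s + 1) = (s + 1) / (s + 1)\<^sup>2"
        using s d by (simp_all add: power2_eq_square)
      then show ?thesis unfolding c_def by (simp add: add_divide_distrib algebra_simps)
    qed
    also have "\<dots> \<ge> - (1 / (s + 1)\<^sup>2)" using d by simp
    finally have 1: "- (1 / (s + 1)\<^sup>2) \<le> s * (- 1 / (s + d)\<^sup>2 + 1 / (s + 1)\<^sup>2) + c s" .
    have "s + 1 \<le> (s + 1)\<^sup>2" using s by (simp add: power2_eq_square)
    then have h: "1 / (s + 1)\<^sup>2 \<le> 1 / (s + 1)" using s by (intro divide_left_mono) auto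
    have "2 * (1 / (s + 1)\<^sup>2) \<le> 2 * (1 / (s + 1))" by (rule mult_left_mono[OF h]) simp
    also have "\<dots> = 4 * (1 / (2 * (s + 1)))" using s by (simp add: divide_simps)
    also have "\<dots> \<le> 4 * L s" by (rule mult_left_mono[OF L2]) simp
    finally have 2: "2 * (1 / (s + 1)\<^sup>2) \<le> 4 * L s" .
    have "- 4 * l \<le> 2 * E" if "2 * q \<le> 4 * l" "- q \<le> E" for q l E :: real using that by linarith
    from this[OF 2 1]
    have "- 4 * L s \<le> 2 * (s * (- 1 / (s + d)\<^sup>2 + 1 / (s + 1)\<^sup>2) + c s)" .
    also have "\<dots> \<le> 2 * s * (- 1 / (s + d)\<^sup>2 + 1 / (s + 1)\<^sup>2) + real DIM('a) * c s"
      using mult_right_mono[of 2 "real DIM('a)" "c s"] dim c by (simp add: algebra_simps)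
    finally have "- 4 \<le> (2 * s * (- 1 / (s + d)\<^sup>2 + 1 / (s + 1)\<^sup>2) + real DIM('a) * c s) / L s"
      using L by (simp add: pos_le_divide_eq)
    moreover have "real DIM('a) * \<phi> s + 2 * s * \<phi>' s - s * (\<phi> s)\<^sup>2 =
        (2 * s * (- 1 / (s + d)\<^sup>2 + 1 / (s + 1)\<^sup>2) + real DIM('a) * c s) / L s + s * (\<phi> s)\<^sup>2"
    proof -
      have "n * (k / l) + 2 * s * (A / l + k\<^sup>2 / l\<^sup>2) - s * (k / l)\<^sup>2 = (2 * s * A + n * k) / l + s * (k / l)\<^sup>2"
        for n k l A :: real
        by (simp add: power_divide add_divide_distrib distrib_left)
      then show ?thesis unfolding \<phi> \<phi>'_def by blast
    qed
    ultimately show ?thesis by linarith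
  qed
  have c\<eta>: "continuous_on UNIV \<eta>" using Ck_on_SucD[of 0 UNIV \<eta>] \<eta> by simp
  have i1: "integrable lborel (\<lambda>x. (\<eta> x)\<^sup>2 * ((x \<bullet> x) * (\<phi> (x \<bullet> x))\<^sup>2))"
    by (rule compact_support_integrable[OF _ K(1)]) (auto intro!: continuous_on_mult continuous_on_power c\<eta> cont simp: K)
  have i2: "integrable lborel (\<lambda>x. (\<eta> x)\<^sup>2)"
    by (rule compact_support_integrable[OF _ K(1)]) (auto intro!: continuous_intros c\<eta> simp: K)
  have i3: "integrable lborel (\<lambda>x. (\<eta> x)\<^sup>2 * (\<Sum>b\<in>Basis. partial b (X b) x - (X b x)\<^sup>2))"
  proof (rule compact_support_integrable[OF _ K(1)])
    have "continuous_on UNIV (X b)" "b \<in> Basis \<Longrightarrow> continuous_on UNIV (partial b (X b))" for b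
      using X1[of b] Ck_on_SucD[of 0 UNIV "X b"] by auto
    then show "continuous_on UNIV (\<lambda>x. (\<eta> x)\<^sup>2 * (\<Sum>b\<in>Basis. partial b (X b) x - (X b x)\<^sup>2))"
      by (intro continuous_intros c\<eta>)
  qed (simp add: K)
  have "(LINT x|lborel. (\<eta> x)\<^sup>2 * ((x \<bullet> x) * (\<phi> (x \<bullet> x))\<^sup>2)) - 4 * (LINT x|lborel. (\<eta> x)\<^sup>2) =
      (LINT x|lborel. (\<eta> x)\<^sup>2 * ((x \<bullet> x) * (\<phi> (x \<bullet> x))\<^sup>2) - 4 * (\<eta> x)\<^sup>2)"
    using i1 i2 by simp
  also have "\<dots> \<le> (LINT x|lborel. (\<eta> x)\<^sup>2 * (\<Sum>b\<in>Basis. partial b (X b) x - (X b x)\<^sup>2))"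
  proof (rule integral_mono)
    show "(\<eta> x)\<^sup>2 * ((x \<bullet> x) * (\<phi> (x \<bullet> x))\<^sup>2) - 4 * (\<eta> x)\<^sup>2 \<le> (\<eta> x)\<^sup>2 * (\<Sum>b\<in>Basis. partial b (X b) x - (X b x)\<^sup>2)" for x
      using mult_left_mono[OF lower[of "x \<bullet> x"], of "(\<eta> x)\<^sup>2"] unfolding sX by (simp add: algebra_simps)
  qed (use i1 i2 i3 in auto)
  also have "\<dots> \<le> (LINT x|lborel. (\<Sum>b\<in>Basis. (partial b \<eta> x)\<^sup>2))"
    by (rule hardy_vector_field[OF \<eta> K open_UNIV _ X1]) auto
  finally show "(LINT x|lborel. (\<eta> x)\<^sup>2 * ((x \<bullet> x) * (\<phi> (x \<bullet> x))\<^sup>2))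
      \<le> (LINT x|lborel. (\<Sum>b\<in>Basis. (partial b \<eta> x)\<^sup>2)) + 4 * (LINT x|lborel. (\<eta> x)\<^sup>2)" by simp
qed

text \<open>The cutoff acts on \<kappa> ln L, a doubly logarithmic function. Its squared gradient is
  at most 4 C^2 \<kappa>^2 times the weight of \<open>log_hardy\<close>, so it is small when tested
  against \<eta>^2 even for functions without a uniform bound.\<close>

lemma origin_cutoff:
  assumes dim: "DIM('a::euclidean_space) \<ge> 2" and \<kappa>: "\<kappa> > 0"
    and C: "\<And>s. \<bar>partial 1 cutoff s\<bar> \<le> C"
  obtains \<omega> :: "'a::euclidean_space \<Rightarrow> real" and e :: real where
    "\<And>k. Ck_on k UNIV \<omega>" "\<And>x. 0 \<le> \<omega> x \<and> \<omega> x \<le> 1" "e > 0" "\<And>x. norm x < e \<Longrightarrow> \<omega> x = 0"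
    "\<And>x. x \<noteq> 0 \<Longrightarrow> \<kappa> * ln (ln (1 + 1 / (x \<bullet> x))) \<le> 1 \<Longrightarrow> \<omega> x = 1"
    "\<And>\<eta> K. Ck_on 1 UNIV \<eta> \<Longrightarrow> compact K \<Longrightarrow> (\<And>x. x \<notin> K \<Longrightarrow> \<eta> x = 0) \<Longrightarrow>
      (LINT x|lborel. (\<Sum>b\<in>Basis. (partial b \<omega> x)\<^sup>2) * (\<eta> x)\<^sup>2) \<le>
        4 * C\<^sup>2 * \<kappa>\<^sup>2 * ((LINT x|lborel. (\<Sum>b\<in>Basis. (partial b \<eta> x)\<^sup>2)) + 4 * (LINT x|lborel. (\<eta> x)\<^sup>2))"
proof -
  \<comment> \<open>Makes \<open>L 0\<close> equal to exp (2 / \<kappa>) + 1. The strict excess over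
    exp (2 / \<kappa>) persists near the origin, where the argument of \<open>cutoff\<close> is then
    at least 2.\<close>
  define d where "d = exp (- exp (2 / \<kappa>) - 1)"
  have d0: "d > 0" unfolding d_def by simp
  have "exp (2 / \<kappa>) \<ge> 1" using \<kappa> by simp
  then have "d \<le> exp (- 1)" unfolding d_def by simp
  also have "\<dots> \<le> 1 / 2" using exp_ge_add_one_self[of 1] by (simp add: exp_minus field_simps)
  finally have d: "0 < d" "d \<le> 1/2" using d0 by auto
  define L where "L s = ln (s + 1) - ln (s + d)" for s
  define \<phi> where "\<phi> s = (1 / (s + d) - 1 / (s + 1)) / (ln (s + 1) - ln (s + d))" for s
  define \<omega> where "\<omega> x = cutoff (\<kappa> * ln (L (x \<bullet> x)))" for x :: 'a
  have L0: "L s > 0" if "s \<ge> 0" for s using that d unfolding L_def by simp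
  have Ca: "Ck_on k UNIV (\<lambda>x::'a. x \<bullet> x + e)" for k e
    by (intro Ck_on_add Ck_on_inner_self Ck_on_const open_UNIV)
  have CL: "Ck_on k UNIV (\<lambda>x::'a. L (x \<bullet> x))" for k unfolding L_def
    by (intro Ck_on_diff Ck_on_compose[OF _ _ Ck_on_ln] Ca open_UNIV) (use d in \<open>auto simp: add_nonneg_pos\<close>)
  have Clog: "Ck_on k UNIV (\<lambda>x::'a. \<kappa> * ln (L (x \<bullet> x)))" for k
    by (intro Ck_on_cmult Ck_on_compose[OF _ _ Ck_on_ln] CL open_UNIV) (use L0 in auto)
  have C\<omega>: "Ck_on k UNIV \<omega>" for k
    unfolding \<omega>_def by (rule Ck_on_compose[OF _ _ Ck_on_cutoff Clog]) auto
  have "continuous_on UNIV (\<lambda>x::'a. L (x \<bullet> x))" using CL[of 0] by simp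
  then have "open {x::'a. exp (2 / \<kappa>) < L (x \<bullet> x)}" by (intro open_Collect_less continuous_intros)
  moreover have "exp (2 / \<kappa>) < L ((0::'a) \<bullet> 0)" unfolding L_def d_def by simp
  ultimately obtain e where e: "e > 0" "ball 0 e \<subseteq> {x::'a. exp (2 / \<kappa>) < L (x \<bullet> x)}"
    using open_contains_ball_eq[of "{x::'a. exp (2 / \<kappa>) < L (x \<bullet> x)}" 0] by auto
  have z: "\<omega> x = 0" if "norm x < e" for x
  proof -
    have "exp (2 / \<kappa>) < L (x \<bullet> x)" using e(2) that by auto
    then have "2 / \<kappa> < ln (L (x \<bullet> x))" using ln_less_cancel_iff[of "exp (2 / \<kappa>)" "L (x \<bullet> x)"] L0[of "x \<bullet> x"] by simp
    then have "2 \<le> \<kappa> * ln (L (x \<bullet> x))" using \<kappa> by (simp add: field_simps)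
    then show ?thesis unfolding \<omega>_def by (rule cutoff_zero)
  qed
  \<comment> \<open>The regularization only lowers \<open>L\<close>, so the region where the cutoff
    is 1 can be described without \<open>d\<close>.\<close>
  have one: "\<omega> x = 1" if "x \<noteq> 0" "\<kappa> * ln (ln (1 + 1 / (x \<bullet> x))) \<le> 1" for x
  proof -
    have s: "x \<bullet> x > 0" using that by simp
    have "ln (x \<bullet> x) \<le> ln (x \<bullet> x + d)"
      by (subst ln_le_cancel_iff) (use s d in \<open>auto intro: add_pos_pos\<close>)
    then have "L (x \<bullet> x) \<le> ln (x \<bullet> x + 1) - ln (x \<bullet> x)" unfolding L_def by simp
    also have "\<dots> = ln (1 + 1 / (x \<bullet> x))"
    proof -
      have "ln (q + 1) - ln q = ln (1 + 1 / q)" if "q > 0" for q :: real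
        using that ln_div[of "q + 1" q] by (simp add: add_divide_distrib)
      then show ?thesis using s by blast
    qed
    finally have "ln (L (x \<bullet> x)) \<le> ln (ln (1 + 1 / (x \<bullet> x)))" using L0[of "x \<bullet> x"] by (subst ln_le_cancel_iff) auto
    then have "\<kappa> * ln (L (x \<bullet> x)) \<le> 1" using that(2) \<kappa> by (meson mult_left_mono less_imp_le order.trans)
    then show ?thesis unfolding \<omega>_def by (rule cutoff_one)
  qed
  have grad: "(\<Sum>b\<in>Basis. (partial b \<omega> x)\<^sup>2) \<le> 4 * C\<^sup>2 * \<kappa>\<^sup>2 * ((x \<bullet> x) * (\<phi> (x \<bullet> x))\<^sup>2)" for x
  proof -
    let ?s = "x \<bullet> x"
    let ?c = "partial 1 cutoff (\<kappa> * ln (L ?s))"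
    have "partial b \<omega> x = ?c * (\<kappa> * (- \<phi> ?s * (2 * (x \<bullet> b))))" for b
    proof -
      have dl: "((\<lambda>s. \<kappa> * ln (L s)) has_real_derivative \<kappa> * - \<phi> ?s) (at ?s)"
      proof -
        have "(L has_real_derivative 1 / (?s + 1) - 1 / (?s + d)) (at ?s)"
          unfolding L_def using d inner_ge_zero[of x] by (auto intro!: derivative_eq_intros simp: add_nonneg_pos)
        from DERIV_cmult[OF DERIV_chain2[OF DERIV_ln_divide[OF L0[of ?s]] this], of \<kappa>]
        have a: "((\<lambda>s. \<kappa> * ln (L s)) has_real_derivative \<kappa> * (1 / L ?s * (1 / (?s + 1) - 1 / (?s + d)))) (at ?s)" by simp
        have b: "1 / L ?s * (1 / (?s + 1) - 1 / (?s + d)) = - \<phi> ?s"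
          unfolding \<phi>_def L_def[symmetric] by (simp add: minus_divide_left)
        show ?thesis using a unfolding b .
      qed
      have "partial b (\<lambda>x. \<kappa> * ln (L (x \<bullet> x))) x = \<kappa> * - \<phi> ?s * (2 * (x \<bullet> b))"
        using partial_compose[OF differentiable_inner_self partial_real_derivative(2)[OF dl], of b]
        by (simp add: partial_real_derivative(1)[OF dl] partial_inner_self)
      moreover have "partial b \<omega> x = ?c * partial b (\<lambda>x. \<kappa> * ln (L (x \<bullet> x))) x"
        unfolding \<omega>_def by (rule partial_compose) (use Clog[of 1] Ck_on_cutoff[of 1] in auto)
      ultimately show ?thesis by simp
    qed
    then have "(\<Sum>b\<in>Basis. (partial b \<omega> x)\<^sup>2) = (\<Sum>b\<in>Basis. 4 * ?c\<^sup>2 * \<kappa>\<^sup>2 * (\<phi> ?s)\<^sup>2 * (x \<bullet> b)\<^sup>2)"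
      by (simp add: power_mult_distrib mult_ac)
    also have "\<dots> = ?c\<^sup>2 * (4 * \<kappa>\<^sup>2 * (?s * (\<phi> ?s)\<^sup>2))"
      by (simp add: sum_distrib_left[symmetric] sum_inner_Basis_sq)
    also have "\<dots> \<le> C\<^sup>2 * (4 * \<kappa>\<^sup>2 * (?s * (\<phi> ?s)\<^sup>2))"
    proof (rule mult_right_mono)
      show "?c\<^sup>2 \<le> C\<^sup>2" using C by (metis abs_ge_zero power2_abs power_mono)
    qed simp
    finally show ?thesis by (simp add: mult_ac)
  qed
  show ?thesis
  proof (rule that[of \<omega> e])
    fix \<eta> :: "'a \<Rightarrow> real" and K
    assume \<eta>: "Ck_on 1 UNIV \<eta>" and K: "compact K" "\<And>x. x \<notin> K \<Longrightarrow> \<eta> x = 0"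
    note lh = log_hardy[OF dim d \<eta> K, folded \<phi>_def]
    have c\<eta>: "continuous_on UNIV \<eta>" using Ck_on_SucD[of 0 UNIV \<eta>] \<eta> by simp
    have cw: "continuous_on UNIV (\<lambda>x. \<Sum>b\<in>Basis. (partial b \<omega> x)\<^sup>2)"
      using C\<omega>[of 1] by (intro continuous_intros) simp
    have "(LINT x|lborel. (\<Sum>b\<in>Basis. (partial b \<omega> x)\<^sup>2) * (\<eta> x)\<^sup>2) \<le>
        (LINT x|lborel. 4 * C\<^sup>2 * \<kappa>\<^sup>2 * ((\<eta> x)\<^sup>2 * ((x \<bullet> x) * (\<phi> (x \<bullet> x))\<^sup>2)))"
    proof (rule integral_mono)
      show "integrable lborel (\<lambda>x. (\<Sum>b\<in>Basis. (partial b \<omega> x)\<^sup>2) * (\<eta> x)\<^sup>2)"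
        by (rule compact_support_integrable[OF _ K(1)]) (auto intro!: continuous_on_mult continuous_on_power c\<eta> cw simp: K)
      show "integrable lborel (\<lambda>x. 4 * C\<^sup>2 * \<kappa>\<^sup>2 * ((\<eta> x)\<^sup>2 * ((x \<bullet> x) * (\<phi> (x \<bullet> x))\<^sup>2)))"
        by (rule compact_support_integrable[OF _ K(1)])
          (auto intro!: continuous_on_mult continuous_on_power continuous_on_const c\<eta> lh(1) simp: K)
      show "(\<Sum>b\<in>Basis. (partial b \<omega> x)\<^sup>2) * (\<eta> x)\<^sup>2 \<le> 4 * C\<^sup>2 * \<kappa>\<^sup>2 * ((\<eta> x)\<^sup>2 * ((x \<bullet> x) * (\<phi> (x \<bullet> x))\<^sup>2))" for x
        using mult_right_mono[OF grad[of x], of "(\<eta> x)\<^sup>2"] by (simp add: mult_ac)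
    qed
    also have "\<dots> = 4 * C\<^sup>2 * \<kappa>\<^sup>2 * (LINT x|lborel. (\<eta> x)\<^sup>2 * ((x \<bullet> x) * (\<phi> (x \<bullet> x))\<^sup>2))" by simp
    also have "\<dots> \<le> 4 * C\<^sup>2 * \<kappa>\<^sup>2 * ((LINT x|lborel. (\<Sum>b\<in>Basis. (partial b \<eta> x)\<^sup>2)) + 4 * (LINT x|lborel. (\<eta> x)\<^sup>2))"
      by (intro mult_left_mono[OF lh(2)] mult_nonneg_nonneg) auto
    finally show "(LINT x|lborel. (\<Sum>b\<in>Basis. (partial b \<omega> x)\<^sup>2) * (\<eta> x)\<^sup>2) \<le>
        4 * C\<^sup>2 * \<kappa>\<^sup>2 * ((LINT x|lborel. (\<Sum>b\<in>Basis. (partial b \<eta> x)\<^sup>2)) + 4 * (LINT x|lborel. (\<eta> x)\<^sup>2))" .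
  qed (use C\<omega> z one e in \<open>auto simp: \<omega>_def cutoff_range\<close>)
qed

section \<open>Nonnegativity of the operator\<close>

text \<open>The cutoffs are products of a radial one of radius R and one at the origin, and both
  contribute an error of order 1/R to the localized form bound. The cutoffs tend to 1 off the
  origin, so dominated convergence finishes the proof.\<close>

lemma real_form_nonneg:
  fixes f g :: "'a::euclidean_space \<Rightarrow> real"
  defines "M \<equiv> \<lambda>D. lebesgue_on D"
  assumes dim: "DIM('a) \<ge> 2" and D: "open D" and f: "sqint (M D) f" and g: "sqint (M D) g"
    and weak: "\<And>\<theta>. test_function (D - {0}) \<theta> \<Longrightarrow>
      (LINT x|M D. f x * (- laplacian \<theta> x + V x * \<theta> x)) = (LINT x|M D. g x * \<theta> x)"
    and V: "continuous_on (- {0}) V"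
    and form: "\<And>\<theta>. test_function (D - {0}) \<theta> \<Longrightarrow>
      0 \<le> (LINT x|lborel. (\<Sum>b\<in>Basis. (partial b \<theta> x)\<^sup>2)) + (LINT x|lborel. V x * (\<theta> x)\<^sup>2)"
    and approx: "\<And>R. R > 0 \<Longrightarrow> \<exists>\<eta> F. (\<forall>k. test_function D (\<eta> k)) \<and>
      L2_lim (M D) \<eta> (\<lambda>x. cutoff (1 / R\<^sup>2 * (x \<bullet> x)) * f x) \<and>
      (\<forall>b\<in>Basis. L2_lim (M D) (\<lambda>k. partial b (\<eta> k)) (F b))"
  shows "0 \<le> (LINT x|M D. g x * f x)"
proof -
  let ?M = "M D"
  obtain C where C: "\<And>s. \<bar>partial 1 cutoff s\<bar> \<le> C" "C > 0" "\<forall>s. s < 1 \<or> s > 2 \<longrightarrow> partial 1 cutoff s = 0"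
    using cutoff_deriv by blast
  \<comment> \<open>The first summand bounds the error of the radial cutoff, the 1 that of the
    cutoff at the origin.\<close>
  define A where "A = 16 * C\<^sup>2 * (nrm ?M f)\<^sup>2 + 1"
  \<comment> \<open>The region on which \<zeta> is required to be 1 exhausts the punctured space as
    n grows.\<close>
  define P where "P n \<zeta> \<longleftrightarrow> continuous_on UNIV \<zeta> \<and> (\<forall>x. 0 \<le> \<zeta> x \<and> \<zeta> x \<le> 1) \<and>
      (\<forall>x. x \<noteq> 0 \<longrightarrow> norm x \<le> real (Suc n) \<longrightarrow> ln (ln (1 + 1 / (x \<bullet> x))) \<le> real (Suc n) \<longrightarrow> \<zeta> x = 1) \<and>
      - A / real (Suc n) \<le> (LINT x|?M. (\<zeta> x)\<^sup>2 * (g x * f x))" for n and \<zeta> :: "'a \<Rightarrow> real"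
  have "\<exists>\<zeta>. P n \<zeta>" for n
  proof -
    define R where "R = real (Suc n)"
    have R: "R \<ge> 1" unfolding R_def by simp
    then have R0: "R > 0" "2 * R > 0" by auto
    define \<rho> where "\<rho> x = cutoff (1 / R\<^sup>2 * (x \<bullet> x))" for x :: 'a
    \<comment> \<open>Twice the radius, so that it is 1 on the ball outside of which \<rho>
      vanishes; the approximating test functions are those for \<open>\<zeta>1 * f\<close>.\<close>
    define \<zeta>1 where "\<zeta>1 x = cutoff (1 / (2 * R)\<^sup>2 * (x \<bullet> x))" for x :: 'a
    note \<rho> = radial_cutoff[where 'a='a, OF R0(1) C(1,3), folded \<rho>_def]
    note \<zeta>1 = radial_cutoff[where 'a='a, OF R0(2) C(1,3), folded \<zeta>1_def]
    obtain \<eta> F where \<eta>: "\<And>k. test_function D (\<eta> k)" "L2_lim ?M \<eta> (\<lambda>x. \<zeta>1 x * f x)"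
      and F: "\<And>b. b \<in> Basis \<Longrightarrow> L2_lim ?M (\<lambda>k. partial b (\<eta> k)) (F b)"
      using approx[OF R0(2)] unfolding \<zeta>1_def by blast
    define h where "h x = \<zeta>1 x * f x" for x
    have h: "L2_lim ?M \<eta> h" using \<eta>(2) unfolding h_def .
    \<comment> \<open>The limit of the right side of the Hardy estimate for \<open>\<eta> k\<close>,
      without its factor: essentially the squared H^1 norm of \<open>\<zeta>1 * f\<close>.\<close>
    define B where "B = (\<Sum>b\<in>Basis. LINT x|?M. F b x * F b x) + 4 * (LINT x|?M. h x * h x)"
    have B: "B \<ge> 0" unfolding B_def by (intro add_nonneg_nonneg sum_nonneg mult_nonneg_nonneg integral_nonneg_AE) auto
    \<comment> \<open>Two demands: \<kappa> is at most 1/R, so that \<omega> is 1 where the double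
      logarithm is at most R, and \<kappa> times 8 C^2 B is at most 1/R, which controls the Hardy
      error.\<close>
    define \<kappa> where "\<kappa> = 1 / (R * (1 + 8 * C\<^sup>2 * B))"
    have B1: "1 + 8 * C\<^sup>2 * B \<ge> 1" using B by simp
    have RB: "R * (1 + 8 * C\<^sup>2 * B) \<ge> 1"
      using mult_mono[OF R B1] R by simp
    have \<kappa>: "\<kappa> > 0" "\<kappa> \<le> 1" "\<kappa> \<le> 1 / R" "\<kappa> * (8 * C\<^sup>2 * B) \<le> 1 / R"
    proof -
      show "\<kappa> > 0" "\<kappa> \<le> 1" unfolding \<kappa>_def using RB by auto
      have q: "1 + 8 * C\<^sup>2 * B > 0" using B1 by linarith
      show "\<kappa> \<le> 1 / R" unfolding \<kappa>_def using mult_left_mono[OF B1, of R] R by (intro frac_le) linarith+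
      have "\<kappa> * (8 * C\<^sup>2 * B) \<le> \<kappa> * (1 + 8 * C\<^sup>2 * B)" using \<open>\<kappa> > 0\<close> by (intro mult_left_mono) auto
      also have "\<dots> = 1 / R"
      proof -
        have "1 / (R * q) * q = 1 / R" if "q > 0" for q using that R by simp
        then show ?thesis unfolding \<kappa>_def using q by blast
      qed
      finally show "\<kappa> * (8 * C\<^sup>2 * B) \<le> 1 / R" .
    qed
    obtain \<omega> :: "'a \<Rightarrow> real" and e where \<omega>: "\<And>k. Ck_on k UNIV \<omega>" "\<And>x. 0 \<le> \<omega> x \<and> \<omega> x \<le> 1"
      and e: "e > 0" "\<And>x. norm x < e \<Longrightarrow> \<omega> x = 0"
      and \<omega>1: "\<And>x. x \<noteq> 0 \<Longrightarrow> \<kappa> * ln (ln (1 + 1 / (x \<bullet> x))) \<le> 1 \<Longrightarrow> \<omega> x = 1"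
      and hardy: "\<And>\<eta> K. Ck_on 1 UNIV \<eta> \<Longrightarrow> compact K \<Longrightarrow> (\<And>x. x \<notin> K \<Longrightarrow> \<eta> x = 0) \<Longrightarrow>
        (LINT x|lborel. (\<Sum>b\<in>Basis. (partial b \<omega> x)\<^sup>2) * (\<eta> x)\<^sup>2) \<le>
        4 * C\<^sup>2 * \<kappa>\<^sup>2 * ((LINT x|lborel. (\<Sum>b\<in>Basis. (partial b \<eta> x)\<^sup>2)) + 4 * (LINT x|lborel. (\<eta> x)\<^sup>2))"
    proof (rule origin_cutoff[OF dim \<kappa>(1) C(1)], goal_cases)
      case (1 \<omega> e)
      show thesis by (rule that) (fact 1)+
    qed
    define \<zeta> where "\<zeta> x = \<rho> x * \<omega> x" for x
    have \<zeta>S: "Ck_on k UNIV \<zeta>" for k unfolding \<zeta>_def by (intro Ck_on_mult \<rho>(1) \<omega>(1) open_UNIV)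
    define K where "K = cball (0::'a) (2 * R) - ball 0 e"
    have K: "compact K" "K \<subseteq> - {0}" unfolding K_def using e(1) by (auto intro: compact_diff)
    have \<zeta>0: "\<zeta> x = 0" if "x \<notin> K" for x
      using that \<rho>(4)[of x] e(2)[of x] unfolding \<zeta>_def K_def by auto
    have \<zeta>1K: "\<zeta>1 x = 1" if "x \<in> K" for x using that \<zeta>1(3)[of x] unfolding K_def by auto
    define N where "N x = (\<Sum>b\<in>Basis. (partial b \<zeta> x)\<^sup>2)" for x
    define W where "W x = (\<Sum>b\<in>Basis. (partial b \<omega> x)\<^sup>2)" for x
    define w where "w x = (\<rho> x)\<^sup>2 * W x" for x
    have loc: "0 \<le> (LINT x|?M. (\<zeta> x)\<^sup>2 * (g x * f x)) + (LINT x|?M. N x * (f x)\<^sup>2)"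
      unfolding N_def M_def
      by (rule localized_form_bound[OF D f[unfolded M_def] g[unfolded M_def] weak[unfolded M_def] V form \<zeta>S K \<zeta>0 \<zeta>1K \<eta>[unfolded M_def] F[unfolded M_def]])
    have c\<rho>: "continuous_on UNIV \<rho>" "\<rho> differentiable at x" for x using Ck_on_1D[OF \<rho>(1)] by auto
    have c\<omega>: "continuous_on UNIV \<omega>" "\<omega> differentiable at x" "b \<in> Basis \<Longrightarrow> continuous_on UNIV (partial b \<omega>)" for x b
      using Ck_on_1D[OF \<omega>(1)] by auto
    have cN: "continuous_on UNIV N" unfolding N_def by (intro continuous_intros Ck_on_1D(3)[OF \<zeta>S])
    have cW: "continuous_on UNIV W" unfolding W_def by (intro continuous_intros c\<omega>)
    have cw: "continuous_on UNIV w" unfolding w_def by (intro continuous_intros c\<rho> cW)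
    have N0: "N x = 0" if "x \<notin> K" for x
      unfolding N_def using partial_zero_outside[OF compact_imp_closed[OF K(1)] \<zeta>0 that] by simp
    have w0: "w x = 0" if "x \<notin> cball 0 (2 * R)" for x unfolding w_def using \<rho>(4)[OF that] by simp
    have W0: "W x \<ge> 0" for x unfolding W_def by (intro sum_nonneg) auto
    \<comment> \<open>The product rule and (y + z)^2 \<le> 2 y^2 + 2 z^2, with \<omega> at most 1 in
      the first part. The factor \<rho>^2 is kept in \<open>w\<close> because it confines the second
      part to the ball where \<open>\<zeta>1\<close> is 1.\<close>
    have Nle: "N x \<le> 16 * C\<^sup>2 / R\<^sup>2 + 2 * w x" for x
    proof -
      have "(partial b \<zeta> x)\<^sup>2 \<le> 2 * (partial b \<rho> x)\<^sup>2 + 2 * ((\<rho> x)\<^sup>2 * (partial b \<omega> x)\<^sup>2)" for b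
      proof -
        have p: "partial b \<zeta> x = \<rho> x * partial b \<omega> x + partial b \<rho> x * \<omega> x"
          unfolding \<zeta>_def by (rule partial_mult[OF c\<rho>(2) c\<omega>(2)])
        have "(y + z)\<^sup>2 \<le> 2 * z\<^sup>2 + 2 * y\<^sup>2" for y z :: real
          using sum_squares_bound[of y z] by (simp add: power2_sum)
        then have "(partial b \<zeta> x)\<^sup>2 \<le> 2 * (partial b \<rho> x * \<omega> x)\<^sup>2 + 2 * (\<rho> x * partial b \<omega> x)\<^sup>2" unfolding p .
        moreover have "(partial b \<rho> x * \<omega> x)\<^sup>2 \<le> (partial b \<rho> x)\<^sup>2"
          using mult_left_mono[of "(\<omega> x)\<^sup>2" 1 "(partial b \<rho> x)\<^sup>2"] \<omega>(2)[of x]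
          by (simp add: power_mult_distrib power_le_one)
        ultimately show ?thesis by (simp add: power_mult_distrib)
      qed
      then have "N x \<le> (\<Sum>b\<in>Basis. 2 * (partial b \<rho> x)\<^sup>2 + 2 * ((\<rho> x)\<^sup>2 * (partial b \<omega> x)\<^sup>2))"
        unfolding N_def by (intro sum_mono)
      also have "\<dots> = 2 * (\<Sum>b\<in>Basis. (partial b \<rho> x)\<^sup>2) + 2 * w x"
        unfolding w_def W_def by (simp add: sum.distrib sum_distrib_left)
      also have "\<dots> \<le> 2 * (8 * C\<^sup>2 / R\<^sup>2) + 2 * w x" using \<rho>(5)[of x] by simp
      finally show ?thesis by simp
    qed
    have meas: "v \<in> borel_measurable ?M" if "continuous_on UNIV v" for v :: "'a \<Rightarrow> real"
      unfolding M_def by (rule continuous_measurable_lebesgue_on[OF that])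
    obtain Cw where Cw: "\<And>x. \<bar>w x\<bar> \<le> Cw" using compact_support_bounded[OF cw compact_cball w0] by blast
    obtain CN where CN: "\<And>x. \<bar>N x\<bar> \<le> CN" using compact_support_bounded[OF cN K(1) N0] by blast
    have iw: "integrable ?M (\<lambda>x. w x * (f x)\<^sup>2)"
      using sqint_mult_integrable[OF sqint_mult_bounded[OF f meas[OF cw], of Cw] f] Cw
      by (simp add: power2_eq_square mult.assoc)
    have iN: "integrable ?M (\<lambda>x. N x * (f x)\<^sup>2)"
      using sqint_mult_integrable[OF sqint_mult_bounded[OF f meas[OF cN], of CN] f] CN
      by (simp add: power2_eq_square mult.assoc)
    have if2: "integrable ?M (\<lambda>x. (f x)\<^sup>2)" using f unfolding sqint_def by simp
    have "(LINT x|?M. N x * (f x)\<^sup>2) \<le> (LINT x|?M. 16 * C\<^sup>2 / R\<^sup>2 * (f x)\<^sup>2 + 2 * (w x * (f x)\<^sup>2))"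
    proof (rule integral_mono[OF iN])
      show "N x * (f x)\<^sup>2 \<le> 16 * C\<^sup>2 / R\<^sup>2 * (f x)\<^sup>2 + 2 * (w x * (f x)\<^sup>2)" for x
        using mult_right_mono[OF Nle[of x], of "(f x)\<^sup>2"] by (simp add: distrib_right)
    qed (use if2 iw in auto)
    also have "\<dots> = 16 * C\<^sup>2 / R\<^sup>2 * (nrm ?M f)\<^sup>2 + 2 * (LINT x|?M. w x * (f x)\<^sup>2)"
      using if2 iw unfolding nrm_sq by simp
    \<comment> \<open>\<open>hardy\<close> needs C^1 functions, so it is applied to the approximants
      \<open>\<eta> j\<close> and passed to the limit; multiplication by the bounded
      \<open>w\<close> is continuous in mean square.\<close>
    also have "(LINT x|?M. w x * (f x)\<^sup>2) \<le> 4 * C\<^sup>2 * \<kappa>\<^sup>2 * B"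
    proof -
      have e1: "w x * (f x)\<^sup>2 = (w x * h x) * h x" for x
        using \<zeta>1(3)[of x] w0[of x] unfolding h_def by (cases "x \<in> cball 0 (2 * R)") (auto simp: power2_eq_square)
      have l1: "(\<lambda>j. LINT x|?M. (w x * \<eta> j x) * \<eta> j x) \<longlonglongrightarrow> (LINT x|?M. (w x * h x) * h x)"
        by (intro L2_lim_inner L2_lim_mult[OF h meas[OF cw] Cw] h)
      have l2: "(\<lambda>j. 4 * C\<^sup>2 * \<kappa>\<^sup>2 * ((\<Sum>b\<in>Basis. LINT x|?M. partial b (\<eta> j) x * partial b (\<eta> j) x) + 4 * (LINT x|?M. \<eta> j x * \<eta> j x)))
          \<longlonglongrightarrow> 4 * C\<^sup>2 * \<kappa>\<^sup>2 * B"
        unfolding B_def by (intro tendsto_intros L2_lim_inner F h)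
      have "(LINT x|?M. (w x * \<eta> j x) * \<eta> j x) \<le>
          4 * C\<^sup>2 * \<kappa>\<^sup>2 * ((\<Sum>b\<in>Basis. LINT x|?M. partial b (\<eta> j) x * partial b (\<eta> j) x) + 4 * (LINT x|?M. \<eta> j x * \<eta> j x))" for j
      proof -
        obtain Kj where Kj: "compact Kj" "Kj \<subseteq> D" "\<And>x. x \<notin> Kj \<Longrightarrow> \<eta> j x = 0" "\<And>k. Ck_on k UNIV (\<eta> j)"
          using test_functionD[OF \<eta>(1)[of j]] by metis
        have c: "continuous_on UNIV (\<eta> j)" "b \<in> Basis \<Longrightarrow> continuous_on UNIV (partial b (\<eta> j))" for b
          using Ck_on_1D[OF Kj(4)] by auto
        have p0: "partial b (\<eta> j) x = 0" if "x \<notin> Kj" for b x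
          by (rule partial_zero_outside[OF compact_imp_closed[OF Kj(1)] Kj(3) that])
        have tr: "(LINT x|?M. v x) = (LINT x|lborel. v x)" "integrable lborel v"
          if "continuous_on UNIV v" "\<And>x. x \<notin> Kj \<Longrightarrow> v x = 0" for v :: "'a \<Rightarrow> real"
          unfolding M_def using compact_support_integral_lebesgue_on[OF that(1) Kj(1) that(2) Kj(2) D]
            compact_support_integrable[OF that(1) Kj(1) that(2)] by auto
        have "(LINT x|?M. (w x * \<eta> j x) * \<eta> j x) = (LINT x|lborel. (w x * \<eta> j x) * \<eta> j x)"
          by (rule tr(1)) (auto intro!: continuous_intros cw c simp: Kj(3))
        also have "\<dots> \<le> (LINT x|lborel. W x * (\<eta> j x)\<^sup>2)"
        proof (rule integral_mono)
          show "integrable lborel (\<lambda>x. (w x * \<eta> j x) * \<eta> j x)"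
            by (rule tr(2)) (auto intro!: continuous_intros cw c simp: Kj(3))
          show "integrable lborel (\<lambda>x. W x * (\<eta> j x)\<^sup>2)"
            by (rule tr(2)) (auto intro!: continuous_intros cW c simp: Kj(3))
          fix x
          have "(\<rho> x)\<^sup>2 * W x \<le> 1 * W x" using \<rho>(2)[of x] W0[of x] by (intro mult_right_mono power_le_one) auto
          then have "w x * (\<eta> j x)\<^sup>2 \<le> W x * (\<eta> j x)\<^sup>2" unfolding w_def by (intro mult_right_mono) auto
          then show "(w x * \<eta> j x) * \<eta> j x \<le> W x * (\<eta> j x)\<^sup>2" by (simp add: power2_eq_square mult.assoc)
        qed
        also have "\<dots> \<le> 4 * C\<^sup>2 * \<kappa>\<^sup>2 * ((LINT x|lborel. (\<Sum>b\<in>Basis. (partial b (\<eta> j) x)\<^sup>2)) + 4 * (LINT x|lborel. (\<eta> j x)\<^sup>2))"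
          unfolding W_def by (rule hardy[OF Kj(4,1,3)])
        also have "(LINT x|lborel. (\<eta> j x)\<^sup>2) = (LINT x|?M. \<eta> j x * \<eta> j x)"
          unfolding power2_eq_square by (rule tr(1)[symmetric]) (auto intro!: continuous_intros c simp: Kj(3))
        also have "(LINT x|lborel. (\<Sum>b\<in>Basis. (partial b (\<eta> j) x)\<^sup>2)) = (\<Sum>b\<in>Basis. LINT x|lborel. (partial b (\<eta> j) x)\<^sup>2)"
          by (rule Bochner_Integration.integral_sum) (auto intro!: tr(2) continuous_intros c simp: p0)
        also have "\<dots> = (\<Sum>b\<in>Basis. LINT x|?M. partial b (\<eta> j) x * partial b (\<eta> j) x)"
          unfolding power2_eq_square by (intro sum.cong refl tr(1)[symmetric]) (auto intro!: continuous_intros c simp: p0)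
        finally show ?thesis .
      qed
      then have "(LINT x|?M. (w x * h x) * h x) \<le> 4 * C\<^sup>2 * \<kappa>\<^sup>2 * B"
        by (intro LIMSEQ_le[OF l1 l2]) blast
      then show ?thesis unfolding e1 .
    qed
    also have "16 * C\<^sup>2 / R\<^sup>2 * (nrm ?M f)\<^sup>2 + 2 * (4 * C\<^sup>2 * \<kappa>\<^sup>2 * B) \<le> A / R"
    proof -
      have "2 * (4 * C\<^sup>2 * \<kappa>\<^sup>2 * B) = \<kappa> * (\<kappa> * (8 * C\<^sup>2 * B))" by (simp add: power2_eq_square)
      also have "\<dots> \<le> 1 * (1 / R)" using \<kappa> B by (intro mult_mono) auto
      finally have 1: "2 * (4 * C\<^sup>2 * \<kappa>\<^sup>2 * B) \<le> 1 / R" by simp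
      have "1 / R\<^sup>2 \<le> 1 / R" using R by (intro divide_left_mono) (auto simp: power2_eq_square)
      then have "16 * C\<^sup>2 * (nrm ?M f)\<^sup>2 * (1 / R\<^sup>2) \<le> 16 * C\<^sup>2 * (nrm ?M f)\<^sup>2 * (1 / R)"
        by (intro mult_left_mono) auto
      then show ?thesis using 1 unfolding A_def by (simp add: add_divide_distrib)
    qed
    finally have "(LINT x|?M. N x * (f x)\<^sup>2) \<le> A / R" by simp
    then have r1: "- A / real (Suc n) \<le> (LINT x|?M. (\<zeta> x)\<^sup>2 * (g x * f x))"
      using loc unfolding R_def by simp
    have r2: "continuous_on UNIV \<zeta>" by (rule Ck_on_continuous[OF \<zeta>S])
    have r3: "0 \<le> \<zeta> x \<and> \<zeta> x \<le> 1" for x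
      unfolding \<zeta>_def using \<rho>(2)[of x] \<omega>(2)[of x] by (simp add: mult_le_one)
    have r4: "\<zeta> x = 1" if x: "x \<noteq> 0" "norm x \<le> real (Suc n)" "ln (ln (1 + 1 / (x \<bullet> x))) \<le> real (Suc n)" for x
    proof -
      have "\<kappa> * ln (ln (1 + 1 / (x \<bullet> x))) \<le> \<kappa> * R"
        using x(3) \<kappa>(1) unfolding R_def by (intro mult_left_mono) auto
      also have "\<dots> \<le> 1 / R * R" using \<kappa>(3) R by (intro mult_right_mono) auto
      finally have "\<omega> x = 1" using R by (intro \<omega>1 x(1)) simp
      moreover have "\<rho> x = 1" using x(2) \<rho>(3)[of x] unfolding R_def by simp
      ultimately show ?thesis unfolding \<zeta>_def by simp
    qed
    show ?thesis
      unfolding P_def by (rule exI[of _ \<zeta>], intro conjI[OF r2] conjI[OF allI[OF r3]] conjI[OF _ r1] allI impI r4)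
  qed
  then obtain \<zeta> where "\<And>n. P n (\<zeta> n)" by metis
  then have \<zeta>: "\<And>n. continuous_on UNIV (\<zeta> n)" "\<And>n x. 0 \<le> \<zeta> n x \<and> \<zeta> n x \<le> 1"
    "\<And>n x. x \<noteq> 0 \<Longrightarrow> norm x \<le> real (Suc n) \<Longrightarrow> ln (ln (1 + 1 / (x \<bullet> x))) \<le> real (Suc n) \<Longrightarrow> \<zeta> n x = 1"
    "\<And>n. - A / real (Suc n) \<le> (LINT x|?M. (\<zeta> n x)\<^sup>2 * (g x * f x))"
    unfolding P_def by (blast, blast, blast, blast)
  have igf: "integrable ?M (\<lambda>x. g x * f x)" by (rule sqint_mult_integrable[OF g f])
  have "(\<lambda>n. LINT x|?M. (\<zeta> n x)\<^sup>2 * (g x * f x)) \<longlonglongrightarrow> (LINT x|?M. g x * f x)"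
  proof (rule integral_dominated_convergence)
    show "(\<lambda>x. g x * f x) \<in> borel_measurable ?M" using igf by simp
    show "(\<lambda>x. (\<zeta> n x)\<^sup>2 * (g x * f x)) \<in> borel_measurable ?M" for n
      using f g continuous_measurable_lebesgue_on[OF \<zeta>(1), of n D] unfolding sqint_def M_def
      by (intro borel_measurable_times borel_measurable_power) auto
    show "integrable ?M (\<lambda>x. \<bar>g x * f x\<bar>)" using igf by simp
    show "AE x in ?M. norm ((\<zeta> n x)\<^sup>2 * (g x * f x)) \<le> \<bar>g x * f x\<bar>" for n
    proof (rule AE_I2)
      fix x
      have "(\<zeta> n x)\<^sup>2 * \<bar>g x * f x\<bar> \<le> 1 * \<bar>g x * f x\<bar>"
        using \<zeta>(2)[of n x] by (intro mult_right_mono power_le_one) auto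
      then show "norm ((\<zeta> n x)\<^sup>2 * (g x * f x)) \<le> \<bar>g x * f x\<bar>" by (simp add: abs_mult)
    qed
    have "AE x in lebesgue. x \<noteq> (0::'a)" by (rule AE_completion[OF AE_lborel_singleton])
    then have "AE x in ?M. x \<noteq> 0" unfolding M_def
      by (subst AE_restrict_space_iff) (use D in \<open>auto simp: borel_open sets_completionI_sets\<close>)
    then show "AE x in ?M. (\<lambda>n. (\<zeta> n x)\<^sup>2 * (g x * f x)) \<longlonglongrightarrow> g x * f x"
    proof eventually_elim
      case (elim x)
      \<comment> \<open>At every point except the origin, a null set, the cutoffs are eventually
        equal to 1.\<close>
      obtain n0 where n0: "max (norm x) (ln (ln (1 + 1 / (x \<bullet> x)))) \<le> real n0" using real_arch_simple by blast
      have "eventually (\<lambda>n. (\<zeta> n x)\<^sup>2 * (g x * f x) = g x * f x) sequentially"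
      proof (rule eventually_sequentiallyI[of n0])
        fix n assume "n0 \<le> n"
        then have "max (norm x) (ln (ln (1 + 1 / (x \<bullet> x)))) \<le> real (Suc n)" using n0 by simp
        then show "(\<zeta> n x)\<^sup>2 * (g x * f x) = g x * f x" using \<zeta>(3)[OF elim, of n] by simp
      qed
      then show ?case by (rule tendsto_eventually)
    qed
  qed
  moreover have "(\<lambda>n. - A / real (Suc n)) \<longlonglongrightarrow> 0"
    using tendsto_mult_right_zero[OF LIMSEQ_inverse_real_of_nat, of "- A"] by (simp add: divide_inverse)
  ultimately show ?thesis using \<zeta>(4) by (intro LIMSEQ_le[of "\<lambda>n. - A / real (Suc n)" 0]) auto
qed

section \<open>From real to complex functions\<close>

lemma sqint_bounded_linear:
  fixes T :: "complex \<Rightarrow> real"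
  assumes T: "bounded_linear T" "\<And>z. \<bar>T z\<bar> \<le> cmod z" and f: "sqint M f"
  shows "sqint M (\<lambda>x. T (f x))" "nrm M (\<lambda>x. T (f x)) \<le> nrm M f"
proof -
  have m: "(\<lambda>x. T (f x)) \<in> borel_measurable M"
    by (rule borel_measurable_continuous_on[OF linear_continuous_on[OF T(1)]]) (use f in \<open>simp add: sqint_def\<close>)
  have le: "(norm (T z))\<^sup>2 \<le> (norm z)\<^sup>2" for z using T(2)[of z] by (intro power_mono) auto
  have i: "integrable M (\<lambda>x. (norm (T (f x)))\<^sup>2)"
    by (rule Bochner_Integration.integrable_bound[where f="\<lambda>x. (norm (f x))\<^sup>2"])
      (use f m le in \<open>auto simp: sqint_def intro!: borel_measurable_power borel_measurable_norm\<close>)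
  then show "sqint M (\<lambda>x. T (f x))" using m unfolding sqint_def by simp
  show "nrm M (\<lambda>x. T (f x)) \<le> nrm M f"
    unfolding nrm_def using f i le by (intro real_sqrt_le_mono integral_mono) (auto simp: sqint_def)
qed

text \<open>The Laplacian, \<open>V\<close> and the test functions are real, so a real-linear
  \<open>T\<close> that contracts and commutes with real factors carries the weak equation and the
  local Dirichlet condition to real functions. It is applied to the real and imaginary
  parts.\<close>

lemma dirichlet_graph_component_nonneg:
  fixes T :: "complex \<Rightarrow> real" and D :: "'a::euclidean_space set"
  assumes dim: "DIM('a) \<ge> 2" and D: "open D" and fg: "(f, g) \<in> dirichlet_graph D V"
    and V: "continuous_on (- {0}) V"
    and form: "\<And>\<theta>. test_function (D - {0}) \<theta> \<Longrightarrow>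
      0 \<le> (LINT x|lborel. (\<Sum>b\<in>Basis. (partial b \<theta> x)\<^sup>2)) + (LINT x|lborel. V x * (\<theta> x)\<^sup>2)"
    and T: "bounded_linear T" "\<And>z. \<bar>T z\<bar> \<le> cmod z" "\<And>r z. T (of_real r * z) = r * T z"
  shows "0 \<le> (LINT x|lebesgue_on D. T (g x) * T (f x))"
proof -
  let ?M = "lebesgue_on D"
  have f: "sqint ?M f" and g: "sqint ?M g" and loc: "f \<in> H10_loc D"
    using fg unfolding dirichlet_graph_def L2_iff by auto
  have eq: "(LINT x|?M. f x * of_real (- laplacian \<eta> x + V x * \<eta> x)) = (LINT x|?M. g x * of_real (\<eta> x))"
    if "test_function (D - {0}) \<eta>" for \<eta> :: "'a \<Rightarrow> real"
    using fg that unfolding dirichlet_graph_def by blast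
  note Tl = sqint_bounded_linear[OF T(1,2)]
  have TI: "T (LINT x|?M. k x * of_real (v x)) = (LINT x|?M. T (k x) * v x)"
    if "sqint ?M k" "sqint ?M v" for k and v :: "'a \<Rightarrow> real"
  proof -
    have "(\<lambda>x. complex_of_real (v x)) \<in> borel_measurable ?M"
      by (rule borel_measurable_continuous_on[OF linear_continuous_on[OF bounded_linear_of_real]])
        (use that(2) in \<open>simp add: sqint_def\<close>)
    then have "sqint ?M (\<lambda>x. complex_of_real (v x))" using that(2) unfolding sqint_def by simp
    then have "T (LINT x|?M. k x * of_real (v x)) = (LINT x|?M. T (k x * of_real (v x)))"
      by (intro integral_bounded_linear[OF T(1), symmetric] sqint_mult_integrable that(1))
    then show ?thesis using T(3) by (simp add: mult.commute)
  qed
  show ?thesis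
  proof (rule real_form_nonneg[OF dim D Tl(1)[OF f] Tl(1)[OF g] _ V form])
    fix \<theta> :: "'a \<Rightarrow> real" assume \<theta>: "test_function (D - {0}) \<theta>"
    obtain K where K: "compact K" "K \<subseteq> D - {0}" "\<And>x. x \<notin> K \<Longrightarrow> \<theta> x = 0" "\<And>k. Ck_on k UNIV \<theta>"
      using test_functionD[OF \<theta>] by metis
    have clK: "closed K" by (rule compact_imp_closed[OF K(1)])
    have c\<theta>: "continuous_on UNIV \<theta>" by (rule Ck_on_continuous[OF K(4)])
    have "Ck_on (Suc (Suc 0)) UNIV \<theta>" by (rule K(4))
    then have cl: "continuous_on UNIV (laplacian \<theta>)" unfolding laplacian_def[abs_def]
      by (intro continuous_on_sum) simp
    have l0: "laplacian \<theta> x = 0" if "x \<notin> K" for x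
      unfolding laplacian_def using partial_zero_outside[OF clK partial_zero_outside[OF clK K(3)] that] by simp
    have cV: "continuous_on UNIV (\<lambda>x. V x * \<theta> x)"
      by (rule continuous_on_glue[OF clK, where S="- {0}"])
        (use K in \<open>auto intro!: continuous_intros V continuous_on_subset[OF c\<theta>]\<close>)
    have s1: "sqint ?M (\<lambda>x. - laplacian \<theta> x + V x * \<theta> x)"
      by (rule compact_support_sqint[OF _ K(1) _ D]) (auto intro!: continuous_intros cl cV simp: l0 K(3))
    have s2: "sqint ?M \<theta>" by (rule compact_support_sqint[OF c\<theta> K(1,3) D])
    show "(LINT x|?M. T (f x) * (- laplacian \<theta> x + V x * \<theta> x)) = (LINT x|?M. T (g x) * \<theta> x)"
      unfolding TI[OF f s1, symmetric] TI[OF g s2, symmetric] eq[OF \<theta>] ..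
  next
    fix R :: real assume R: "R > 0"
    obtain C where C: "\<And>s. \<bar>partial 1 cutoff s\<bar> \<le> C" "\<forall>s. s < 1 \<or> s > 2 \<longrightarrow> partial 1 cutoff s = 0"
      using cutoff_deriv by blast
    define \<rho> where "\<rho> x = cutoff (1 / R\<^sup>2 * (x \<bullet> x))" for x :: 'a
    note \<rho> = radial_cutoff[where 'a='a, OF R C, folded \<rho>_def]
    have "test_function UNIV (\<lambda>x. complex_of_real (\<rho> x))"
    proof (rule test_functionI)
      show "complex_of_real (\<rho> x) = 0" if "x \<notin> cball 0 (2 * R)" for x using \<rho>(4)[OF that] by simp
      show "Ck_on k UNIV (\<lambda>x. complex_of_real (\<rho> x))" for k
        by (rule Ck_on_bounded_linear[OF open_UNIV bounded_linear_of_real \<rho>(1)])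
    qed auto
    then have "(\<lambda>x. complex_of_real (\<rho> x) * f x) \<in> H10 D" using loc unfolding H10_loc_def by blast
    then obtain \<eta> F where \<eta>: "\<And>k. test_function D (\<eta> k)"
        "(\<lambda>k. L2_norm D (\<lambda>x. \<eta> k x - complex_of_real (\<rho> x) * f x)) \<longlonglongrightarrow> 0"
      and F: "\<And>b. b \<in> Basis \<Longrightarrow> F b \<in> L2 D"
        "\<And>b. b \<in> Basis \<Longrightarrow> (\<lambda>k. L2_norm D (\<lambda>x. partial b (\<eta> k) x - F b x)) \<longlonglongrightarrow> 0"
      and \<rho>f: "(\<lambda>x. complex_of_real (\<rho> x) * f x) \<in> L2 D"
      unfolding H10_def by blast
    have sq: "sqint ?M v" if v: "continuous_on UNIV v" "compact K" "\<And>x. x \<notin> K \<Longrightarrow> v x = 0" for v :: "'a \<Rightarrow> complex" and K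
    proof -
      have "sqint ?M (\<lambda>x. norm (v x))"
        by (rule compact_support_sqint[OF _ v(2) _ D]) (use v in \<open>auto intro: continuous_on_norm\<close>)
      then show ?thesis using continuous_measurable_lebesgue_on[OF v(1)] unfolding sqint_def by simp
    qed
    have lim: "L2_lim ?M (\<lambda>k x. T (X k x)) (\<lambda>x. T (Y x))"
      if X: "\<And>k. sqint ?M (X k)" and Y: "sqint ?M Y" and l: "(\<lambda>k. L2_norm D (\<lambda>x. X k x - Y x)) \<longlonglongrightarrow> 0" for X Y
      unfolding L2_lim_def
    proof (intro conjI allI Tl(1) X Y)
      show "(\<lambda>k. nrm ?M (\<lambda>x. T (X k x) - T (Y x))) \<longlonglongrightarrow> 0"
      proof (rule Lim_null_comparison[OF always_eventually l], rule allI)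
        fix k
        have "(\<lambda>x. T (X k x) - T (Y x)) = (\<lambda>x. T (X k x - Y x))"
          using linear_diff[OF bounded_linear.linear[OF T(1)]] by auto
        then show "norm (nrm ?M (\<lambda>x. T (X k x) - T (Y x))) \<le> L2_norm D (\<lambda>x. X k x - Y x)"
          using Tl(2)[OF sqint_diff[OF X Y]] by (simp add: L2_norm_eq)
      qed
    qed
    \<comment> \<open>\<open>T\<close> contracts the norm and commutes with partial derivatives, so
      the images of the complex approximants approximate \<open>\<rho> * T f\<close> together with
      their gradients.\<close>
    define \<eta>' where "\<eta>' k x = T (\<eta> k x)" for k x
    define F' where "F' b x = T (F b x)" for b x
    have tf: "test_function D (\<eta>' k)" for k
    proof -
      obtain K where K: "compact K" "K \<subseteq> D" "\<And>x. x \<notin> K \<Longrightarrow> \<eta> k x = 0" "\<And>j. Ck_on j UNIV (\<eta> k)"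
        using test_functionD[OF \<eta>(1)[of k]] by metis
      show ?thesis unfolding \<eta>'_def
        by (rule test_functionI[OF K(1,2)])
          (use K(3) linear_0[OF bounded_linear.linear[OF T(1)]] in \<open>auto intro: Ck_on_bounded_linear[OF open_UNIV T(1) K(4)]\<close>)
    qed
    have s\<eta>: "sqint ?M (\<eta> k)" "b \<in> Basis \<Longrightarrow> sqint ?M (partial b (\<eta> k))"
      and p\<eta>: "partial b (\<eta>' k) = (\<lambda>x. T (partial b (\<eta> k) x))" for k b
    proof -
      obtain K where K: "compact K" "K \<subseteq> D" "\<And>x. x \<notin> K \<Longrightarrow> \<eta> k x = 0" "\<And>j. Ck_on j UNIV (\<eta> k)"
        using test_functionD[OF \<eta>(1)[of k]] by metis
      note c = Ck_on_1D[OF K(4)]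
      show "sqint ?M (\<eta> k)" by (rule sq[OF c(1) K(1,3)])
      have p0: "partial b (\<eta> k) x = 0" if "x \<notin> K" for x
      proof -
        have "partial b (\<eta> k) x = partial b (\<lambda>_. 0::complex) x"
          by (rule partial_cong[where S="- K"]) (use K that in \<open>auto simp: compact_imp_closed\<close>)
        also have "\<dots> = 0" by (rule partial_eqI) auto
        finally show ?thesis .
      qed
      show "sqint ?M (partial b (\<eta> k))" if "b \<in> Basis" by (rule sq[OF c(3)[OF that] K(1) p0])
      show "partial b (\<eta>' k) = (\<lambda>x. T (partial b (\<eta> k) x))"
        unfolding \<eta>'_def by (rule ext) (rule partial_bounded_linear[OF T(1) c(2)])
    qed
    have "L2_lim ?M \<eta>' (\<lambda>x. \<rho> x * T (f x))"
      using lim[OF s\<eta>(1) \<rho>f[unfolded L2_iff] \<eta>(2)] T(3) unfolding \<eta>'_def by simp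
    moreover have "L2_lim ?M (\<lambda>k. partial b (\<eta>' k)) (F' b)" if "b \<in> Basis" for b
      unfolding p\<eta> F'_def by (rule lim[OF s\<eta>(2)[OF that] F(1)[OF that, unfolded L2_iff] F(2)[OF that]])
    ultimately show "\<exists>\<eta> F. (\<forall>k. test_function D (\<eta> k)) \<and>
      L2_lim ?M \<eta> (\<lambda>x. cutoff (1 / R\<^sup>2 * (x \<bullet> x)) * T (f x)) \<and>
      (\<forall>b\<in>Basis. L2_lim ?M (\<lambda>k. partial b (\<eta> k)) (F b))"
      using tf unfolding \<rho>_def by blast
  qed
qed

text \<open>The real part of g times the conjugate of f splits into the products of the real and of
  the imaginary parts, each with nonnegative integral.\<close>

lemma dirichlet_graph_nonneg:
  fixes D :: "'a::euclidean_space set"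
  assumes "DIM('a) \<ge> 2" "open D" "(f, g) \<in> dirichlet_graph D V" "continuous_on (- {0}) V"
    and "\<And>\<theta>. test_function (D - {0}) \<theta> \<Longrightarrow>
      0 \<le> (LINT x|lborel. (\<Sum>b\<in>Basis. (partial b \<theta> x)\<^sup>2)) + (LINT x|lborel. V x * (\<theta> x)\<^sup>2)"
  shows "0 \<le> Re (L2_inner D g f)"
proof -
  let ?M = "lebesgue_on D"
  have f: "f \<in> L2 D" and g: "g \<in> L2 D" using assms(3) unfolding dirichlet_graph_def by auto
  note comp = dirichlet_graph_component_nonneg[OF assms]
  note s = sqint_bounded_linear(1)
  have R: "0 \<le> (LINT x|?M. Re (g x) * Re (f x))" and I: "0 \<le> (LINT x|?M. Im (g x) * Im (f x))"
    by (rule comp; simp add: bounded_linear_Re bounded_linear_Im abs_Re_le_cmod abs_Im_le_cmod)+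
  have iR: "integrable ?M (\<lambda>x. Re (g x) * Re (f x))" and iI: "integrable ?M (\<lambda>x. Im (g x) * Im (f x))"
    using f g unfolding L2_iff
    by (auto intro!: sqint_mult_integrable s bounded_linear_Re bounded_linear_Im abs_Re_le_cmod abs_Im_le_cmod)
  have "Re (L2_inner D g f) = (LINT x|?M. Re (g x * cnj (f x)))"
    unfolding L2_inner_def by (rule integral_Re[symmetric]) (rule L2_inner_integrable[OF g f])
  also have "\<dots> = (LINT x|?M. Re (g x) * Re (f x)) + (LINT x|?M. Im (g x) * Im (f x))"
    using iR iI by simp
  finally show ?thesis using R I by simp
qed

theorem theorem2:
  fixes a V :: "real ^ 'n \<Rightarrow> real" and \<beta> :: real
    and D :: "(real ^ 'n) set" and H :: "(real ^ 'n) graph"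
  assumes "CARD('n) \<ge> 2"
    and "0 < \<beta>" and "\<beta> \<le> 1"
    and "locally_holder_on \<beta> UNIV a" and "\<forall>x. a x \<ge> 0" and "\<exists>x. a x \<noteq> 0"
    and "locally_holder_on \<beta> (- {0}) V"
    and "Liminf (at 0) (\<lambda>x. ereal (V x)) > - \<infinity>"
    and "open D" and "connected D" and "D \<noteq> {}"
    and "(INF x\<in>D. a x) > 0"
    and "dirichlet_realization D V H" and "inf_spectrum D H < 0"
  shows "\<forall>p \<phi>. p > 1 \<and> bounded (range \<phi>) \<and> continuous_on UNIV \<phi> \<and>
           (\<forall>x. \<phi> x \<ge> 0) \<and> (\<exists>x. \<phi> x \<noteq> 0) \<longrightarrow>
           \<not> (\<exists>u. global_solution V a p \<phi> u)"
proof (intro allI impI notI)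
  fix p :: real and \<phi> :: "real ^ 'n \<Rightarrow> real"
  assume "p > 1 \<and> bounded (range \<phi>) \<and> continuous_on UNIV \<phi> \<and> (\<forall>x. \<phi> x \<ge> 0) \<and> (\<exists>x. \<phi> x \<noteq> 0)"
  then have p: "p > 1" and \<phi>: "continuous_on UNIV \<phi>" "\<forall>x. \<phi> x \<ge> 0" "\<exists>x. \<phi> x \<noteq> 0" by auto
  assume "\<exists>u. global_solution V a p \<phi> u"
  then obtain u where u: "global_solution V a p \<phi> u" by blast
  have dim: "DIM(real ^ 'n) \<ge> 2" using assms(1) by simp
  have V: "continuous_on (- {0}) V"
    by (rule locally_holder_imp_continuous[OF assms(7,2)]) auto
  have "bdd_below (a ` D)" using assms(5) by (intro bdd_belowI[of _ 0]) auto
  then have aD: "(INF x\<in>D. a x) \<le> a x" if "x \<in> D" for x using that by (rule cINF_lower)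
  \<comment> \<open>The supposed global solution enters only through this inequality; what follows
    concerns the operator alone.\<close>
  have form: "0 \<le> (LINT x|lborel. (\<Sum>b\<in>Basis. (partial b \<theta> x)\<^sup>2)) + (LINT x|lborel. V x * (\<theta> x)\<^sup>2)"
    if "test_function (D - {0}) \<theta>" for \<theta>
    using that
  proof (rule test_functionD)
    fix K assume K: "compact K" "K \<subseteq> D - {0}" "\<And>x. x \<notin> K \<Longrightarrow> \<theta> x = 0" "\<And>k. Ck_on k UNIV \<theta>"
    show ?thesis
      by (rule quadratic_form_nonneg[OF u p global_solution_positive[OF dim u V assms(5) \<phi>] V assms(12) aD K(4,1,2,3)])
  qed
  have "self_adjoint D H" and sub: "H \<subseteq> dirichlet_graph D V"
    using assms(13) unfolding dirichlet_realization_def by auto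
  \<comment> \<open>Every realization is contained in \<open>dirichlet_graph D V\<close>, on all of
    which the form bound holds, so no particular self-adjoint extension has to be
    identified.\<close>
  then have "0 \<le> inf_spectrum D H"
    using dirichlet_graph_nonneg[OF dim assms(9) _ V form] by (intro nonnegative_self_adjoint_inf_spectrum) blast+
  then show False using assms(14) by simp
qed

end
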